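(* There is an absolute positive constant $c>0$ such that the following holds. Let $d\ge 2$ be an integer, let $s:=d(d+3)$, let $0<N\le \frac{1}{40\pi\sqrt{d}}$, let $0<\delta<\infty$, and let $V\subset E(s,N)\subset\mathbb{R}^s$ be a convex set such that $$\frac{|E(4,N)|}{|\pi(V)|}\le\delta .$$ Then $$\frac{1}{|V|}\int_V C(v)\,dv\le c\,(\log\delta+\log d).$$
   Context: For an integer $d\ge 2$ consider the real planar polynomial system $$\dot x=-y+F(x,y),\qquad \dot y=x+G(x,y),$$ $$F(x,y)=\sum_{1\le i+k\le d}a_{ki}x^ky^i,\qquad G(x,y)=\sum_{1\le i+k\le d}b_{ki}x^ky^i,$$ where the indices $k,i$ are nonnegative integers. The real coefficients $(a_{ki}),(b_{ki})$ form a point $v\in\mathbb{R}^s$, with $s=d(d+3)$ the total number of coefficients, and $\mathbb{R}^s$ carries the Euclidean norm, $|v|^2=\sum|a_{ki}|^2+\sum|b_{ki}|^2$. $E(n,r)$ denotes the open Euclidean ball of radius $r$ in $\mathbb{R}^n$ centered at $0$. $C(v)$ is the number of limit cycles (isolated closed trajectories) of the system with coefficient vector $v$ that are situated in the disk $D_{1/2}=\{(x,y)\in\mathbb{R}^2:\ |x|^2+|y|^2\le 1/4\}$. $\pi:\mathbb{R}^s\to\mathbb{R}^4$ is the natural coordinate projection sending $v$ to the coefficients $(a_{10},a_{01},b_{10},b_{01})$ of the linear parts of $F$ and $G$. $|E(4,N)|$ and $|\pi(V)|$ are Lebesgue measures in $\mathbb{R}^4$. $|V|$ and $dv$ refer to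 Lebesgue measure in the real affine hull of $V$ (which may have dimension smaller than $s$). "Absolute" means that $c$ does not depend on $d,N,\delta,V$. *)

theory Defs
  imports "HOL-Analysis.Analysis" "HOL-Analysis.Finite_Function_Topology"
begin

(* The two components are the coefficient families (a_ki) and (b_ki), indexed by pairs (k, i).
   Finitely supported families form a real vector space, so convex and affine hull are the
   library notions while d remains a variable. *)
type_synonym coeffs = "((nat \<times> nat) \<Rightarrow>\<^sub>0 real) \<times> ((nat \<times> nat) \<Rightarrow>\<^sub>0 real)"

definition coeff_index :: "nat \<Rightarrow> (nat \<times> nat) set" where
  "coeff_index d = {(k, i). 1 \<le> i + k \<and> i + k \<le> d}"

lemma card_coeff_index: "2 * card (coeff_index d) = d * (d + 3)"
proof -
  have e: "coeff_index d = (SIGMA k:{..d}. {..d-k}) - {(0,0)}"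
    unfolding coeff_index_def by auto
  have "card (coeff_index d) = (\<Sum>k\<le>d. Suc (d-k)) - 1"
    unfolding e by (subst card_Diff_singleton) auto
  moreover have "(\<Sum>k\<le>d. Suc (d-k)) = (\<Sum>k\<le>d. Suc k)"
    by (rule sum.reindex_bij_witness[where i="\<lambda>k. d-k" and j="\<lambda>k. d-k"]) auto
  moreover have "2 * (\<Sum>k\<le>d. Suc k) = d * (d+3) + 2" by (induction d) (auto simp: algebra_simps)
  ultimately show ?thesis by linarith
qed

(* R^s for s = d (d + 3). *)
definition coeff_space :: "nat \<Rightarrow> coeffs set" where
  "coeff_space d = {(a, b). Poly_Mapping.keys a \<subseteq> coeff_index d \<and> Poly_Mapping.keys b \<subseteq> coeff_index d}"

(* The Euclidean norm on R^s. The norm that the type coeffs inherits from the library is a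
   different one (built from l^1 norms) and is not used. *)
definition coeff_norm :: "nat \<Rightarrow> coeffs \<Rightarrow> real" where
  "coeff_norm d v = sqrt ((\<Sum>p\<in>coeff_index d. \<bar>Poly_Mapping.lookup (fst v) p\<bar>\<^sup>2) +
                          (\<Sum>p\<in>coeff_index d. \<bar>Poly_Mapping.lookup (snd v) p\<bar>\<^sup>2))"

definition coeff_ball :: "nat \<Rightarrow> real \<Rightarrow> coeffs set" where
  "coeff_ball d r = {v \<in> coeff_space d. coeff_norm d v < r}"

(* (a_10, a_01, b_10, b_01); the index (1, 0) belongs to the monomial x, (0, 1) to y. *)
definition linear_part :: "coeffs \<Rightarrow> real ^ 4" where
  "linear_part v = vector [Poly_Mapping.lookup (fst v) (1, 0), Poly_Mapping.lookup (fst v) (0, 1),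
                           Poly_Mapping.lookup (snd v) (1, 0), Poly_Mapping.lookup (snd v) (0, 1)]"

definition poly_eval :: "nat \<Rightarrow> ((nat \<times> nat) \<Rightarrow>\<^sub>0 real) \<Rightarrow> real \<Rightarrow> real \<Rightarrow> real" where
  "poly_eval d a x y = (\<Sum>(k, i)\<in>coeff_index d. Poly_Mapping.lookup a (k, i) * x ^ k * y ^ i)"

definition vector_field :: "nat \<Rightarrow> coeffs \<Rightarrow> real \<times> real \<Rightarrow> real \<times> real" where
  "vector_field d v = (\<lambda>(x, y). (- y + poly_eval d (fst v) x y, x + poly_eval d (snd v) x y))"

definition closed_trajectory :: "nat \<Rightarrow> coeffs \<Rightarrow> (real \<times> real) set \<Rightarrow> bool" where
  "closed_trajectory d v S \<longleftrightarrow>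
     (\<exists>\<gamma> T. (\<forall>t. (\<gamma> has_vector_derivative vector_field d v (\<gamma> t)) (at t)) \<and>
            0 < T \<and> (\<forall>t. \<gamma> (t + T) = \<gamma> t) \<and> (\<exists>t. \<gamma> t \<noteq> \<gamma> 0) \<and> S = range \<gamma>)"

(* Isolated: some neighbourhood of S contains no other closed trajectory. *)
definition limit_cycle :: "nat \<Rightarrow> coeffs \<Rightarrow> (real \<times> real) set \<Rightarrow> bool" where
  "limit_cycle d v S \<longleftrightarrow> closed_trajectory d v S \<and>
     (\<exists>U. open U \<and> S \<subseteq> U \<and> (\<forall>S'. closed_trajectory d v S' \<and> S' \<subseteq> U \<longrightarrow> S' = S))"

(* C(v); an infinite number of limit cycles would give the value infinity. The norm on
   real \<times> real is the Euclidean one. *)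
definition num_limit_cycles :: "nat \<Rightarrow> coeffs \<Rightarrow> ennreal" where
  "num_limit_cycles d v = emeasure (count_space UNIV) {S. limit_cycle d v S \<and> S \<subseteq> cball 0 (1/2)}"

(* An isometry from Euclidean R^m, realised as {..<m} \<rightarrow>\<^sub>E UNIV, onto A. Such a map is
   injective when A is contained in coeff_space d. *)
definition isometric_chart ::
  "nat \<Rightarrow> coeffs set \<Rightarrow> nat \<Rightarrow> ((nat \<Rightarrow> real) \<Rightarrow> coeffs) \<Rightarrow> bool" where
  "isometric_chart d A m \<phi> \<longleftrightarrow>
     \<phi> ` ({..<m} \<rightarrow>\<^sub>E UNIV) = A \<and>
     (\<forall>x\<in>{..<m} \<rightarrow>\<^sub>E UNIV. \<forall>y\<in>{..<m} \<rightarrow>\<^sub>E UNIV.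
        coeff_norm d (\<phi> x - \<phi> y) = L2_set (\<lambda>j. x j - y j) {..<m})"

(* Lebesgue measure of a nonempty affine subspace A of coeff_space d: Lebesgue measure of R^m,
   m = dim A, transported along an isometry. The choice of isometry is immaterial since Lebesgue
   measure is invariant under Euclidean isometries. *)
definition affine_lebesgue :: "nat \<Rightarrow> coeffs set \<Rightarrow> coeffs measure" where
  "affine_lebesgue d A =
     (case (SOME (m, \<phi>). isometric_chart d A m \<phi>) of
        (m, \<phi>) \<Rightarrow> embed_measure (completion (\<Pi>\<^sub>M j\<in>{..<m}. (lborel :: real measure))) \<phi>)"

end

theory Submission
  imports Defs "HOL-Complex_Analysis.Complex_Analysis"
begin

text \<open>In polar coordinates the logarithm of the radius satisfies d(ln r)/d phi = slope, where for small coefficients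
  slope is a holomorphic function of the complexified radius. Hence the increment G(x) of ln r over one turn, started
  at (x, 0), is holomorphic in |x| < 7/10; it is bounded there by a multiple of sqrt d N, it satisfies |G(0)| \<ge> 2 |tau|
  for the trace tau = a10 + b01, and every closed trajectory in the disk of radius 1/2 meets the positive x-axis in
  a zero of G that determines it. Jensen's inequality therefore gives at most 3 ln (13 sqrt d N / |tau|) limit cycles.

  It remains to average this logarithm. Since the linear parts of V fill a proportion at least 1/delta of the ball,
  |tau| \<ge> N / (32 delta) at some point of V. Homotheties towards that point show that the part of V where |tau| < e
  has relative volume O(d^2 delta e / N), and summing over e = e0 exp(-k) gives O(ln delta + ln d).\<close>

section \<open>Zeros of holomorphic functions\<close>

text \<open>Working with ln r instead of r removes the trivial zero of the return map at the origin:
  the value G(0) that remains depends on the linear part alone and is bounded below by its trace,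
  which is why only the projection of V to the linear coefficients enters the hypothesis. Only the
  radius is complexified while the angle stays real, so the angular speed must stay away from 0 for
  all complex radii in the unit disk; Cauchy-Schwarz over the monomials costs sqrt d, and this is
  the origin of the condition N <= 1/(40 pi sqrt d). It makes ln r drift by at most 6/59 per turn,
  so that initial radii below 7/10 never leave the unit disk. Two obstacles lie outside the study of
  a single system. The count C(v) must be shown measurable, which rests on closedness of the set of
  coefficients that admit a closed orbit meeting a given compact interval of the positive axis. And
  V need be neither closed nor full-dimensional, so volumes are computed for the closure in an
  isometric chart, with constants that depend only on an upper bound for the dimension.\<close>

lemma abs_deriv_le_imp_exp_bound:
  fixes h h' :: "real \<Rightarrow> real"
  assumes D: "\<And>t. (h has_real_derivative h' t) (at t)"
    and B: "\<And>t. \<bar>h' t\<bar> \<le> K * h t"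
  shows "h t \<le> h s * exp (K * \<bar>t - s\<bar>)"
proof (cases "s \<le> t")
  case True
  \<comment> \<open>Gronwall with an integrating factor; the sign in its exponent depends on the
    direction of time, hence the two cases.\<close>
  have "h t * exp (-K * t) \<le> h s * exp (-K * s)"
  proof (rule DERIV_nonpos_imp_nonincreasing[OF True])
    fix x
    have "((\<lambda>x. h x * exp (-K * x)) has_real_derivative (h' x - K * h x) * exp (-K * x)) (at x)"
      by (auto intro!: derivative_eq_intros D simp: algebra_simps)
    moreover have "(h' x - K * h x) * exp (-K * x) \<le> 0"
      using B[of x] by (intro mult_nonpos_nonneg) auto
    ultimately show "\<exists>y. ((\<lambda>x. h x * exp (-K * x)) has_real_derivative y) (at x) \<and> y \<le> 0" by blast
  qed
  then have "h t * exp (-K * t) * exp (K * t) \<le> h s * exp (-K * s) * exp (K * t)"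
    by (intro mult_right_mono) auto
  with True show ?thesis by (simp add: mult.assoc flip: exp_add) (simp add: algebra_simps)
next
  case False
  have "h t * exp (K * t) \<le> h s * exp (K * s)"
  proof (rule DERIV_nonneg_imp_nondecreasing[of t s])
    show "t \<le> s" using False by simp
  next
    fix x
    have "((\<lambda>x. h x * exp (K * x)) has_real_derivative (h' x + K * h x) * exp (K * x)) (at x)"
      by (auto intro!: derivative_eq_intros D simp: algebra_simps)
    moreover have "(h' x + K * h x) * exp (K * x) \<ge> 0"
      using B[of x] by (intro mult_nonneg_nonneg) auto
    ultimately show "\<exists>y. ((\<lambda>x. h x * exp (K * x)) has_real_derivative y) (at x) \<and> 0 \<le> y" by blast
  qed
  then have "h t * exp (K * t) * exp (-K * t) \<le> h s * exp (K * s) * exp (-K * t)"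
    by (intro mult_right_mono) auto
  with False show ?thesis by (simp add: mult.assoc flip: exp_add) (simp add: algebra_simps)
qed

text \<open>The form in which Gronwall's bound is used for polar coordinates: it shows that the
  origin is never reached in finite time, and that the turn-to-turn increment of ln r vanishes
  identically once it vanishes at one angle.\<close>

lemma abs_deriv_le_imp_eq_0:
  fixes h h' :: "real \<Rightarrow> real"
  assumes "\<And>t. (h has_real_derivative h' t) (at t)" "\<And>t. \<bar>h' t\<bar> \<le> K * h t"
    and "\<And>t. h t \<ge> 0" "h s = 0"
  shows "h t = 0"
  using abs_deriv_le_imp_exp_bound[of h h' K t s, OF assms(1,2)] assms(3)[of t] assms(4) by simp

text \<open>Schwarz-Pick: precomposition with the disk automorphism that takes 0 to a moves the zero
  to 0, where the Schwarz lemma applies.\<close>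

lemma divide_Moebius_bound:
  assumes hol: "g holomorphic_on ball 0 1" and bd: "\<And>z. norm z < 1 \<Longrightarrow> norm (g z) < 1"
    and a: "norm a < 1" "g a = 0" and w: "norm w < 1"
  shows "norm (g w) \<le> norm (Moebius_function 0 a w)"
proof -
  define T where "T = Moebius_function 0 (-a)"
  have Tb: "norm (T z) < 1" if "norm z < 1" for z
    unfolding T_def using a that by (intro Moebius_function_norm_lt_1) auto
  have 1: "(g \<circ> T) holomorphic_on ball 0 1"
    unfolding T_def using a Tb unfolding T_def
    by (intro holomorphic_on_compose_gen[OF Moebius_function_holomorphic hol]) auto
  have T0: "T 0 = a" unfolding T_def by (simp add: Moebius_function_of_zero)
  have "norm ((g \<circ> T) (Moebius_function 0 a w)) \<le> norm (Moebius_function 0 a w)"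
    by (rule Schwarz_Lemma(1)[OF 1]) (use T0 a bd Tb w Moebius_function_norm_lt_1 in auto)
  moreover have "T (Moebius_function 0 a w) = w"
    unfolding T_def by (rule Moebius_function_compose) (use a w in auto)
  ultimately show ?thesis by simp
qed

text \<open>One Blaschke factor is split off without raising the bound, although that factor has
  modulus below 1 inside the disk. Off a this is the Schwarz-Pick estimate; at a it follows by
  continuity of the quotient.\<close>

lemma divide_zero_bound:
  assumes hol: "g holomorphic_on ball 0 1" and bd: "\<And>z. norm z < 1 \<Longrightarrow> norm (g z) \<le> 1"
    and a: "norm a < 1" "g a = 0"
  shows "\<exists>k. k holomorphic_on ball 0 1 \<and> (\<forall>z. norm z < 1 \<longrightarrow> norm (k z) \<le> 1) \<and>
           (\<forall>z. norm z < 1 \<longrightarrow> g z = k z * Moebius_function 0 a z)"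
proof -
  obtain q where q: "q holomorphic_on ball 0 1" "\<And>z. norm z < 1 \<Longrightarrow> g z = (z - a) * q z"
  proof -
    define q where "q z = (if z = a then deriv g a else (g z - g a) / (z - a))" for z
    have "q holomorphic_on ball 0 1"
      unfolding q_def by (rule pole_lemma_open[OF hol]) simp
    moreover have "g z = (z - a) * q z" for z using a by (auto simp: q_def)
    ultimately show ?thesis using that by blast
  qed
  \<comment> \<open>The factor 1 - cnj a * z is the denominator of the Moebius map, so
    \<open>k\<close> is the quotient of g by that map, with the singularity at a already removed in
    \<open>q\<close>.\<close>
  define k where "k z = q z * (1 - cnj a * z)" for z
  have nz: "1 - cnj a * z \<noteq> 0" if "norm z < 1" for z
  proof
    assume "1 - cnj a * z = 0"
    then have "norm (cnj a * z) = 1" by simp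
    then show False using a that by (metis complex_mod_cnj less_irrefl norm_mult norm_mult_less mult_1)
  qed
  have hk: "k holomorphic_on ball 0 1" unfolding k_def by (intro holomorphic_intros q)
  have gk: "g z = k z * Moebius_function 0 a z" if "norm z < 1" for z
    using nz[OF that] q(2)[OF that] by (simp add: k_def Moebius_function_simple)
  have off: "norm (k z) \<le> 1" if z: "norm z < 1" "z \<noteq> a" for z
  proof -
    have Mz: "norm (Moebius_function 0 a z) > 0"
      using nz[OF z(1)] z by (simp add: Moebius_function_simple)
    \<comment> \<open>Schwarz-Pick wants |g| < 1 strictly; scaling by \<epsilon> < 1 provides this,
      and \<epsilon> tends to 1 afterwards.\<close>
    have "norm (\<epsilon> * g z) \<le> norm (Moebius_function 0 a z)" if "norm \<epsilon> < 1" for \<epsilon>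
      using divide_Moebius_bound[of "\<lambda>z. \<epsilon> * g z" a z]
    proof -
      have "norm (\<epsilon> * g z) < 1" if "norm z < 1" for z
        using bd[OF that] \<open>norm \<epsilon> < 1\<close>
        by (metis mult.right_neutral mult_left_mono norm_ge_zero norm_mult order.strict_trans1)
      then show ?thesis
        using a z by (intro divide_Moebius_bound) (auto intro!: holomorphic_intros hol)
    qed
    then have le: "\<epsilon> * norm (g z) \<le> norm (Moebius_function 0 a z)" if "0 < \<epsilon>" "\<epsilon> < 1" for \<epsilon>
      using that by (metis abs_of_pos norm_mult norm_of_real)
    have "1 * norm (g z) \<le> norm (Moebius_function 0 a z)"
    proof (rule field_le_mult_one_interval)
      show "\<epsilon> * (1 * norm (g z)) \<le> norm (Moebius_function 0 a z)" if "0 < \<epsilon>" "\<epsilon> < 1" for \<epsilon>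
        using le[OF that] by simp
    qed
    then show ?thesis using gk[OF z(1)] Mz by (simp add: norm_mult)
  qed
  have "norm (k a) \<le> 1"
  proof (rule Lim_norm_ubound)
    show "(k \<longlongrightarrow> k a) (at a)"
      using hk a by (metis continuous_on_eq_continuous_at holomorphic_on_imp_continuous_on
        isCont_def mem_ball_0 open_ball)
    show "\<forall>\<^sub>F z in at a. norm (k z) \<le> 1"
      unfolding eventually_at_topological
      by (intro exI[of _ "ball 0 1"]) (use off a in auto)
  qed auto
  then show ?thesis using hk gk off by blast
qed

text \<open>Jensen's inequality in product form: a Blaschke factor with zero a has modulus |a| at 0,
  and the other zeros survive in the quotient because the factor vanishes only at a.\<close>

lemma norm_at_0_le_prod_zeros:
  assumes "finite A" "g holomorphic_on ball 0 1" "\<And>z. norm z < 1 \<Longrightarrow> norm (g z) \<le> 1"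
    and "A \<subseteq> ball 0 1" "\<And>a. a \<in> A \<Longrightarrow> g a = 0"
  shows "norm (g 0) \<le> (\<Prod>a\<in>A. norm a)"
  using assms
proof (induction A arbitrary: g rule: finite_induct)
  case empty
  then show ?case by simp
next
  case (insert a A)
  have a: "norm a < 1" "g a = 0" using insert by auto
  from divide_zero_bound[OF insert.prems(1,2) a]
  obtain k where k: "k holomorphic_on ball 0 1" "\<And>z. norm z < 1 \<Longrightarrow> norm (k z) \<le> 1"
    "\<And>z. norm z < 1 \<Longrightarrow> g z = k z * Moebius_function 0 a z" by blast
  have "norm (k 0) \<le> (\<Prod>a\<in>A. norm a)"
  proof (rule insert.IH[OF k(1,2)])
    show "A \<subseteq> ball 0 1" using insert by auto
    fix b assume b: "b \<in> A"
    then have "b \<noteq> a" "norm b < 1" "g b = 0" using insert by auto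
    moreover have "1 - cnj a * b \<noteq> 0"
    proof
      assume "1 - cnj a * b = 0"
      then have "norm (cnj a * b) = 1" by simp
      then show False using a \<open>norm b < 1\<close>
        by (metis complex_mod_cnj less_irrefl norm_mult norm_mult_less mult_1)
    qed
    ultimately show "k b = 0" using k(3)[of b] by (auto simp: Moebius_function_simple)
  qed
  then show ?case using insert k(3)[of 0]
    by (simp add: Moebius_function_simple norm_mult mult.commute mult_mono)
qed

text \<open>Rescaling the disk of radius 7/10 to the unit disk puts the zeros into (0, 5/7], so n of
  them force |g 0| / M <= (5/7)^n. The constant 3 comes from ln (7/5) >= 1/3.\<close>

lemma card_zeros_le_ln:
  assumes hol: "g holomorphic_on ball 0 (7/10)" and bd: "\<And>z. norm z < 7/10 \<Longrightarrow> norm (g z) \<le> M"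
    and A: "finite A" "A \<subseteq> {0<..1/2::real}" "\<And>x. x \<in> A \<Longrightarrow> g (of_real x) = 0"
    and g0: "g 0 \<noteq> 0"
  shows "real (card A) \<le> 3 * ln (M / norm (g 0))"
proof -
  have M: "M > 0" using bd[of 0] g0 by (metis norm_zero zero_less_divide_iff zero_less_numeral
      zero_less_norm_iff order_less_le_trans)
  define f where "f z = g (7/10 * z) / of_real M" for z
  define B where "B = (\<lambda>x::real. complex_of_real (10/7 * x)) ` A"
  have inj: "inj_on (\<lambda>x::real. complex_of_real (10/7 * x)) A"
    by (auto simp: inj_on_def)
  have "norm (f 0) \<le> (\<Prod>a\<in>B. norm a)"
  proof (rule norm_at_0_le_prod_zeros)
    show "finite B" using A by (simp add: B_def)
    have "(g \<circ> (\<lambda>z. 7/10 * z)) holomorphic_on ball 0 1"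
      by (intro holomorphic_on_compose_gen[OF _ hol] holomorphic_intros) (auto simp: norm_mult)
    then show "f holomorphic_on ball 0 1"
      unfolding f_def o_def using M by (intro holomorphic_intros) auto
    show "norm (f z) \<le> 1" if "norm z < 1" for z
      using bd[of "7/10 * z"] that M by (simp add: f_def norm_divide norm_mult)
    show "B \<subseteq> ball 0 1" using A by (force simp: B_def norm_mult)
    show "f a = 0" if "a \<in> B" for a using that A(3) by (auto simp: B_def f_def)
  qed
  also have "(\<Prod>a\<in>B. norm a) \<le> (\<Prod>a\<in>B. 5/7)"
    using A by (intro prod_mono) (force simp: B_def norm_mult)
  also have "\<dots> = (5/7) ^ card A" unfolding B_def using card_image[OF inj] by simp
  finally have "norm (g 0) / M \<le> (5/7) ^ card A" using M by (simp add: f_def norm_divide)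
  then have "ln (norm (g 0) / M) \<le> ln ((5/7) ^ card A)"
    using M g0 by (subst ln_le_cancel_iff) auto
  then have "ln (norm (g 0) / M) \<le> card A * ln (5/7)" by (simp add: ln_realpow)
  moreover have "ln (5/7::real) \<le> - 1/3"
  proof -
    \<comment> \<open>Numerically e < 2.72 <= 2.744 = (7/5)^3.\<close>
    have "(exp (1/3))^3 = exp (1::real)" by (simp flip: exp_of_nat_mult)
    also have "exp (1::real) < 272/100" using e_less_272 by simp
    also have "\<dots> \<le> (7/5)^3" by (simp add: power3_eq_cube)
    finally have "exp (1/3) \<le> (7/5::real)" by (meson le_less_linear less_asym power_strict_mono exp_ge_zero zero_le_divide_iff zero_le_numeral zero_less_numeral)
    then have "1/3 \<le> ln (7/5::real)" by (subst ln_ge_iff) auto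
    moreover have "ln (5/7::real) = - ln (7/5)" by (simp add: ln_div)
    ultimately show ?thesis by linarith
  qed
  ultimately have "ln (norm (g 0) / M) \<le> card A * (-1/3)"
    by (smt (verit) mult_left_mono of_nat_0_le_iff)
  moreover have "ln (M / norm (g 0)) = - ln (norm (g 0) / M)" using M g0 by (simp add: ln_div)
  ultimately show ?thesis by simp
qed

section \<open>The vector field in polar coordinates\<close>

lemma finite_coeff_index [simp]: "finite (coeff_index d)"
  by (rule finite_subset[of _ "{..d} \<times> {..d}"]) (auto simp: coeff_index_def)

text \<open>One component of the perturbation along the ray of angle \<phi>, divided by r, as a
  polynomial in a complex radius. The subtraction in the exponent never truncates, because the
  indices satisfy k + i >= 1.\<close>

definition pol :: "nat \<Rightarrow> ((nat \<times> nat) \<Rightarrow>\<^sub>0 real) \<Rightarrow> real \<Rightarrow> complex \<Rightarrow> complex" where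
  "pol d a \<phi> r = (\<Sum>(k, i)\<in>coeff_index d.
     of_real (Poly_Mapping.lookup a (k, i) * (cos \<phi> ^ k * sin \<phi> ^ i)) * r ^ (k + i - 1))"

text \<open>Together with \<open>polQ\<close> below, the system in polar form: r' = r * polP and
  \<phi>' = 1 + polQ.\<close>

definition polP :: "nat \<Rightarrow> coeffs \<Rightarrow> real \<Rightarrow> complex \<Rightarrow> complex" where
  "polP d v \<phi> r = of_real (cos \<phi>) * pol d (fst v) \<phi> r + of_real (sin \<phi>) * pol d (snd v) \<phi> r"

definition polQ :: "nat \<Rightarrow> coeffs \<Rightarrow> real \<Rightarrow> complex \<Rightarrow> complex" where
  "polQ d v \<phi> r = of_real (cos \<phi>) * pol d (snd v) \<phi> r - of_real (sin \<phi>) * pol d (fst v) \<phi> r"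

definition slope :: "nat \<Rightarrow> coeffs \<Rightarrow> real \<Rightarrow> complex \<Rightarrow> complex" where
  "slope d v \<phi> r = polP d v \<phi> r / (1 + polQ d v \<phi> r)"

text \<open>The terms of degree j are at most those of the binomial expansion of (c + s)^j = 1, and
  there are d degrees. With c, s the squares of cos and sin this is the source of the factor sqrt
  d.\<close>

lemma sum_powers_le:
  fixes c s :: real
  assumes "c \<ge> 0" "s \<ge> 0" "c + s = 1"
  shows "(\<Sum>(k, i)\<in>coeff_index d. c ^ k * s ^ i) \<le> real d"
proof -
  have e: "coeff_index d = (\<Union>j\<in>{1..d}. (\<lambda>k. (k, j - k)) ` {..j})"
    by (auto simp: coeff_index_def image_iff Bex_def)
  have "(\<Sum>(k, i)\<in>coeff_index d. c ^ k * s ^ i)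
      = (\<Sum>j\<in>{1..d}. \<Sum>(k, i)\<in>(\<lambda>k. (k, j - k)) ` {..j}. c ^ k * s ^ i)"
    unfolding e by (rule sum.UNION_disjoint) auto
  also have "\<dots> = (\<Sum>j\<in>{1..d}. \<Sum>k\<le>j. c ^ k * s ^ (j - k))"
    by (intro sum.cong refl, subst sum.reindex) (auto simp: inj_on_def)
  also have "\<dots> \<le> (\<Sum>j\<in>{1..d}. 1)"
  proof (rule sum_mono)
    fix j assume "j \<in> {1..d}"
    have "(\<Sum>k\<le>j. c ^ k * s ^ (j - k)) \<le> (\<Sum>k\<le>j. of_nat (j choose k) * c ^ k * s ^ (j - k))"
    proof (rule sum_mono)
      fix k assume "k \<in> {..j}"
      then have "1 \<le> real (j choose k)" by (simp add: Suc_leI)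
      then have "1 * (c ^ k * s ^ (j - k)) \<le> real (j choose k) * (c ^ k * s ^ (j - k))"
        using assms by (intro mult_right_mono) auto
      then show "c ^ k * s ^ (j - k) \<le> of_nat (j choose k) * c ^ k * s ^ (j - k)"
        by (simp add: mult.assoc)
    qed
    also have "\<dots> = (c + s) ^ j" by (simp add: binomial_ring)
    finally show "(\<Sum>k\<le>j. c ^ k * s ^ (j - k)) \<le> 1" using assms by simp
  qed
  finally show ?thesis by simp
qed

text \<open>Cauchy-Schwarz against the values of the monomials on the unit circle, whose squares sum
  to at most d; a radius of modulus at most 1 only shrinks the terms.\<close>

lemma norm_pol_le:
  assumes r: "norm r \<le> 1"
  shows "norm (pol d a \<phi> r) \<le> sqrt (real d) * sqrt (\<Sum>p\<in>coeff_index d. \<bar>Poly_Mapping.lookup a p\<bar>\<^sup>2)"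
proof -
  let ?m = "\<lambda>p. cos \<phi> ^ fst p * sin \<phi> ^ snd p"
  have "norm (pol d a \<phi> r) \<le> (\<Sum>p\<in>coeff_index d. \<bar>Poly_Mapping.lookup a p\<bar> * \<bar>?m p\<bar>)"
    unfolding pol_def
  proof (rule sum_norm_le, clarify)
    fix k i
    have "norm (r ^ (k + i - 1)) \<le> 1" using r by (simp add: norm_power power_le_one)
    then have "norm (complex_of_real (Poly_Mapping.lookup a (k, i) * (cos \<phi> ^ k * sin \<phi> ^ i))) * norm (r ^ (k + i - 1))
       \<le> norm (complex_of_real (Poly_Mapping.lookup a (k, i) * (cos \<phi> ^ k * sin \<phi> ^ i))) * 1"
      by (intro mult_left_mono) auto
    then show "norm (complex_of_real (Poly_Mapping.lookup a (k, i) * (cos \<phi> ^ k * sin \<phi> ^ i)) * r ^ (k + i - 1))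
       \<le> \<bar>Poly_Mapping.lookup a (k, i)\<bar> * \<bar>?m (k, i)\<bar>"
      by (simp add: norm_mult abs_mult norm_power power_abs)
  qed
  also have "\<dots> \<le> L2_set (Poly_Mapping.lookup a) (coeff_index d) * L2_set ?m (coeff_index d)"
    by (rule L2_set_mult_ineq)
  also have "\<dots> \<le> L2_set (Poly_Mapping.lookup a) (coeff_index d) * sqrt (real d)"
  proof (rule mult_left_mono)
    have "(\<Sum>p\<in>coeff_index d. (?m p)\<^sup>2) = (\<Sum>(k, i)\<in>coeff_index d. ((cos \<phi>)\<^sup>2) ^ k * ((sin \<phi>)\<^sup>2) ^ i)"
      by (intro sum.cong) (auto simp: power_mult_distrib power_mult[symmetric] mult.commute)
    also have "\<dots> \<le> real d" by (rule sum_powers_le) auto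
    finally show "L2_set ?m (coeff_index d) \<le> sqrt (real d)" by (simp add: L2_set_def)
  qed simp
  finally show ?thesis by (simp add: L2_set_def mult.commute)
qed

lemma pol_le_coeff_norm:
  assumes "norm r \<le> 1"
  shows "norm (pol d (fst v) \<phi> r) \<le> sqrt (real d) * coeff_norm d v"
    and "norm (pol d (snd v) \<phi> r) \<le> sqrt (real d) * coeff_norm d v"
proof -
  show "norm (pol d (fst v) \<phi> r) \<le> sqrt (real d) * coeff_norm d v"
    unfolding coeff_norm_def
    by (rule order_trans[OF norm_pol_le[OF assms]]) (intro mult_left_mono real_sqrt_le_mono, auto intro: sum_nonneg)
  show "norm (pol d (snd v) \<phi> r) \<le> sqrt (real d) * coeff_norm d v"
    unfolding coeff_norm_def
    by (rule order_trans[OF norm_pol_le[OF assms]]) (intro mult_left_mono real_sqrt_le_mono, auto intro: sum_nonneg)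
qed

lemma coeff_norm_nonneg [simp]: "coeff_norm d v \<ge> 0"
  unfolding coeff_norm_def by (simp add: sum_nonneg)

lemma norm_trig_comb_le:
  assumes "norm (x::complex) \<le> B" "norm y \<le> B"
  shows "norm (of_real (cos \<phi>) * x + of_real (sin \<phi>) * y) \<le> 2 * B"
    and "norm (of_real (cos \<phi>) * x - of_real (sin \<phi>) * y) \<le> 2 * B"
proof -
  have c: "norm (complex_of_real (cos \<phi>) * x) \<le> 1 * B" unfolding norm_mult
    by (intro mult_mono assms) auto
  have s: "norm (complex_of_real (sin \<phi>) * y) \<le> 1 * B" unfolding norm_mult
    by (intro mult_mono assms) auto
  from c s show "norm (of_real (cos \<phi>) * x + of_real (sin \<phi>) * y) \<le> 2 * B"
    by norm
  from c s show "norm (of_real (cos \<phi>) * x - of_real (sin \<phi>) * y) \<le> 2 * B"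
    by norm
qed

lemma pol_holomorphic [holomorphic_intros]: "(\<lambda>r. pol d a \<phi> r) holomorphic_on S"
  unfolding pol_def case_prod_unfold by (intro holomorphic_intros)

lemma pol_continuous [continuous_intros]:
  fixes f :: "'a::t2_space \<Rightarrow> real"
  assumes "continuous_on S f" "continuous_on S g"
  shows "continuous_on S (\<lambda>x. pol d a (f x) (g x))"
  unfolding pol_def case_prod_unfold by (intro continuous_intros assms)

lemma poly_eval_polar:
  "poly_eval d a (r * cos \<phi>) (r * sin \<phi>) = r * Re (pol d a \<phi> (of_real r))"
proof -
  have "r * Re (pol d a \<phi> (of_real r)) = (\<Sum>(k, i)\<in>coeff_index d.
      r * (Poly_Mapping.lookup a (k, i) * (cos \<phi> ^ k * sin \<phi> ^ i) * r ^ (k + i - 1)))"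
    unfolding pol_def by (simp add: case_prod_unfold sum_distrib_left flip: of_real_power)
  also have "\<dots> = poly_eval d a (r * cos \<phi>) (r * sin \<phi>)"
    unfolding poly_eval_def
  proof (rule sum.cong[OF refl], clarify)
    fix k i assume "(k, i) \<in> coeff_index d"
    then obtain j where j: "k + i = Suc j" by (cases "k + i") (auto simp: coeff_index_def)
    have "r * r ^ (k + i - 1) = r ^ k * r ^ i" using j by (simp flip: power_add power_Suc)
    then show "r * (Poly_Mapping.lookup a (k, i) * (cos \<phi> ^ k * sin \<phi> ^ i) * r ^ (k + i - 1))
        = Poly_Mapping.lookup a (k, i) * (r * cos \<phi>) ^ k * (r * sin \<phi>) ^ i"
      by (simp add: power_mult_distrib)
  qed
  finally show ?thesis by simp
qed

lemma pol_real: "pol d a \<phi> (of_real r) = of_real (Re (pol d a \<phi> (of_real r)))"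
proof -
  have "pol d a \<phi> (of_real r) \<in> \<real>" unfolding pol_def case_prod_unfold
    by (intro sum_in_Reals Reals_mult Reals_power) auto
  then show ?thesis by (simp add: of_real_Re)
qed

lemma pol_periodic: "pol d a (\<phi> + 2 * pi) r = pol d a \<phi> r"
  by (simp add: pol_def)

text \<open>Since 0 ^ 0 = 1, exactly the two monomials of degree 1 survive at r = 0.\<close>

lemma pol_0:
  assumes "d \<ge> 1"
  shows "pol d a \<phi> 0 = of_real (Poly_Mapping.lookup a (1,0) * cos \<phi> + Poly_Mapping.lookup a (0,1) * sin \<phi>)"
proof -
  have "pol d a \<phi> 0 = (\<Sum>(k, i)\<in>{(1,0),(0,1)}.
     of_real (Poly_Mapping.lookup a (k, i) * (cos \<phi> ^ k * sin \<phi> ^ i)) * 0 ^ (k + i - 1))"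
    unfolding pol_def
  proof (rule sum.mono_neutral_right)
    show "{(1, 0), (0, 1)} \<subseteq> coeff_index d" using assms by (auto simp: coeff_index_def)
    have "k + i - 1 > 0" if "(k, i) \<in> coeff_index d - {(1, 0), (0, 1)}" for k i
      using that by (cases k; cases i) (auto simp: coeff_index_def)
    then have "complex_of_real (Poly_Mapping.lookup a (k, i) * (cos \<phi> ^ k * sin \<phi> ^ i)) * 0 ^ (k + i - 1) = 0"
      if "(k, i) \<in> coeff_index d - {(1, 0), (0, 1)}" for k i using that by (metis mult_zero_right zero_power)
    then show "\<forall>p\<in>coeff_index d - {(1, 0), (0, 1)}. (case p of (k, i) \<Rightarrow>
       complex_of_real (Poly_Mapping.lookup a (k, i) * (cos \<phi> ^ k * sin \<phi> ^ i)) * 0 ^ (k + i - 1)) = 0"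
      by (simp only: split_paired_Ball_Sigma Ball_def split_paired_All case_prod_conv) blast
  qed simp
  then show ?thesis by simp
qed

text \<open>The bound is the admissible range of N with the denominator cleared. It is not strict,
  so limits of coefficient vectors of norm below N still satisfy it.\<close>

locale small_field =
  fixes d :: nat and v :: coeffs
  assumes d1: "d \<ge> 1" and small: "sqrt (real d) * coeff_norm d v \<le> 1 / (40 * pi)"
begin

text \<open>Bounds both \<open>polP\<close> and \<open>polQ\<close> on the unit disk; the 2 is the
  crude price of combining the two components with cos and sin.\<close>

abbreviation \<kappa> :: real where "\<kappa> \<equiv> 2 * (sqrt (real d) * coeff_norm d v)"

lemma kappa_bounds: "0 \<le> \<kappa>" "\<kappa> \<le> 1 / (20 * pi)" "\<kappa> \<le> 1 / 60"
proof -
  show "0 \<le> \<kappa>" by simp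
  show a: "\<kappa> \<le> 1 / (20 * pi)" using small by (simp add: field_simps)
  also have "1 / (20 * pi) \<le> 1 / 60" using pi_gt3 by (intro divide_left_mono) auto
  finally show "\<kappa> \<le> 1 / 60" .
qed

lemma polP_le: "norm r \<le> 1 \<Longrightarrow> norm (polP d v \<phi> r) \<le> \<kappa>"
  unfolding polP_def by (intro norm_trig_comb_le pol_le_coeff_norm)

lemma polQ_le: "norm r \<le> 1 \<Longrightarrow> norm (polQ d v \<phi> r) \<le> \<kappa>"
  unfolding polQ_def by (intro norm_trig_comb_le pol_le_coeff_norm)

lemma one_plus_polQ_ge: "norm r \<le> 1 \<Longrightarrow> norm (1 + polQ d v \<phi> r) \<ge> 59 / 60"
  using polQ_le[of r \<phi>] kappa_bounds norm_triangle_ineq2[of 1 "- polQ d v \<phi> r"] by simp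

lemma one_plus_polQ_nz: "norm r \<le> 1 \<Longrightarrow> 1 + polQ d v \<phi> r \<noteq> 0"
  using one_plus_polQ_ge[of r \<phi>] by auto

lemma slope_le_kappa: 
  assumes "norm r \<le> 1"
  shows "norm (slope d v \<phi> r) \<le> 60 / 59 * \<kappa>"
proof -
  have "norm (slope d v \<phi> r) \<le> \<kappa> / (59 / 60)"
    unfolding slope_def norm_divide
    using polP_le one_plus_polQ_ge assms kappa_bounds by (intro frac_le) auto
  then show ?thesis by simp
qed

lemma slope_le: 
  assumes "norm r \<le> 1"
  shows "norm (slope d v \<phi> r) \<le> 1 / 59"
  using slope_le_kappa[OF assms, of \<phi>] kappa_bounds by linarith

lemma slope_holomorphic: 
  assumes "S \<subseteq> cball 0 1"
  shows "slope d v \<phi> holomorphic_on S"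
proof -
  have "(\<lambda>r. slope d v \<phi> r) holomorphic_on S"
    unfolding slope_def polP_def
    using one_plus_polQ_nz[of _ \<phi>] assms unfolding polQ_def by (intro holomorphic_intros) auto
  then show ?thesis .
qed

lemma slope_continuous:
  fixes f :: "'a::t2_space \<Rightarrow> real"
  assumes "continuous_on S f" "continuous_on S g" "\<And>x. x \<in> S \<Longrightarrow> norm (g x) \<le> 1"
  shows "continuous_on S (\<lambda>x. slope d v (f x) (g x))"
  unfolding slope_def
  using one_plus_polQ_nz assms(3) unfolding polQ_def polP_def
  by (intro continuous_intros assms(1,2)) auto

text \<open>In the variable ln r the slope is holomorphic on Re <= 0 and bounded there by 1/59. The
  margin 19/100 is the radius that is left for Cauchy's estimate of its derivative.\<close>

lemma slope_exp_lipschitz: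
  assumes "Re z \<le> - 19/100" "Re w \<le> - 19/100"
  shows "norm (slope d v \<phi> (exp z) - slope d v \<phi> (exp w)) \<le> 3 / 32 * norm (z - w)"
proof (rule field_differentiable_bound)
  let ?S = "{z. Re z \<le> -19/100}"
  let ?h = "\<lambda>z. slope d v \<phi> (exp z)"
  show "convex ?S" by (rule convex_halfspace_Re_le)
  show "z \<in> ?S" "w \<in> ?S" using assms by auto
  fix u assume u: "u \<in> ?S"
  have hol: "?h holomorphic_on {z. Re z \<le> 0}"
  proof -
    have "(slope d v \<phi> \<circ> exp) holomorphic_on {z. Re z \<le> 0}"
      by (rule holomorphic_on_compose_gen[OF holomorphic_on_exp slope_holomorphic[OF order_refl]]) auto
    then show ?thesis by (simp add: o_def)
  qed
  have sub: "cball u (19/100) \<subseteq> {z. Re z \<le> 0}"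
  proof
    fix y assume "y \<in> cball u (19/100)"
    then have "\<bar>Re (u - y)\<bar> \<le> 19/100" using abs_Re_le_cmod[of "u - y"] by (simp add: dist_norm)
    moreover have "Re u \<le> - 19/100" using u by simp
    ultimately have "Re y \<le> 0" unfolding minus_complex.sel by linarith
    then show "y \<in> {z. Re z \<le> 0}" by simp
  qed
  have sub': "ball u (19/100) \<subseteq> {z. Re z \<le> 0}" using sub ball_subset_cball by blast
  then have "?h holomorphic_on ball u (19/100)"
    by (rule holomorphic_on_subset[OF hol])
  then have "(?h has_field_derivative deriv ?h u) (at u)"
    by (intro holomorphic_derivI[of _ "ball u (19/100)"]) auto
  then show "(?h has_field_derivative deriv ?h u) (at u within ?S)"
    using has_field_derivative_at_within by blast
  \<comment> \<open>The quotient of 1/59 by 19/100 is about 0.089, below 3/32 = 0.09375.\<close>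
  have "norm ((deriv ^^ 1) ?h u) \<le> fact 1 * (1/59) / (19/100) ^ 1"
  proof (rule Cauchy_inequality)
    show "?h holomorphic_on ball u (19/100)" by (rule holomorphic_on_subset[OF hol sub'])
    show "continuous_on (cball u (19/100)) ?h" 
      by (rule holomorphic_on_imp_continuous_on[OF holomorphic_on_subset[OF hol sub]])
    fix x assume "norm (u - x) = 19/100"
    then have "x \<in> cball u (19/100)" by (simp add: dist_norm)
    then have "Re x \<le> 0" using sub by blast
    then show "norm (?h x) \<le> 1/59" by (intro slope_le) simp
  qed simp
  then show "norm (deriv ?h u) \<le> 3 / 32" by simp
qed

lemma slope_real: "slope d v \<phi> (of_real r) = of_real (Re (slope d v \<phi> (of_real r)))"
proof -
  have "slope d v \<phi> (of_real r) \<in> \<real>" unfolding slope_def polP_def polQ_def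
    by (subst (1 2 3 4) pol_real) (auto intro!: Reals_divide)
  then show ?thesis by (simp add: of_real_Re)
qed

lemma slope_periodic: "slope d v (\<phi> + 2 * pi) r = slope d v \<phi> r"
  by (simp add: slope_def polP_def polQ_def pol_periodic)

definition tr :: real where
  "tr = Poly_Mapping.lookup (fst v) (1,0) + Poly_Mapping.lookup (snd v) (0,1)"

text \<open>At r = 0 the numerator of the slope is half the trace minus half the angular derivative of the denominator,
  and the logarithmic derivative of the denominator integrates to 0 over a period.\<close>

lemma integral_slope_0:
  shows "2 * \<bar>tr\<bar> \<le> norm (of_real (2 * pi) * integral {0..1} (\<lambda>\<tau>. slope d v (2 * pi * \<tau>) 0))"
proof -
  define Q where "Q \<tau> = Re (polQ d v (2 * pi * \<tau>) 0)" for \<tau>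
  define Q' where "Q' \<tau> = 2 * pi * ((Poly_Mapping.lookup (snd v) (0,1) - Poly_Mapping.lookup (fst v) (1,0))
      * ((cos (2 * pi * \<tau>))\<^sup>2 - (sin (2 * pi * \<tau>))\<^sup>2)
      - 2 * (Poly_Mapping.lookup (snd v) (1,0) + Poly_Mapping.lookup (fst v) (0,1))
      * (sin (2 * pi * \<tau>) * cos (2 * pi * \<tau>)))" for \<tau>
  have Qeq: "polQ d v (2 * pi * \<tau>) 0 = of_real (Q \<tau>)" for \<tau>
    unfolding Q_def polQ_def by (simp add: pol_0[OF d1])
  have Qb: "\<bar>Q \<tau>\<bar> \<le> 1 / 60" for \<tau>
    using polQ_le[of 0 "2 * pi * \<tau>"] kappa_bounds(3) by (simp add: Qeq)
  have QD: "(Q has_real_derivative Q' \<tau>) (at \<tau> within X)" for \<tau> X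
    unfolding Q_def polQ_def Q'_def
    by (auto simp: pol_0[OF d1] intro!: derivative_eq_intros)
       (simp add: algebra_simps power2_eq_square)
  have P: "polP d v (2 * pi * \<tau>) 0 = of_real (tr / 2 - Q' \<tau> / (4 * pi))" for \<tau>
  proof -
    \<comment> \<open>The identity behind the split: the quadratic form of the linear part is half
      its trace minus 1/(4 pi) times the \<tau>-derivative of \<open>Q\<close>.\<close>
    have *: "c * (a * c + b * s) + s * (e * c + f * s) = (a + f) / 2 * (c\<^sup>2 + s\<^sup>2)
        - (2 * pi * ((f - a) * (c\<^sup>2 - s\<^sup>2) - 2 * (e + b) * (s * c))) / (4 * pi)" for a b c e f s :: real
    proof -
      have "(2 * pi * X) / (4 * pi) = X / 2" for X by simp
      then show ?thesis by (simp only:) (simp add: power2_eq_square algebra_simps add_divide_distrib diff_divide_distrib)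
    qed
    note *[of "cos (2 * pi * \<tau>)" "Poly_Mapping.lookup (fst v) (1,0)" "Poly_Mapping.lookup (fst v) (0,1)"
      "sin (2 * pi * \<tau>)" "Poly_Mapping.lookup (snd v) (1,0)" "Poly_Mapping.lookup (snd v) (0,1)",
      unfolded sin_cos_squared_add2 mult_1_right, folded tr_def Q'_def]
    then show ?thesis unfolding polP_def by (simp add: pol_0[OF d1] flip: of_real_mult of_real_add)
  qed
  define g where "g \<tau> = tr / 2 * (1 / (1 + Q \<tau>))" for \<tau>
  have nz: "1 + Q \<tau> > 0" for \<tau> using Qb[of \<tau>] by linarith
  have contQ: "continuous_on X Q" for X
    using QD by (meson DERIV_continuous_on)
  have gint: "g integrable_on {0..1}" unfolding g_def
    using nz by (intro integrable_continuous_real continuous_intros contQ) (auto simp: less_imp_neq[THEN not_sym])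
  have dint: "((\<lambda>\<tau>. Q' \<tau> / (1 + Q \<tau>)) has_integral (ln (1 + Q 1) - ln (1 + Q 0))) {0..1}"
    by (rule fundamental_theorem_of_calculus)
       (use nz in \<open>auto intro!: derivative_eq_intros QD simp flip: has_real_derivative_iff_has_vector_derivative\<close>)
  moreover have "Q 1 = Q 0" unfolding Q_def using pol_periodic[of d _ 0 0]
    by (simp add: polQ_def pol_0[OF d1])
  ultimately have dint: "((\<lambda>\<tau>. Q' \<tau> / (1 + Q \<tau>)) has_integral 0) {0..1}" by simp
  have "((\<lambda>\<tau>. g \<tau> - 1 / (4 * pi) * (Q' \<tau> / (1 + Q \<tau>))) has_integral (integral {0..1} g - 1 / (4 * pi) * 0)) {0..1}"
    by (intro has_integral_diff has_integral_mult_right dint integrable_integral gint)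
  then have "((\<lambda>\<tau>. complex_of_real (g \<tau> - 1 / (4 * pi) * (Q' \<tau> / (1 + Q \<tau>)))) has_integral of_real (integral {0..1} g)) {0..1}"
    by (intro has_integral_of_real) simp
  moreover have "complex_of_real (g \<tau> - 1 / (4 * pi) * (Q' \<tau> / (1 + Q \<tau>))) = slope d v (2 * pi * \<tau>) 0" for \<tau>
    unfolding slope_def P Qeq g_def by (simp add: diff_divide_distrib)
  ultimately have I: "integral {0..1} (\<lambda>\<tau>. slope d v (2 * pi * \<tau>) 0) = of_real (integral {0..1} g)"
    by (simp add: integral_unique)
  define q where "q \<tau> = 1 / (1 + Q \<tau>)" for \<tau>
  have qint: "q integrable_on {0..1}" unfolding q_def
    using nz by (intro integrable_continuous_real continuous_intros contQ) (auto simp: less_imp_neq[THEN not_sym])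
  \<comment> \<open>From |Q| <= 1/60 one gets 1/(1 + Q) >= 60/61; with pi > 3 the resulting factor
    180/61 exceeds 2.\<close>
  have "integral {0..1::real} (\<lambda>_. 60/61) \<le> integral {0..1::real} q"
  proof (rule integral_le)
    fix \<tau> :: real
    show "60/61 \<le> q \<tau>" unfolding q_def using nz[of \<tau>] Qb[of \<tau>] by (simp add: field_simps abs_le_iff)
  qed (use qint in auto)
  then have ge: "60/61 \<le> integral {0..1} q" by simp
  have Ig: "integral {0..1} g = tr / 2 * integral {0..1} q"
    unfolding g_def q_def by (rule integral_mult_right)
  then have "norm (of_real (2 * pi) * integral {0..1} (\<lambda>\<tau>. slope d v (2 * pi * \<tau>) 0)) = pi * \<bar>tr\<bar> * \<bar>integral {0..1} q\<bar>"
    unfolding I Ig norm_mult norm_of_real abs_mult by simp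
  also have "\<dots> \<ge> 3 * \<bar>tr\<bar> * (60/61)"
    using ge pi_gt3 by (intro mult_mono) auto
  finally show ?thesis by linarith
qed

end

section \<open>The displacement function\<close>

text \<open>Needed for differentiation under the integral sign. Uniform continuity on a compact
  product makes f(., t) - f(., t0) uniformly small near x0, Cauchy's estimate transfers this to the
  derivative, and for the fixed parameter t0 the derivative is continuous anyway.\<close>

lemma continuous_on_deriv_param:
  fixes f :: "complex \<Rightarrow> 'a::metric_space \<Rightarrow> complex"
  assumes U: "open U" and cont: "continuous_on (U \<times> K) (\<lambda>(x, t). f x t)"
    and hol: "\<And>t. t \<in> K \<Longrightarrow> (\<lambda>x. f x t) holomorphic_on U" and K: "compact K"
  shows "continuous_on (U \<times> K) (\<lambda>(x, t). deriv (\<lambda>x. f x t) x)"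
  unfolding continuous_on_iff
proof (clarify)
  fix x0 t0 and e :: real assume x0: "x0 \<in> U" and t0: "t0 \<in> K" and e: "e > 0"
  obtain r where r: "r > 0" "cball x0 (2 * r) \<subseteq> U"
  proof -
    obtain r where "r > 0" "cball x0 r \<subseteq> U" using U x0 open_contains_cball[of U] by blast
    then show ?thesis using that[of "r / 2"] by simp
  qed
  have "uniformly_continuous_on (cball x0 (2 * r) \<times> K) (\<lambda>(x, t). f x t)"
    using r K by (intro compact_uniformly_continuous continuous_on_subset[OF cont] compact_Times) auto
  then obtain \<delta> where \<delta>: "\<delta> > 0" "\<And>y y'. y \<in> cball x0 (2 * r) \<times> K \<Longrightarrow> y' \<in> cball x0 (2 * r) \<times> K \<Longrightarrow>
      dist y' y < \<delta> \<Longrightarrow> dist (case y' of (x, t) \<Rightarrow> f x t) (case y of (x, t) \<Rightarrow> f x t) < e * r / 2"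
    proof -
    assume "uniformly_continuous_on (cball x0 (2 * r) \<times> K) (\<lambda>(x, t). f x t)"
    moreover have "e * r / 2 > 0" using e r by simp
    ultimately obtain \<delta> where "\<delta> > 0" "\<forall>y\<in>cball x0 (2 * r) \<times> K. \<forall>y'\<in>cball x0 (2 * r) \<times> K. dist y' y < \<delta> \<longrightarrow>
        dist (case y' of (x, t) \<Rightarrow> f x t) (case y of (x, t) \<Rightarrow> f x t) < e * r / 2"
      unfolding uniformly_continuous_on_def by meson
    then show ?thesis using that by blast
  qed
  have "(\<lambda>x. f x t0) holomorphic_on U" by (rule hol[OF t0])
  then have "deriv (\<lambda>x. f x t0) holomorphic_on U" using U by (rule holomorphic_deriv)
  then have "continuous_on U (deriv (\<lambda>x. f x t0))" by (rule holomorphic_on_imp_continuous_on)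
  then obtain \<eta> where \<eta>: "\<eta> > 0" "\<And>x. x \<in> U \<Longrightarrow> dist x x0 < \<eta> \<Longrightarrow>
      dist (deriv (\<lambda>x. f x t0) x) (deriv (\<lambda>x. f x t0) x0) < e / 2"
  proof -
    assume "continuous_on U (deriv (\<lambda>x. f x t0))"
    moreover have "e / 2 > 0" using e by simp
    ultimately obtain \<eta> where "\<eta> > 0" "\<forall>x\<in>U. dist x x0 < \<eta> \<longrightarrow>
      dist (deriv (\<lambda>x. f x t0) x) (deriv (\<lambda>x. f x t0) x0) < e / 2"
      unfolding continuous_on_iff using x0 by meson
    then show ?thesis using that by blast
  qed
  show "\<exists>\<rho>>0. \<forall>y\<in>U \<times> K. dist y (x0, t0) < \<rho> \<longrightarrow>
          dist (case y of (x, t) \<Rightarrow> deriv (\<lambda>x. f x t) x) (deriv (\<lambda>x. f x t0) x0) < e"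
  proof (intro exI[of _ "min \<delta> (min \<eta> r)"] conjI ballI impI)
    show "0 < min \<delta> (min \<eta> r)" using \<delta> \<eta> r by simp
    fix y assume "y \<in> U \<times> K" and "dist y (x0, t0) < min \<delta> (min \<eta> r)"
    then obtain x t where y: "y = (x, t)" "x \<in> U" "t \<in> K" and D: "dist (x, t) (x0, t0) < min \<delta> (min \<eta> r)"
      by (cases y) auto
    have dx: "dist x x0 < min \<eta> r" and dt: "dist t t0 < \<delta>"
      using D dist_fst_le[of "(x, t)" "(x0, t0)"] dist_snd_le[of "(x, t)" "(x0, t0)"] by auto
    have sub: "cball x r \<subseteq> cball x0 (2 * r)"
    proof
      fix w assume "w \<in> cball x r"
      then show "w \<in> cball x0 (2 * r)" using dx dist_triangle[of x0 w x] by (simp add: dist_commute)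
    qed
    let ?g = "\<lambda>x. f x t - f x t0"
    have hg: "?g holomorphic_on U" using y t0 by (intro holomorphic_intros hol) auto
    have "norm ((deriv ^^ 1) ?g x) \<le> fact 1 * (e * r / 2) / r ^ 1"
    proof (rule Cauchy_inequality)
      show "?g holomorphic_on ball x r"
        using sub r ball_subset_cball[of x r] by (intro holomorphic_on_subset[OF hg]) blast
      show "continuous_on (cball x r) ?g"
        using sub r by (intro holomorphic_on_imp_continuous_on holomorphic_on_subset[OF hg]) blast
      fix w assume "norm (x - w) = r"
      then have w: "w \<in> cball x0 (2 * r)" using sub by (auto simp: dist_norm)
      have "dist (w, t) (w, t0) < \<delta>" using dt by (simp add: dist_Pair_Pair)
      then show "norm (?g w) \<le> e * r / 2" using \<delta>(2)[of "(w, t0)" "(w, t)"] w y t0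
        by (simp add: dist_norm)
    qed (use r in simp)
    then have "norm (deriv ?g x) \<le> e / 2" using r by simp
    moreover have "deriv ?g x = deriv (\<lambda>x. f x t) x - deriv (\<lambda>x. f x t0) x"
      using y t0 U by (intro deriv_diff holomorphic_on_imp_differentiable_at[OF hol]) auto
    ultimately have "dist (deriv (\<lambda>x. f x t) x) (deriv (\<lambda>x. f x t0) x) \<le> e / 2"
      by (simp add: dist_norm)
    moreover have "dist (deriv (\<lambda>x. f x t0) x) (deriv (\<lambda>x. f x t0) x0) < e / 2"
      using \<eta>(2)[of x] y dx by simp
    ultimately show "dist (case y of (x, t) \<Rightarrow> deriv (\<lambda>x. f x t) x) (deriv (\<lambda>x. f x t0) x0) < e"
      using dist_triangle[of "deriv (\<lambda>x. f x t) x" "deriv (\<lambda>x. f x t0) x0" "deriv (\<lambda>x. f x t0) x"]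
      unfolding y by simp
  qed
qed

lemma integral_param_holomorphic:
  fixes f :: "complex \<Rightarrow> real \<Rightarrow> complex"
  assumes U: "open U" "convex U" and cont: "continuous_on (U \<times> {a..b}) (\<lambda>(x, t). f x t)"
    and hol: "\<And>t. t \<in> {a..b} \<Longrightarrow> (\<lambda>x. f x t) holomorphic_on U"
  shows "(\<lambda>x. integral {a..b} (f x)) holomorphic_on U"
proof -
  have "(\<lambda>x. integral (cbox a b) (f x)) holomorphic_on U"
  proof (rule leibniz_rule_holomorphic)
    show "((\<lambda>x. f x t) has_field_derivative deriv (\<lambda>x. f x t) x) (at x within U)"
      if "x \<in> U" "t \<in> cbox a b" for x t
      using holomorphic_derivI[OF hol U(1) that(1)] that has_field_derivative_at_within by auto
    show "f x integrable_on cbox a b" if "x \<in> U" for x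
    proof (rule integrable_continuous)
      have "continuous_on {a..b} ((\<lambda>(x, t). f x t) \<circ> (\<lambda>t. (x, t)))"
        using that by (intro continuous_on_compose continuous_intros continuous_on_subset[OF cont]) auto
      then show "continuous_on (cbox a b) (f x)" by (simp add: o_def)
    qed
    show "continuous_on (U \<times> cbox a b) (\<lambda>(x, t). deriv (\<lambda>x. f x t) x)"
      using continuous_on_deriv_param[OF U(1) cont hol] by simp
  qed (rule U)
  then show ?thesis by simp
qed

lemma exp_3_10: "exp (3/10::real) \<le> 10/7"
proof -
  have "1 + (-3/10) \<le> exp (-3/10::real)" by (rule exp_ge_add_one_self)
  then have "7/10 * exp (3/10) \<le> exp (-3/10::real) * exp (3/10)" by (intro mult_right_mono) auto
  then show ?thesis by (simp flip: exp_add)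
qed

lemma ln_7_10: "ln (7/10::real) \<le> -3/10"
  using ln_add_one_self_le_self2[of "-3/10"] by simp

lemma ln_6_10: "ln (6/10::real) \<le> -4/10"
  using ln_add_one_self_le_self2[of "-4/10"] by simp

section \<open>Picard iteration with a complex initial radius\<close>

context small_field
begin

text \<open>Picard iterates for ln (r / x), with the initial point x complex.\<close>

primrec pic :: "nat \<Rightarrow> complex \<Rightarrow> real \<Rightarrow> complex" where
  "pic 0 x \<phi> = 0"
| "pic (Suc n) x \<phi> = of_real \<phi> * integral {0..1} (\<lambda>\<tau>. slope d v (\<phi> * \<tau>) (x * exp (pic n x (\<phi> * \<tau>))))"

text \<open>The reason for the radius 7/10: since 7/10 * exp (3/10) <= 1, a drift of ln r by at most
  3/10 keeps the point in the unit disk.\<close>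

lemma slope_arg_le:
  assumes "norm x < 7/10" "norm (u :: complex) \<le> 3/10"
  shows "norm (x * exp u) \<le> 1"
proof -
  have "norm (x * exp u) = norm x * exp (Re u)" by (simp add: norm_mult)
  also have "\<dots> \<le> 7/10 * exp (3/10)"
    using assms abs_Re_le_cmod[of u] by (intro mult_mono) auto
  also have "\<dots> \<le> 1" using exp_3_10 by simp
  finally show ?thesis .
qed

text \<open>For x different from 0 this is the Lipschitz bound in the variable Ln x + u, whose real
  part is at most -3/10 + 6/59 < -19/100. At x = 0 both arguments of the slope are 0.\<close>

lemma slope_lipschitz:
  assumes x: "norm x < 7/10" and u: "norm u \<le> 6/59" "norm w \<le> 6/59"
  shows "norm (slope d v \<phi> (x * exp u) - slope d v \<phi> (x * exp w)) \<le> 3/32 * norm (u - w)"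
proof (cases "x = 0")
  case False
  have "ln (norm x) \<le> ln (7/10)" using False x by (subst ln_le_cancel_iff) auto
  then have "Re (Ln x) \<le> -3/10" using Re_Ln[OF False] ln_7_10 by linarith
  moreover have "\<bar>Re u\<bar> \<le> 6/59" "\<bar>Re w\<bar> \<le> 6/59"
    using u abs_Re_le_cmod[of u] abs_Re_le_cmod[of w] by linarith+
  ultimately have "Re (Ln x + u) \<le> -19/100" "Re (Ln x + w) \<le> -19/100" by (simp_all; linarith)+
  from slope_exp_lipschitz[OF this, of \<phi>] show ?thesis
    using False by (simp add: exp_add)
qed simp

text \<open>The constant 40 pi enters here: \<kappa> <= 1/(20 pi) limits the change of ln r during a
  full turn to 6/59.\<close>

lemma kappa_2pi: "2 * pi * (60/59 * \<kappa>) \<le> 6/59"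
proof -
  have "2 * pi * (60/59 * \<kappa>) \<le> 2 * pi * (60/59 * (1 / (20 * pi)))"
    using kappa_bounds by (intro mult_left_mono) auto
  then show ?thesis by simp
qed

text \<open>The three claims depend on each other: the bound keeps the argument of
  \<open>slope\<close> in the unit disk, where it is holomorphic and continuous, and continuity
  makes the next integral behave well. Scaling the integration variable by \<phi> in
  \<open>pic\<close> fixes the interval to [0, 1], so \<phi> is a mere parameter.\<close>

lemma pic_props:
  "continuous_on (ball 0 (7/10) \<times> {0..2*pi}) (\<lambda>(x, \<phi>). pic n x \<phi>) \<and>
   (\<forall>\<phi>\<in>{0..2*pi}. (\<lambda>x. pic n x \<phi>) holomorphic_on ball 0 (7/10)) \<and>
   (\<forall>x\<in>ball 0 (7/10). \<forall>\<phi>\<in>{0..2*pi}. norm (pic n x \<phi>) \<le> 2 * pi * (60/59 * \<kappa>))"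
proof (induction n)
  case 0
  then show ?case using kappa_bounds(1) by (simp add: case_prod_unfold)
next
  case (Suc n)
  let ?B = "ball 0 (7/10) :: complex set" and ?J = "{0..2*pi}"
  have c: "continuous_on (?B \<times> ?J) (\<lambda>p. pic n (fst p) (snd p))"
    using Suc by (simp only: case_prod_unfold)
  have h: "(\<lambda>x. pic n x \<phi>) holomorphic_on ?B" if "\<phi> \<in> ?J" for \<phi>
    using Suc that by blast
  have b: "norm (pic n x \<phi>) \<le> 6/59" if "x \<in> ?B" "\<phi> \<in> ?J" for x \<phi>
    using Suc that kappa_2pi order_trans by blast
  have J: "\<phi> * \<tau> \<in> ?J" if "\<phi> \<in> ?J" "\<tau> \<in> {0..1}" for \<phi> \<tau> :: real
    using that mult_left_le[of \<tau> \<phi>] by auto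
  have arg: "norm (x * exp (pic n x \<phi>)) \<le> 1" if "x \<in> ?B" "\<phi> \<in> ?J" for x \<phi>
    using b[OF that] that by (intro slope_arg_le) auto
  let ?f = "\<lambda>q \<tau>. slope d v (snd q * \<tau>) (fst q * exp (pic n (fst q) (snd q * \<tau>)))"
  have "continuous_on ((?B \<times> ?J) \<times> {0..1}) ((\<lambda>p. pic n (fst p) (snd p)) \<circ> (\<lambda>z. (fst (fst z), snd (fst z) * snd z)))"
    by (intro continuous_on_compose continuous_intros continuous_on_subset[OF c]) (use J in auto)
  then have cp: "continuous_on ((?B \<times> ?J) \<times> {0..1}) (\<lambda>z. pic n (fst (fst z)) (snd (fst z) * snd z))"
    by (simp add: o_def)
  have cont: "continuous_on ((?B \<times> ?J) \<times> {0..1}) (\<lambda>(q, \<tau>). ?f q \<tau>)"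
    unfolding case_prod_unfold
    by (intro slope_continuous continuous_intros cp) (use arg J in auto)
  have cont1: "continuous_on (?B \<times> {0..1}) (\<lambda>(x, \<tau>). ?f (x, \<phi>) \<tau>)" if "\<phi> \<in> ?J" for \<phi>
  proof -
    have "continuous_on (?B \<times> {0..1}) ((\<lambda>(q, \<tau>). ?f q \<tau>) \<circ> (\<lambda>z. ((fst z, \<phi>), snd z)))"
      by (intro continuous_on_compose continuous_intros continuous_on_subset[OF cont]) (use that in auto)
    then show ?thesis by (simp add: o_def case_prod_unfold)
  qed
  have cont2: "continuous_on {0..1} (\<lambda>\<tau>. ?f (x, \<phi>) \<tau>)" if "x \<in> ?B" "\<phi> \<in> ?J" for x \<phi>
  proof -
    have "continuous_on {0..1} ((\<lambda>(x, \<tau>). ?f (x, \<phi>) \<tau>) \<circ> (\<lambda>\<tau>. (x, \<tau>)))"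
      by (intro continuous_on_compose continuous_intros continuous_on_subset[OF cont1[OF that(2)]]) (use that in auto)
    then show ?thesis by (simp add: o_def)
  qed
  show ?case
  proof (intro conjI ballI)
    have "continuous_on (?B \<times> ?J) (\<lambda>q. integral (cbox 0 1) (?f q))"
      by (rule integral_continuous_on_param) (use cont in simp)
    then show "continuous_on (?B \<times> ?J) (\<lambda>(x, \<phi>). pic (Suc n) x \<phi>)"
      unfolding case_prod_unfold pic.simps by (intro continuous_intros) simp
  next
    fix \<phi> assume \<phi>: "\<phi> \<in> ?J"
    have "(\<lambda>x. integral {0..1} (?f (x, \<phi>))) holomorphic_on ?B"
    proof (rule integral_param_holomorphic)
      fix \<tau> :: real assume \<tau>: "\<tau> \<in> {0..1}"
      have "(slope d v (\<phi> * \<tau>) \<circ> (\<lambda>x. x * exp (pic n x (\<phi> * \<tau>)))) holomorphic_on ?B"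
        by (rule holomorphic_on_compose_gen[OF _ slope_holomorphic[OF order_refl]])
           (use arg J[OF \<phi> \<tau>] in \<open>auto intro!: holomorphic_intros h\<close>)
      then show "(\<lambda>x. ?f (x, \<phi>) \<tau>) holomorphic_on ?B" by (simp add: o_def)
    qed (use cont1[OF \<phi>] in auto)
    then show "(\<lambda>x. pic (Suc n) x \<phi>) holomorphic_on ?B"
      by (auto intro!: holomorphic_intros)
    fix x assume x: "x \<in> ?B"
    have "norm (integral {0..1} (?f (x, \<phi>))) \<le> 60/59 * \<kappa> * (1 - 0)"
      by (intro integral_bound cont2 x \<phi> slope_le_kappa) (use arg J x \<phi> in auto)
    then have "\<phi> * norm (integral {0..1} (?f (x, \<phi>))) \<le> 2 * pi * (60/59 * \<kappa>)"
      using \<phi> kappa_bounds by (intro mult_mono) auto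
    then show "norm (pic (Suc n) x \<phi>) \<le> 2 * pi * (60/59 * \<kappa>)"
      using \<phi> by (simp add: norm_mult)
  qed
qed

lemma pic_le:
  assumes "norm x < 7/10" "\<phi> \<in> {0..2*pi}"
  shows "norm (pic n x \<phi>) \<le> 6/59"
proof -
  have "x \<in> ball 0 (7/10)" using assms(1) by simp
  then have "norm (pic n x \<phi>) \<le> 2 * pi * (60/59 * \<kappa>)" using pic_props[of n] assms(2) by blast
  then show ?thesis using kappa_2pi by (rule order_trans)
qed

lemma pic_continuous:
  assumes "norm x < 7/10" "\<phi> \<in> {0..2*pi}"
  shows "continuous_on {0..1} (\<lambda>\<tau>. pic n x (\<phi> * \<tau>))"
proof -
  have c: "continuous_on (ball 0 (7/10) \<times> {0..2*pi}) (\<lambda>(x, \<phi>). pic n x \<phi>)"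
    using pic_props[of n] by blast
  have J: "\<phi> * \<tau> \<in> {0..2*pi}" if "\<tau> \<in> {0..1}" for \<tau> :: real
    using that assms mult_left_le[of \<tau> \<phi>] by auto
  have "continuous_on {0..1} ((\<lambda>(x, \<phi>). pic n x \<phi>) \<circ> (\<lambda>\<tau>. (x, \<phi> * \<tau>)))"
    by (intro continuous_on_compose continuous_intros continuous_on_subset[OF c]) (use J assms in auto)
  then show ?thesis by (simp add: o_def)
qed

text \<open>The map y to z is one Picard step. Leaving y arbitrary serves two purposes: consecutive
  iterates give convergence, and a fixed point z = y identifies the limit with a true
  solution.\<close>

lemma pic_contract:
  assumes x: "norm x < 7/10" and \<phi>: "\<phi> \<in> {0..2*pi}"
    and y: "continuous_on {0..2*pi} y" "\<And>\<psi>. \<psi> \<in> {0..2*pi} \<Longrightarrow> norm (y \<psi>) \<le> 6/59"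
    and eq: "\<And>\<psi>. \<psi> \<in> {0..2*pi} \<Longrightarrow> z \<psi> = of_real \<psi> * integral {0..1} (\<lambda>\<tau>. slope d v (\<psi> * \<tau>) (x * exp (y (\<psi> * \<tau>))))"
    and D: "\<And>\<psi>. \<psi> \<in> {0..2*pi} \<Longrightarrow> norm (pic n x \<psi> - y \<psi>) \<le> D"
  shows "norm (pic (Suc n) x \<phi> - z \<phi>) \<le> 3/4 * D"
proof -
  have J: "\<phi> * \<tau> \<in> {0..2*pi}" if "\<tau> \<in> {0..1}" for \<tau> :: real
    using that \<phi> mult_left_le[of \<tau> \<phi>] by auto
  let ?f = "\<lambda>\<tau>. slope d v (\<phi> * \<tau>) (x * exp (pic n x (\<phi> * \<tau>)))"
  let ?g = "\<lambda>\<tau>. slope d v (\<phi> * \<tau>) (x * exp (y (\<phi> * \<tau>)))"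
  have f: "continuous_on {0..1} ?f"
    by (intro slope_continuous continuous_intros pic_continuous slope_arg_le x \<phi> order_trans[OF pic_le[OF x]])
       (use J in auto)
  have "continuous_on {0..1} (y \<circ> (\<lambda>\<tau>. \<phi> * \<tau>))"
    by (intro continuous_on_compose continuous_intros continuous_on_subset[OF y(1)]) (use J in auto)
  then have g: "continuous_on {0..1} ?g"
    by (intro slope_continuous continuous_intros slope_arg_le x order_trans[OF y(2)])
       (use J in \<open>auto simp: o_def\<close>)
  have "norm (integral {0..1} (\<lambda>\<tau>. ?f \<tau> - ?g \<tau>)) \<le> 3/32 * D * (1 - 0)"
  proof (rule integral_bound)
    show "continuous_on {0..1} (\<lambda>\<tau>. ?f \<tau> - ?g \<tau>)" by (intro continuous_intros f g)
    fix \<tau> :: real assume "\<tau> \<in> {0..1}"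
    then have "norm (?f \<tau> - ?g \<tau>) \<le> 3/32 * norm (pic n x (\<phi> * \<tau>) - y (\<phi> * \<tau>))"
      by (intro slope_lipschitz x pic_le y J)
    also have "\<dots> \<le> 3/32 * D" using D J \<open>\<tau> \<in> {0..1}\<close> by auto
    finally show "norm (?f \<tau> - ?g \<tau>) \<le> 3/32 * D" .
  qed simp
  \<comment> \<open>Here \<phi> <= 2 pi < 8, and 8 * 3/32 = 3/4.\<close>
  then have "\<phi> * norm (integral {0..1} (\<lambda>\<tau>. ?f \<tau> - ?g \<tau>)) \<le> 8 * (3/32 * D)"
    using \<phi> pi_less_4 by (intro mult_mono) auto
  moreover have "pic (Suc n) x \<phi> - z \<phi> = of_real \<phi> * integral {0..1} (\<lambda>\<tau>. ?f \<tau> - ?g \<tau>)"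
    unfolding eq[OF \<phi>] pic.simps
    by (subst integral_diff) (auto intro!: integrable_continuous_real f g simp: right_diff_distrib)
  ultimately show ?thesis using \<phi> by (simp add: norm_mult)
qed

lemma pic_step:
  assumes x: "norm x < 7/10"
  shows "\<phi> \<in> {0..2*pi} \<Longrightarrow> norm (pic (Suc n) x \<phi> - pic n x \<phi>) \<le> 6/59 * (3/4) ^ n"
proof (induction n arbitrary: \<phi>)
  case 0
  then show ?case using pic_le[OF x, of \<phi> "Suc 0"] by (simp del: pic.simps(2))
next
  case (Suc n)
  have c: "continuous_on (ball 0 (7/10) \<times> {0..2*pi}) (\<lambda>(x, \<phi>). pic n x \<phi>)" for n
    using pic_props[of n] by blast
  have "continuous_on {0..2*pi} ((\<lambda>(x, \<phi>). pic n x \<phi>) \<circ> (\<lambda>\<phi>. (x, \<phi>)))"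
    by (intro continuous_on_compose continuous_intros continuous_on_subset[OF c]) (use x in auto)
  then have "continuous_on {0..2*pi} (pic n x)" by (simp add: o_def)
  then have "norm (pic (Suc (Suc n)) x \<phi> - pic (Suc n) x \<phi>) \<le> 3/4 * (6/59 * (3/4) ^ n)"
    by (intro pic_contract[where y = "pic n x"] x Suc pic_le) auto
  then show ?case by simp
qed

text \<open>The function G of the overview.\<close>

definition displ :: "complex \<Rightarrow> complex" where
  "displ x = lim (\<lambda>n. pic n x (2 * pi))"

text \<open>The telescoping series of the iterates is dominated by a geometric series with ratio
  3/4, independently of x; uniformity is what passes holomorphy on to the limit.\<close>

lemma displ_uniform_limit: "uniform_limit (ball 0 (7/10)) (\<lambda>n x. pic n x (2 * pi)) displ sequentially"
proof -
  have "summable (\<lambda>n. 6/59 * (3/4::real) ^ n)" by (intro summable_mult summable_geometric) auto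
  then have "uniform_limit (ball 0 (7/10)) (\<lambda>n x. \<Sum>i<n. pic (Suc i) x (2 * pi) - pic i x (2 * pi))
     (\<lambda>x. suminf (\<lambda>i. pic (Suc i) x (2 * pi) - pic i x (2 * pi))) sequentially"
  proof (rule Weierstrass_m_test[rotated])
    fix n and x :: complex assume "x \<in> ball 0 (7/10)"
    then show "norm (pic (Suc n) x (2 * pi) - pic n x (2 * pi)) \<le> 6/59 * (3/4) ^ n"
      by (intro pic_step) auto
  qed
  moreover have "(\<Sum>i<n. pic (Suc i) x (2 * pi) - pic i x (2 * pi)) = pic n x (2 * pi)" for n x
    using sum_lessThan_telescope[of "\<lambda>i. pic i x (2 * pi)" n] by (simp only: pic.simps(1) diff_zero)
  ultimately obtain l where l: "uniform_limit (ball 0 (7/10)) (\<lambda>n x. pic n x (2 * pi)) l sequentially"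
    by (auto simp del: pic.simps)
  then have "l x = displ x" if "x \<in> ball 0 (7/10)" for x
    unfolding displ_def using limI[OF tendsto_uniform_limitI[OF l that]] by simp
  then have "uniform_limit (ball 0 (7/10)) (\<lambda>n x. pic n x (2 * pi)) l sequentially
      \<longleftrightarrow> uniform_limit (ball 0 (7/10)) (\<lambda>n x. pic n x (2 * pi)) displ sequentially"
    by (intro uniform_limit_cong') auto
  with l show ?thesis by blast
qed

lemma displ_LIMSEQ: "norm x < 7/10 \<Longrightarrow> (\<lambda>n. pic n x (2 * pi)) \<longlonglongrightarrow> displ x"
  using tendsto_uniform_limitI[OF displ_uniform_limit] by simp

lemma displ_holomorphic: "displ holomorphic_on ball 0 (7/10)"
proof (rule holomorphic_uniform_sequence)
  show "(\<lambda>x. pic n x (2 * pi)) holomorphic_on ball 0 (7/10)" for n using pic_props[of n] by auto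
  fix x :: complex assume "x \<in> ball 0 (7/10)"
  then obtain r where "r > 0" "cball x r \<subseteq> ball 0 (7/10)" by (meson open_ball open_contains_cball)
  then show "\<exists>r>0. cball x r \<subseteq> ball 0 (7/10) \<and> uniform_limit (cball x r) (\<lambda>n x. pic n x (2 * pi)) displ sequentially"
    using uniform_limit_on_subset[OF displ_uniform_limit] by blast
qed simp

lemma displ_le: "norm x < 7/10 \<Longrightarrow> norm (displ x) \<le> 13 * \<kappa>"
proof (rule Lim_norm_ubound[OF _ displ_LIMSEQ])
  assume x: "norm x < 7/10"
  have "norm (pic n x (2 * pi)) \<le> 2 * pi * (60/59 * \<kappa>)" for n
  proof -
    have "x \<in> ball 0 (7/10)" using x by simp
    moreover have "2 * pi \<in> {0..2*pi}" by simp
    ultimately show ?thesis using pic_props[of n] by blast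
  qed
  \<comment> \<open>The factor 2 * (63/20) * (60/59) is about 6.41, so 13 is generous.\<close>
  also have "2 * pi * (60/59 * \<kappa>) \<le> 2 * (63/20) * (60/59 * \<kappa>)"
    using kappa_bounds pi_approx by (intro mult_right_mono mult_left_mono) auto
  also have "\<dots> \<le> 13 * \<kappa>" using kappa_bounds by simp
  finally show "\<forall>\<^sub>F n in sequentially. norm (pic n x (2 * pi)) \<le> 13 * \<kappa>" by simp
qed auto

text \<open>At x = 0 the factor x annihilates the previous iterate inside \<open>slope\<close>, so
  all iterates after the first step coincide and the limit is the integral already
  estimated.\<close>

lemma displ_0_ge: "2 * \<bar>tr\<bar> \<le> norm (displ 0)"
proof -
  have "(\<lambda>n. pic (Suc n) 0 (2 * pi)) \<longlonglongrightarrow> displ 0"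
    by (rule LIMSEQ_Suc[OF displ_LIMSEQ]) simp
  then have "displ 0 = of_real (2 * pi) * integral {0..1} (\<lambda>\<tau>. slope d v (2 * pi * \<tau>) 0)"
    by (simp add: LIMSEQ_const_iff)
  then show ?thesis using integral_slope_0 by simp
qed

text \<open>The link between the abstract limit and actual solutions: the distance of the iterates
  to a fixed point shrinks by 3/4 in each step.\<close>

lemma displ_eq_fixpoint:
  assumes x: "norm x < 7/10"
    and y: "continuous_on {0..2*pi} y" "\<And>\<psi>. \<psi> \<in> {0..2*pi} \<Longrightarrow> norm (y \<psi>) \<le> 6/59"
    and eq: "\<And>\<psi>. \<psi> \<in> {0..2*pi} \<Longrightarrow> y \<psi> = of_real \<psi> * integral {0..1} (\<lambda>\<tau>. slope d v (\<psi> * \<tau>) (x * exp (y (\<psi> * \<tau>))))"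
  shows "displ x = y (2 * pi)"
proof -
  have b: "norm (pic n x \<phi> - y \<phi>) \<le> (3/4) ^ n * (6/59)" if "\<phi> \<in> {0..2*pi}" for n \<phi>
    using that
  proof (induction n arbitrary: \<phi>)
    case (Suc n)
    have "norm (pic (Suc n) x \<phi> - y \<phi>) \<le> 3/4 * ((3/4) ^ n * (6/59))"
      by (rule pic_contract[OF x Suc.prems y eq Suc.IH])
    then show ?case by simp
  qed (use y in simp)
  have "(\<lambda>n. pic n x (2 * pi)) \<longlonglongrightarrow> y (2 * pi)"
  proof (rule LIM_zero_cancel, rule Lim_null_comparison)
    show "\<forall>\<^sub>F n in sequentially. norm (pic n x (2 * pi) - y (2 * pi)) \<le> (3/4) ^ n * (6/59)"
      using b[of "2 * pi"] by simp
    show "(\<lambda>n. (3/4) ^ n * (6/59::real)) \<longlonglongrightarrow> 0"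
      by (intro tendsto_mult_left_zero LIMSEQ_power_zero) simp
  qed
  then show ?thesis using displ_LIMSEQ[OF x] LIMSEQ_unique by blast
qed

section \<open>Real trajectories in polar coordinates\<close>

definition cfield :: "complex \<Rightarrow> complex" where
  "cfield z = Complex (fst (vector_field d v (Re z, Im z))) (snd (vector_field d v (Re z, Im z)))"

text \<open>Division by z separates the polar equations: z'/z has real part (ln r)' and imaginary
  part \<phi>'.\<close>

lemma cfield_polar:
  "cfield (of_real r * cis \<phi>) =
     of_real r * cis \<phi> * Complex (Re (polP d v \<phi> (of_real r))) (1 + Re (polQ d v \<phi> (of_real r)))"
proof -
  define A where "A = Re (pol d (fst v) \<phi> (of_real r))"
  define B where "B = Re (pol d (snd v) \<phi> (of_real r))"
  have P: "Re (polP d v \<phi> (of_real r)) = cos \<phi> * A + sin \<phi> * B"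
    unfolding polP_def A_def B_def by simp
  have Q: "Re (polQ d v \<phi> (of_real r)) = cos \<phi> * B - sin \<phi> * A"
    unfolding polQ_def A_def B_def by simp
  \<comment> \<open>Inserting cos^2 + sin^2 on one side turns the claim into a polynomial identity
    in cos and sin.\<close>
  have e: "A = A * ((cos \<phi>)\<^sup>2 + (sin \<phi>)\<^sup>2)" "B = B * ((cos \<phi>)\<^sup>2 + (sin \<phi>)\<^sup>2)" by simp_all
  have 1: "cfield (of_real r * cis \<phi>) = Complex (- (r * sin \<phi>) + r * A) (r * cos \<phi> + r * B)"
    unfolding cfield_def vector_field_def by (simp add: poly_eval_polar A_def B_def)
  show ?thesis unfolding 1 P Q
    by (subst (1) e(1), subst (1) e(2)) (simp add: complex_eq_iff algebra_simps power2_eq_square del: sin_cos_squared_add sin_cos_squared_add2 sin_cos_squared_add3)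
qed

lemma polP_real_le: "\<bar>r\<bar> \<le> 1 \<Longrightarrow> \<bar>Re (polP d v \<phi> (of_real r))\<bar> \<le> 1/60"
  using abs_Re_le_cmod[of "polP d v \<phi> (of_real r)"] polP_le[of "of_real r" \<phi>] kappa_bounds(3) by simp

lemma polQ_real_le: "\<bar>r\<bar> \<le> 1 \<Longrightarrow> \<bar>Re (polQ d v \<phi> (of_real r))\<bar> \<le> 1/60"
  using abs_Re_le_cmod[of "polQ d v \<phi> (of_real r)"] polQ_le[of "of_real r" \<phi>] kappa_bounds(3) by simp

lemma slope_Re: "Re (slope d v \<phi> (of_real r)) = Re (polP d v \<phi> (of_real r)) / (1 + Re (polQ d v \<phi> (of_real r)))"
proof -
  have "polP d v \<phi> (of_real r) = of_real (Re (polP d v \<phi> (of_real r)))"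
    unfolding polP_def by (subst (1 2) pol_real) simp
  moreover have "polQ d v \<phi> (of_real r) = of_real (Re (polQ d v \<phi> (of_real r)))"
    unfolding polQ_def by (subst (1 2) pol_real) simp
  ultimately show ?thesis unfolding slope_def
    by (metis Re_complex_of_real of_real_1 of_real_add of_real_divide)
qed

text \<open>The radial speed is at most proportional to r, so |z|^2 satisfies a linear differential
  inequality and a zero at one time would propagate to all times.\<close>

lemma nonzero_trajectory:
  assumes z: "\<And>t. (z has_vector_derivative cfield (z t)) (at t)" and b: "\<And>t. norm (z t) \<le> 1"
    and nz: "z s \<noteq> 0"
  shows "z t \<noteq> 0"
proof
  assume zt: "z t = 0"
  have "(norm (z s))\<^sup>2 = 0"
  proof (rule abs_deriv_le_imp_eq_0[of "\<lambda>t. (norm (z t))\<^sup>2" "\<lambda>t. 2 * (z t \<bullet> cfield (z t))" 2 t])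
    fix t
    have "((\<lambda>t. z t \<bullet> z t) has_vector_derivative (z t \<bullet> cfield (z t) + cfield (z t) \<bullet> z t)) (at t)"
      by (rule bounded_bilinear.has_vector_derivative[OF bounded_bilinear_inner z z])
    then show "((\<lambda>t. (norm (z t))\<^sup>2) has_real_derivative 2 * (z t \<bullet> cfield (z t))) (at t)"
      by (simp add: has_real_derivative_iff_has_vector_derivative dot_square_norm inner_commute)
    have "z t = of_real (norm (z t)) * cis (Arg (z t))" by (simp add: rcis_def[symmetric] rcis_cmod_Arg)
    then obtain r \<phi> where r: "r = norm (z t)" and zr: "z t = of_real r * cis \<phi>" by blast
    have "z t \<bullet> cfield (z t) = r\<^sup>2 * Re (polP d v \<phi> (of_real r)) * ((cos \<phi>)\<^sup>2 + (sin \<phi>)\<^sup>2)"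
      unfolding zr cfield_polar inner_complex_def
      by (simp add: algebra_simps power2_eq_square del: sin_cos_squared_add sin_cos_squared_add2 sin_cos_squared_add3)
    then have "\<bar>z t \<bullet> cfield (z t)\<bar> = r\<^sup>2 * \<bar>Re (polP d v \<phi> (of_real r))\<bar>" by (simp add: abs_mult)
    also have "\<dots> \<le> r\<^sup>2 * 1" using polP_real_le[of r \<phi>] b[of t] r by (intro mult_left_mono) auto
    finally show "\<bar>2 * (z t \<bullet> cfield (z t))\<bar> \<le> 2 * (norm (z t))\<^sup>2" using r by simp
  qed (use zt in auto)
  then show False using nz by simp
qed

text \<open>A continuous logarithm of z is obtained by integrating z'/z; no lifting theorem for
  paths is involved. Its real and imaginary parts are ln r and an unwrapped angle.\<close>

lemma polar_lift:
  assumes z: "\<And>t. (z has_vector_derivative cfield (z t)) (at t)" and b: "\<And>t. norm (z t) \<le> 1"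
    and nz: "z s \<noteq> 0"
  obtains \<rho> \<phi> where "\<And>t. z t = of_real (exp (\<rho> t)) * cis (\<phi> t)"
    "\<And>t. (\<rho> has_real_derivative Re (polP d v (\<phi> t) (of_real (exp (\<rho> t))))) (at t)"
    "\<And>t. (\<phi> has_real_derivative 1 + Re (polQ d v (\<phi> t) (of_real (exp (\<rho> t))))) (at t)"
proof -
  have nz: "z t \<noteq> 0" for t using nonzero_trajectory[OF z b nz] .
  define w where "w t = cfield (z t) / z t" for t
  have zc: "isCont z t" for t using z[of t] has_vector_derivative_continuous by blast
  have contF: "continuous_on UNIV cfield"
  proof -
    have *: "continuous_on UNIV (\<lambda>z. poly_eval d a (Re z) (Im z))" for a
      unfolding poly_eval_def case_prod_unfold by (intro continuous_intros)
    show ?thesis unfolding cfield_def vector_field_def Complex_eq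
      by (auto intro!: continuous_intros *)
  qed
  have wc: "isCont w t" for t unfolding w_def
    using contF nz by (intro continuous_intros continuous_at_compose[OF zc, unfolded o_def] zc)
      (auto simp: continuous_on_eq_continuous_at isCont_o2[OF zc])
  obtain W0 where W0: "\<And>t. (W0 has_vector_derivative w t) (at t)"
    using einterval_antiderivative[of "-\<infinity>" "\<infinity>" w] wc by auto
  \<comment> \<open>The normalization at time 0 makes the constant z * exp (- W) equal to 1.\<close>
  define W where "W t = W0 t - W0 0 + Ln (z 0)" for t
  have W: "(W has_vector_derivative w t) (at t)" for t
    unfolding W_def by (auto intro!: derivative_eq_intros W0)
  have "((\<lambda>t. z t * exp (- W t)) has_vector_derivative 0) (at t within UNIV)" for t
  proof -
    have "((\<lambda>t. exp (- W t)) has_vector_derivative (- w t * exp (- W t))) (at t)"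
      using field_vector_diff_chain_at[OF has_vector_derivative_minus[OF W[of t]] DERIV_exp] by (simp add: o_def)
    from has_vector_derivative_mult[OF z this]
    show ?thesis using nz[of t] by (simp add: w_def)
  qed
  from has_vector_derivative_zero_constant[OF convex_UNIV this]
  obtain c where c: "\<And>t. z t * exp (- W t) = c" by auto
  have "c = 1" using c[of 0] nz[of 0] by (simp add: W_def exp_minus)
  then have zW: "z t = exp (W t)" for t using c[of t] by (simp add: exp_minus field_simps)
  define \<rho> \<phi> where "\<rho> t = Re (W t)" and "\<phi> t = Im (W t)" for t
  have 1: "z t = of_real (exp (\<rho> t)) * cis (\<phi> t)" for t
    unfolding zW \<rho>_def \<phi>_def by (simp add: exp_eq_polar)
  have w: "w t = Complex (Re (polP d v (\<phi> t) (of_real (exp (\<rho> t))))) (1 + Re (polQ d v (\<phi> t) (of_real (exp (\<rho> t)))))" for t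
    unfolding w_def using nz[of t] unfolding 1 cfield_polar by simp
  have "(\<rho> has_vector_derivative Re (w t)) (at t)" "(\<phi> has_vector_derivative Im (w t)) (at t)" for t
    unfolding \<rho>_def \<phi>_def
    by (rule bounded_linear.has_vector_derivative[OF bounded_linear_Re W] bounded_linear.has_vector_derivative[OF bounded_linear_Im W])+
  then show ?thesis using that[OF 1] by (simp add: w has_real_derivative_iff_has_vector_derivative)
qed

text \<open>The angle moves with speed between 59/60 and 61/60, so it can replace time;
  \<open>\<tau>\<close> is the time at which a given angle is reached. Its Lipschitz bounds are
  recorded because they later confine the duration of one turn.\<close>

lemma angle_parametrization:
  assumes z: "\<And>t. (z has_vector_derivative cfield (z t)) (at t)" and b: "\<And>t. norm (z t) \<le> 1"
    and nz: "z s \<noteq> 0"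
  obtains \<tau> l where "\<And>\<theta>. z (\<tau> \<theta>) = of_real (exp (l \<theta>)) * cis \<theta>"
    "\<And>\<theta>. (l has_real_derivative Re (slope d v \<theta> (of_real (exp (l \<theta>))))) (at \<theta>)"
    "surj \<tau>" "\<And>a b. a \<le> b \<Longrightarrow> 60/61 * (b - a) \<le> \<tau> b - \<tau> a"
    "\<And>a b. a \<le> b \<Longrightarrow> \<tau> b - \<tau> a \<le> 60/59 * (b - a)"
proof -
  obtain \<rho> \<phi> where \<rho>: "\<And>t. z t = of_real (exp (\<rho> t)) * cis (\<phi> t)"
    "\<And>t. (\<rho> has_real_derivative Re (polP d v (\<phi> t) (of_real (exp (\<rho> t))))) (at t)"
    and \<phi>: "\<And>t. (\<phi> has_real_derivative 1 + Re (polQ d v (\<phi> t) (of_real (exp (\<rho> t))))) (at t)"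
    using polar_lift[OF assms] by metis
  have le1: "\<bar>exp (\<rho> t)\<bar> \<le> 1" for t using b[of t] unfolding \<rho>(1) by (simp add: norm_mult)
  note Q = polQ_real_le[OF le1]
  have lo: "59/60 * (b - a) \<le> \<phi> b - \<phi> a" and hi: "\<phi> b - \<phi> a \<le> 61/60 * (b - a)" if ab: "a \<le> b" for a b
  proof -
    have "\<phi> a - 59/60 * a \<le> \<phi> b - 59/60 * b"
    proof (rule DERIV_nonneg_imp_nondecreasing[OF ab])
      fix t
      show "\<exists>y. ((\<lambda>t. \<phi> t - 59/60 * t) has_real_derivative y) (at t) \<and> 0 \<le> y"
        by (intro exI[of _ "1 + Re (polQ d v (\<phi> t) (of_real (exp (\<rho> t)))) - 59/60"] conjI)
           (use Q[of "\<phi> t" t] in \<open>auto intro!: derivative_eq_intros \<phi> simp: abs_le_iff\<close>)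
    qed
    then show "59/60 * (b - a) \<le> \<phi> b - \<phi> a" unfolding right_diff_distrib by linarith
    have "\<phi> a - 61/60 * a \<ge> \<phi> b - 61/60 * b"
    proof (rule DERIV_nonpos_imp_nonincreasing[OF ab])
      fix t
      show "\<exists>y. ((\<lambda>t. \<phi> t - 61/60 * t) has_real_derivative y) (at t) \<and> y \<le> 0"
        by (intro exI[of _ "1 + Re (polQ d v (\<phi> t) (of_real (exp (\<rho> t)))) - 61/60"] conjI)
           (use Q[of "\<phi> t" t] in \<open>auto intro!: derivative_eq_intros \<phi> simp: abs_le_iff\<close>)
    qed
    then show "\<phi> b - \<phi> a \<le> 61/60 * (b - a)" unfolding right_diff_distrib by linarith
  qed
  have cont: "isCont \<phi> t" for t using \<phi> DERIV_isCont by blast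
  have ex: "\<exists>t. \<phi> t = \<theta>" for \<theta>
  proof -
    \<comment> \<open>Since 59/60 * R >= |\<theta> - \<phi> 0|, the value \<theta> is attained
      between -R and R.\<close>
    define R where "R = 2 * \<bar>\<theta> - \<phi> 0\<bar>"
    have R: "R = 2 * \<bar>\<theta> - \<phi> 0\<bar>" "R \<ge> 0" by (simp_all add: R_def)
    have R': "59/60 * R \<le> \<phi> 0 - \<phi> (-R)" "59/60 * R \<le> \<phi> R - \<phi> 0"
      using lo[of "-R" 0] lo[of 0 R] R(2) by simp_all
    have "\<phi> (-R) \<le> \<theta>" using R R'(1) by (simp add: abs_if split: if_splits)
    moreover have "\<theta> \<le> \<phi> R" using R R'(2) by (simp add: abs_if split: if_splits)
    ultimately show ?thesis using IVT[of \<phi> "-R" \<theta> R] cont by (auto simp: R_def)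
  qed
  define \<tau> where "\<tau> \<theta> = (SOME t. \<phi> t = \<theta>)" for \<theta>
  have \<tau>: "\<phi> (\<tau> \<theta>) = \<theta>" for \<theta> unfolding \<tau>_def by (rule someI_ex[OF ex])
  have inj: "t = t'" if "\<phi> t = \<phi> t'" for t t'
    
  proof (cases "t \<le> t'")
    case True
    then show ?thesis using lo[OF True] that by simp
  next
    case False
    then show ?thesis using lo[of t' t] that by simp
  qed
  have \<tau>\<phi>: "\<tau> (\<phi> t) = t" for t by (rule inj[OF \<tau>])
  then have surj: "surj \<tau>" by (metis surjI)
  have mono: "\<tau> a \<le> \<tau> b" if "a \<le> b" for a b
    
  proof (rule ccontr)
    assume "\<not> \<tau> a \<le> \<tau> b"
    then show False using lo[of "\<tau> b" "\<tau> a"] that by (simp add: \<tau>)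
  qed
  have T1: "60/61 * (b - a) \<le> \<tau> b - \<tau> a" if "a \<le> b" for a b
    using hi[OF mono[OF that]] by (simp add: \<tau>)
  have T2: "\<tau> b - \<tau> a \<le> 60/59 * (b - a)" if "a \<le> b" for a b
    using lo[OF mono[OF that]] by (simp add: \<tau>)
  have "dist (\<tau> a) (\<tau> b) \<le> 60/59 * dist a b" for a b
    
  proof (cases "a \<le> b")
    case True
    then show ?thesis using T2[OF True] mono[OF True] by (simp add: dist_real_def)
  next
    case False
    then have "b \<le> a" by simp
    then show ?thesis using T2[of b a] mono[of b a] by (simp add: dist_real_def)
  qed
  then have "(60/59)-lipschitz_on UNIV \<tau>" by (auto intro!: lipschitz_onI)
  then have \<tau>c: "isCont \<tau> \<theta>" for \<theta>
    using lipschitz_on_continuous_on continuous_on_eq_continuous_at open_UNIV by blast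
  define l where "l \<theta> = \<rho> (\<tau> \<theta>)" for \<theta>
  have pos: "1 + Re (polQ d v \<theta> (of_real (exp (l \<theta>)))) > 0" for \<theta>
    using polQ_real_le[OF le1[of "\<tau> \<theta>"], of \<theta>] by (auto simp: l_def abs_le_iff)
  have \<tau>D: "(\<tau> has_real_derivative inverse (1 + Re (polQ d v \<theta> (of_real (exp (l \<theta>)))))) (at \<theta>)" for \<theta>
    by (rule DERIV_inverse_function[where f = \<phi> and a = "\<theta> - 1" and b = "\<theta> + 1"])
       (use \<phi>[of "\<tau> \<theta>"] pos[of \<theta>] \<tau>c \<tau> in \<open>auto simp: l_def\<close>)
  have lD: "(l has_real_derivative Re (slope d v \<theta> (of_real (exp (l \<theta>))))) (at \<theta>)" for \<theta>
  proof -
    have "((\<lambda>\<theta>. \<rho> (\<tau> \<theta>)) has_real_derivative Re (polP d v (\<phi> (\<tau> \<theta>)) (of_real (exp (\<rho> (\<tau> \<theta>)))))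
        * inverse (1 + Re (polQ d v \<theta> (of_real (exp (l \<theta>)))))) (at \<theta>)"
      by (rule DERIV_chain2[OF \<rho>(2) \<tau>D])
    moreover have "l = (\<lambda>\<theta>. \<rho> (\<tau> \<theta>))" by (simp add: l_def fun_eq_iff)
    ultimately show ?thesis unfolding slope_Re by (simp add: \<tau> divide_inverse)
  qed
  have "z (\<tau> \<theta>) = of_real (exp (l \<theta>)) * cis \<theta>" for \<theta> unfolding \<rho>(1) l_def \<tau> ..
  then show ?thesis using that lD surj T1 T2 by blast
qed

text \<open>A closed orbit closes up after a single turn. The increment D of l over one turn
  satisfies |D'| <= |D|, as the slope is 2 pi periodic in the angle and Lipschitz in ln r. Starting
  from the farthest point of the orbit D cannot be positive, from the nearest it cannot be negative,
  so D has a zero and then vanishes everywhere.\<close>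

lemma periodic_radius:
  assumes z: "\<And>t. (z has_vector_derivative cfield (z t)) (at t)" and b: "\<And>t. norm (z t) \<le> 6/10"
    and T: "T > 0" "\<And>t. z (t + T) = z t"
    and l: "\<And>\<theta>. z (\<tau> \<theta>) = of_real (exp (l \<theta>)) * cis \<theta>"
    and lD: "\<And>\<theta>. (l has_real_derivative Re (slope d v \<theta> (of_real (exp (l \<theta>))))) (at \<theta>)"
    and \<tau>: "surj \<tau>"
  shows "l (\<theta> + 2 * pi) = l \<theta>"
proof -
  have nl: "norm (z (\<tau> \<theta>)) = exp (l \<theta>)" for \<theta> by (simp add: l norm_mult)
  have lle: "l \<theta> \<le> -4/10" for \<theta>
  proof -
    have "exp (l \<theta>) \<le> 6/10" using b[of "\<tau> \<theta>"] nl by simp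
    then have "l \<theta> \<le> ln (6/10)" by (simp add: ln_ge_iff)
    then show ?thesis using ln_6_10 by linarith
  qed
  define D where "D \<theta> = l (\<theta> + 2 * pi) - l \<theta>" for \<theta>
  define D' where "D' \<theta> = Re (slope d v \<theta> (of_real (exp (l (\<theta> + 2 * pi))))) - Re (slope d v \<theta> (of_real (exp (l \<theta>))))" for \<theta>
  have DD: "(D has_real_derivative D' \<theta>) (at \<theta>)" for \<theta>
  proof -
    have "((\<lambda>\<theta>. l (\<theta> + 2 * pi)) has_real_derivative Re (slope d v (\<theta> + 2 * pi) (of_real (exp (l (\<theta> + 2 * pi)))))) (at \<theta>)"
      using lD[of "\<theta> + 2 * pi"] by (simp add: DERIV_shift)
    then show ?thesis unfolding D_def D'_def by (intro DERIV_diff lD) (simp add: slope_periodic)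
  qed
  have D'le: "\<bar>D' \<theta>\<bar> \<le> \<bar>D \<theta>\<bar>" for \<theta>
  proof -
    have "\<bar>D' \<theta>\<bar> \<le> norm (slope d v \<theta> (exp (of_real (l (\<theta> + 2 * pi)))) - slope d v \<theta> (exp (of_real (l \<theta>))))"
      unfolding D'_def exp_of_real minus_complex.sel[symmetric] by (rule abs_Re_le_cmod)
    also have "\<dots> \<le> 3/32 * norm (complex_of_real (l (\<theta> + 2 * pi)) - of_real (l \<theta>))"
      using lle[of \<theta>] lle[of "\<theta> + 2 * pi"] by (intro slope_exp_lipschitz) auto
    also have "norm (complex_of_real (l (\<theta> + 2 * pi)) - of_real (l \<theta>)) = \<bar>D \<theta>\<bar>"
      unfolding D_def by (metis norm_of_real of_real_diff)
    finally show ?thesis by simp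
  qed
  have period: "z t \<in> z ` {0..T}" for t
  \<comment> \<open>Reduction modulo T to one period, so that the extrema of |z| may be taken over a
    compact interval.\<close>
  proof -
    define k where "k = \<lfloor>t / T\<rfloor>"
    have n: "z (t + of_nat n * T) = z t" for n t
    proof (induction n)
      case (Suc n)
      have "t + of_nat (Suc n) * T = (t + of_nat n * T) + T" by (simp add: algebra_simps)
      then show ?case using T(2)[of "t + of_nat n * T"] Suc by (simp only:)
    qed simp
    have "z (t - of_int k * T) = z t"
    proof (cases "k \<ge> 0")
      case True
      then show ?thesis using n[of "t - of_int k * T" "nat k"] by simp
    next
      case False
      then show ?thesis using n[of t "nat (-k)"] by simp
    qed
    moreover have "t - of_int k * T \<in> {0..T}"
    proof -
      have "of_int k \<le> t / T" "t / T < of_int k + 1" unfolding k_def by linarith+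
      then show ?thesis using T(1) by (simp add: field_simps)
    qed
    ultimately show ?thesis by (metis imageI)
  qed
  have zc: "continuous_on {0..T} (\<lambda>t. norm (z t))"
    using z by (intro continuous_on_norm continuous_at_imp_continuous_on) (auto intro: has_vector_derivative_continuous)
  obtain t1 where t1: "\<And>t. norm (z t) \<le> norm (z t1)"
    using continuous_attains_sup[OF compact_Icc _ zc] T(1) period by (metis (no_types, lifting) atLeastAtMost_iff empty_iff imageE less_eq_real_def)
  obtain t2 where t2: "\<And>t. norm (z t2) \<le> norm (z t)"
    using continuous_attains_inf[OF compact_Icc _ zc] T(1) period by (metis (no_types, lifting) atLeastAtMost_iff empty_iff imageE less_eq_real_def)
  obtain \<theta>1 \<theta>2 where \<theta>: "t1 = \<tau> \<theta>1" "t2 = \<tau> \<theta>2" using \<tau> by (metis surjD)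
  have "D \<theta>1 \<le> 0" using t1[of "\<tau> (\<theta>1 + 2 * pi)"] unfolding \<theta> nl by (simp add: D_def)
  moreover have "D \<theta>2 \<ge> 0" using t2[of "\<tau> (\<theta>2 + 2 * pi)"] unfolding \<theta> nl by (simp add: D_def)
  moreover have "isCont D \<theta>" for \<theta> using DD DERIV_isCont by blast
  ultimately obtain \<theta>0 where \<theta>0: "D \<theta>0 = 0"
    using IVT[of D \<theta>1 0 \<theta>2] IVT2[of D \<theta>1 0 \<theta>2] IVT[of D \<theta>2 0 \<theta>1] IVT2[of D \<theta>2 0 \<theta>1]
    by (metis linear)
  have "(D \<theta>)\<^sup>2 = 0"
  proof (rule abs_deriv_le_imp_eq_0[of "\<lambda>\<theta>. (D \<theta>)\<^sup>2" "\<lambda>\<theta>. 2 * D \<theta> * D' \<theta>" 2 \<theta>0])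
    fix t
    show "((\<lambda>\<theta>. (D \<theta>)\<^sup>2) has_real_derivative 2 * D t * D' t) (at t)"
      by (auto intro!: derivative_eq_intros DD)
    have "\<bar>D t\<bar> * \<bar>D' t\<bar> \<le> \<bar>D t\<bar> * \<bar>D t\<bar>" by (intro mult_left_mono D'le) auto
    then show "\<bar>2 * D t * D' t\<bar> \<le> 2 * (D t)\<^sup>2" by (simp add: abs_mult power2_eq_square)
  qed (use \<theta>0 in auto)
  then show ?thesis by (simp add: D_def)
qed

text \<open>The difference l - l 0 solves the Picard equation with initial point exp (l 0) and stays
  within 6/59, so \<open>displ\<close> computes its value at 2 pi.\<close>

lemma displ_zero:
  assumes lD: "\<And>\<theta>. (l has_real_derivative Re (slope d v \<theta> (of_real (exp (l \<theta>))))) (at \<theta>)"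
    and lle: "\<And>\<theta>. exp (l \<theta>) \<le> 6/10" and per: "l (2 * pi) = l 0"
  shows "displ (of_real (exp (l 0))) = 0"
proof -
  define y where "y \<psi> = complex_of_real (l \<psi> - l 0)" for \<psi>
  have lc: "continuous_on X l" for X by (intro continuous_at_imp_continuous_on ballI DERIV_isCont[OF lD])
  have "displ (of_real (exp (l 0))) = y (2 * pi)"
  proof (rule displ_eq_fixpoint)
    have "exp (l 0) < 7/10" using lle[of 0] by linarith
    then show "norm (complex_of_real (exp (l 0))) < 7/10" by simp
    show "continuous_on {0..2*pi} y" unfolding y_def by (intro continuous_intros lc)
  next
    fix \<psi> :: real assume \<psi>: "\<psi> \<in> {0..2*pi}"
    have "norm (l \<psi> - l 0) \<le> 60/59 * \<kappa> * norm (\<psi> - 0)"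
    proof (rule field_differentiable_bound[of UNIV l "\<lambda>\<theta>. Re (slope d v \<theta> (of_real (exp (l \<theta>))))"])
      fix \<theta>
      show "(l has_real_derivative Re (slope d v \<theta> (of_real (exp (l \<theta>))))) (at \<theta> within UNIV)" using lD by simp
      have "exp (l \<theta>) \<le> 1" using lle[of \<theta>] by linarith
      then have "norm (complex_of_real (exp (l \<theta>))) \<le> 1" by simp
      from order_trans[OF abs_Re_le_cmod slope_le_kappa[OF this]]
      show "norm (Re (slope d v \<theta> (of_real (exp (l \<theta>))))) \<le> 60/59 * \<kappa>" by simp
    qed auto
    also have "\<dots> \<le> 60/59 * \<kappa> * (2 * pi)" using \<psi> kappa_bounds by (intro mult_left_mono) auto
    also have "\<dots> \<le> 6/59" using kappa_2pi by (simp add: mult.commute)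
    finally show "norm (y \<psi>) \<le> 6/59" unfolding y_def norm_of_real by simp
    let ?f = "\<lambda>\<tau>. slope d v (\<psi> * \<tau>) (of_real (exp (l (\<psi> * \<tau>))))"
    have "((\<lambda>\<tau>. \<psi> * Re (?f \<tau>)) has_integral (l (\<psi> * 1) - l (\<psi> * 0))) {0..1}"
    proof (rule fundamental_theorem_of_calculus)
      fix \<tau> :: real
      have "((\<lambda>\<tau>. l (\<psi> * \<tau>)) has_real_derivative Re (?f \<tau>) * \<psi>) (at \<tau>)"
        by (rule DERIV_chain2[OF lD]) (auto intro!: derivative_eq_intros)
      then show "((\<lambda>\<tau>. l (\<psi> * \<tau>)) has_vector_derivative \<psi> * Re (?f \<tau>)) (at \<tau> within {0..1})"
        by (simp add: has_real_derivative_iff_has_vector_derivative[symmetric] mult.commute has_field_derivative_at_within)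
    qed simp
    then have "((\<lambda>\<tau>. complex_of_real (\<psi> * Re (?f \<tau>))) has_integral y \<psi>) {0..1}"
      unfolding y_def by (intro has_integral_of_real) simp
    moreover have "complex_of_real (\<psi> * Re (?f \<tau>)) = of_real \<psi> * ?f \<tau>" for \<tau>
      unfolding of_real_mult slope_real[symmetric] ..
    ultimately have "y \<psi> = of_real \<psi> * integral {0..1} ?f" by (simp only: integral_mult_right[symmetric] integral_unique)
    moreover have "of_real (exp (l 0)) * exp (y x) = complex_of_real (exp (l x))" for x
      unfolding y_def exp_of_real of_real_mult[symmetric] exp_add[symmetric] by simp
    ultimately show "y \<psi> = of_real \<psi> * integral {0..1} (\<lambda>\<tau>. slope d v (\<psi> * \<tau>) (of_real (exp (l 0)) * exp (y (\<psi> * \<tau>))))"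
      by (simp only:)
  qed
  then show ?thesis by (simp add: y_def per)
qed

end

section \<open>Closed trajectories\<close>

lemma monomial_lipschitz:
  fixes x y x' y' :: real
  assumes "\<bar>x\<bar> \<le> 1" "\<bar>y\<bar> \<le> 1" "\<bar>x'\<bar> \<le> 1" "\<bar>y'\<bar> \<le> 1"
  shows "\<bar>x ^ k * y ^ i - x' ^ k * y' ^ i\<bar> \<le> real k * \<bar>x - x'\<bar> + real i * \<bar>y - y'\<bar>"
proof -
  have pw: "\<bar>a ^ n - b ^ n\<bar> \<le> real n * \<bar>a - b\<bar>" if "\<bar>a\<bar> \<le> 1" "\<bar>b\<bar> \<le> 1" for a b :: real and n
    using norm_power_diff[of a b n] that by simp
  have "x ^ k * y ^ i - x' ^ k * y' ^ i = (x ^ k - x' ^ k) * y ^ i + x' ^ k * (y ^ i - y' ^ i)"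
    by (simp add: algebra_simps)
  also have "\<bar>\<dots>\<bar> \<le> \<bar>x ^ k - x' ^ k\<bar> * \<bar>y ^ i\<bar> + \<bar>x' ^ k\<bar> * \<bar>y ^ i - y' ^ i\<bar>"
    by (metis abs_mult abs_triangle_ineq)
  also have "\<dots> \<le> (real k * \<bar>x - x'\<bar>) * 1 + 1 * (real i * \<bar>y - y'\<bar>)"
    using assms by (intro add_mono mult_mono pw) (auto simp: power_abs power_le_one)
  finally show ?thesis by simp
qed

text \<open>Sums of absolute values fit term-by-term estimates of polynomials; the metric serves
  only to express convergence of coefficients.\<close>

definition coeff_dist1 :: "nat \<Rightarrow> coeffs \<Rightarrow> coeffs \<Rightarrow> real" where
  "coeff_dist1 d v w =
     (\<Sum>p\<in>coeff_index d. \<bar>Poly_Mapping.lookup (fst v) p - Poly_Mapping.lookup (fst w) p\<bar>) +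
     (\<Sum>p\<in>coeff_index d. \<bar>Poly_Mapping.lookup (snd v) p - Poly_Mapping.lookup (snd w) p\<bar>)"

lemma coeff_dist1_nonneg [simp]: "coeff_dist1 d v w \<ge> 0"
  unfolding coeff_dist1_def by (intro add_nonneg_nonneg sum_nonneg) auto

lemma coeff_dist1_self [simp]: "coeff_dist1 d v v = 0"
  unfolding coeff_dist1_def by simp

lemma lookup_le_coeff_norm:
  assumes "p \<in> coeff_index d"
  shows "\<bar>Poly_Mapping.lookup (fst v) p\<bar> \<le> coeff_norm d v" "\<bar>Poly_Mapping.lookup (snd v) p\<bar> \<le> coeff_norm d v"
proof -
  have "\<bar>Poly_Mapping.lookup (fst v) p\<bar>\<^sup>2 \<le> (\<Sum>p\<in>coeff_index d. \<bar>Poly_Mapping.lookup (fst v) p\<bar>\<^sup>2)"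
    "\<bar>Poly_Mapping.lookup (snd v) p\<bar>\<^sup>2 \<le> (\<Sum>p\<in>coeff_index d. \<bar>Poly_Mapping.lookup (snd v) p\<bar>\<^sup>2)"
    by (intro member_le_sum assms; simp)+
  moreover have "(\<Sum>p\<in>coeff_index d. \<bar>Poly_Mapping.lookup (fst v) p\<bar>\<^sup>2) \<ge> 0"
    "(\<Sum>p\<in>coeff_index d. \<bar>Poly_Mapping.lookup (snd v) p\<bar>\<^sup>2) \<ge> 0" by (intro sum_nonneg; simp)+
  ultimately show "\<bar>Poly_Mapping.lookup (fst v) p\<bar> \<le> coeff_norm d v" "\<bar>Poly_Mapping.lookup (snd v) p\<bar> \<le> coeff_norm d v"
    unfolding coeff_norm_def by (auto intro!: real_le_rsqrt)
qed

lemma poly_eval_lipschitz: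
  assumes p: "norm (x, y) \<le> 1" "norm (x', y') \<le> (1::real)"
    and a: "\<And>p. p \<in> coeff_index d \<Longrightarrow> \<bar>Poly_Mapping.lookup a p\<bar> \<le> 1"
  shows "\<bar>poly_eval d a x y - poly_eval d b x' y'\<bar> \<le>
     real (card (coeff_index d)) * real d * norm ((x, y) - (x', y')) +
     (\<Sum>p\<in>coeff_index d. \<bar>Poly_Mapping.lookup a p - Poly_Mapping.lookup b p\<bar>)"
proof -
  have le: "\<bar>x\<bar> \<le> 1" "\<bar>y\<bar> \<le> 1" "\<bar>x'\<bar> \<le> 1" "\<bar>y'\<bar> \<le> 1"
    using p norm_fst_le[of x y] norm_snd_le[of y x] norm_fst_le[of x' y'] norm_snd_le[of y' x'] by auto
  have dl: "\<bar>x - x'\<bar> \<le> norm ((x, y) - (x', y'))" "\<bar>y - y'\<bar> \<le> norm ((x, y) - (x', y'))"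
    using norm_fst_le[of "x - x'" "y - y'"] norm_snd_le[of "y - y'" "x - x'"] by auto
  have "\<bar>poly_eval d a x y - poly_eval d b x' y'\<bar> \<le>
     (\<Sum>p\<in>coeff_index d. real d * norm ((x, y) - (x', y')) + \<bar>Poly_Mapping.lookup a p - Poly_Mapping.lookup b p\<bar>)"
    unfolding poly_eval_def sum_subtractf[symmetric]
  proof (rule order_trans[OF sum_abs], rule sum_mono, clarify)
    fix k i assume ki: "(k, i) \<in> coeff_index d"
    let ?A = "Poly_Mapping.lookup a (k, i)" and ?B = "Poly_Mapping.lookup b (k, i)"
    have "?A * x ^ k * y ^ i - ?B * x' ^ k * y' ^ i = ?A * (x ^ k * y ^ i - x' ^ k * y' ^ i) + (?A - ?B) * (x' ^ k * y' ^ i)"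
      by (simp add: algebra_simps)
    also have "\<bar>\<dots>\<bar> \<le> \<bar>?A\<bar> * \<bar>x ^ k * y ^ i - x' ^ k * y' ^ i\<bar> + \<bar>?A - ?B\<bar> * \<bar>x' ^ k * y' ^ i\<bar>"
      by (metis abs_mult abs_triangle_ineq)
    also have "\<dots> \<le> 1 * (real d * norm ((x, y) - (x', y'))) + \<bar>?A - ?B\<bar> * 1"
    proof (intro add_mono mult_mono a ki)
      have "\<bar>x ^ k * y ^ i - x' ^ k * y' ^ i\<bar> \<le> real k * \<bar>x - x'\<bar> + real i * \<bar>y - y'\<bar>"
        by (rule monomial_lipschitz[OF le])
      also have "\<dots> \<le> real k * norm ((x, y) - (x', y')) + real i * norm ((x, y) - (x', y'))"
        using dl by (intro add_mono mult_left_mono) auto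
      also have "\<dots> = real (k + i) * norm ((x, y) - (x', y'))" by (simp add: algebra_simps)
      also have "\<dots> \<le> real d * norm ((x, y) - (x', y'))"
        using ki by (intro mult_right_mono) (auto simp: coeff_index_def)
      finally show "\<bar>x ^ k * y ^ i - x' ^ k * y' ^ i\<bar> \<le> real d * norm ((x, y) - (x', y'))" .
      have "\<bar>x' ^ k\<bar> * \<bar>y' ^ i\<bar> \<le> 1 * 1" using le by (intro mult_mono) (auto simp: power_abs power_le_one)
      then show "\<bar>x' ^ k * y' ^ i\<bar> \<le> 1" by (simp add: abs_mult)
    qed auto
    finally show "\<bar>?A * x ^ k * y ^ i - ?B * x' ^ k * y' ^ i\<bar> \<le> real d * norm ((x, y) - (x', y')) + \<bar>?A - ?B\<bar>" by simp
  qed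
  also have "\<dots> = real (card (coeff_index d)) * real d * norm ((x, y) - (x', y')) +
     (\<Sum>p\<in>coeff_index d. \<bar>Poly_Mapping.lookup a p - Poly_Mapping.lookup b p\<bar>)"
    by (simp add: sum.distrib)
  finally show ?thesis .
qed

definition field_lip :: "nat \<Rightarrow> real" where
  "field_lip d = 2 + 2 * (real (card (coeff_index d)) * real d)"

lemma field_lip_nonneg [simp]: "field_lip d \<ge> 0"
  by (simp add: field_lip_def)

text \<open>One estimate for both kinds of dependence: w = v gives Lipschitz continuity in the
  point, p = q gives continuity in the coefficients.\<close>

lemma vector_field_lipschitz:
  assumes "norm p \<le> 1" "norm q \<le> 1" "coeff_norm d v \<le> 1"
  shows "norm (vector_field d v p - vector_field d w q) \<le> field_lip d * norm (p - q) + coeff_dist1 d v w"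
proof -
  obtain x y x' y' where pq: "p = (x, y)" "q = (x', y')" by (metis surj_pair)
  have l: "\<bar>Poly_Mapping.lookup (fst v) p\<bar> \<le> 1" "\<bar>Poly_Mapping.lookup (snd v) p\<bar> \<le> 1" if "p \<in> coeff_index d" for p
    using lookup_le_coeff_norm[OF that, of v] assms(3) by linarith+
  have dl: "\<bar>x - x'\<bar> \<le> norm (p - q)" "\<bar>y - y'\<bar> \<le> norm (p - q)"
    unfolding pq using norm_fst_le[of "x - x'" "y - y'"] norm_snd_le[of "y - y'" "x - x'"] by auto
  note F = poly_eval_lipschitz[where d = d, OF assms(1,2)[unfolded pq] l(1), where b = "fst w", folded pq]
    and G = poly_eval_lipschitz[where d = d, OF assms(1,2)[unfolded pq] l(2), where b = "snd w", folded pq]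
  have "norm (vector_field d v p - vector_field d w q) \<le>
     \<bar>(- y + poly_eval d (fst v) x y) - (- y' + poly_eval d (fst w) x' y')\<bar> +
     \<bar>(x + poly_eval d (snd v) x y) - (x' + poly_eval d (snd w) x' y')\<bar>"
    unfolding pq vector_field_def by (simp add: norm_Pair sqrt_sum_squares_le_sum_abs)
  also have "\<dots> \<le> (\<bar>y - y'\<bar> + \<bar>poly_eval d (fst v) x y - poly_eval d (fst w) x' y'\<bar>) +
     (\<bar>x - x'\<bar> + \<bar>poly_eval d (snd v) x y - poly_eval d (snd w) x' y'\<bar>)" by linarith
  also have "\<dots> \<le> field_lip d * norm (p - q) + coeff_dist1 d v w"
    using F G dl unfolding field_lip_def coeff_dist1_def by (simp add: algebra_simps)
  finally show ?thesis .
qed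

section \<open>Dependence of trajectories on the initial point and the coefficients\<close>

definition trajectory :: "nat \<Rightarrow> coeffs \<Rightarrow> (real \<Rightarrow> real \<times> real) \<Rightarrow> bool" where
  "trajectory d v \<gamma> \<longleftrightarrow> (\<forall>t. (\<gamma> has_vector_derivative vector_field d v (\<gamma> t)) (at t))"

lemma trajectory_shift: "trajectory d v \<gamma> \<Longrightarrow> trajectory d v (\<lambda>t. \<gamma> (t + s))"
  unfolding trajectory_def
proof
  fix t assume "\<forall>t. (\<gamma> has_vector_derivative vector_field d v (\<gamma> t)) (at t)"
  then have "(\<gamma> has_vector_derivative vector_field d v (\<gamma> (t + s))) (at (t + s))" by blast
  then have "((\<gamma> \<circ> (\<lambda>t. t + s)) has_vector_derivative 1 *\<^sub>R vector_field d v (\<gamma> (t + s))) (at t)"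
    by (intro vector_diff_chain_at) (auto intro!: derivative_eq_intros)
  then show "((\<lambda>t. \<gamma> (t + s)) has_vector_derivative vector_field d v (\<gamma> (t + s))) (at t)"
    by (simp add: o_def)
qed

text \<open>Adding the constant square of the coefficient distance to the squared gap absorbs the
  inhomogeneous term, so the homogeneous Gronwall bound applies to the sum.\<close>

lemma trajectory_dist:
  assumes tr: "trajectory d v \<gamma>" "trajectory d w \<eta>"
    and b: "\<And>t. norm (\<gamma> t) \<le> 1" "\<And>t. norm (\<eta> t) \<le> 1" and v: "coeff_norm d v \<le> 1"
  shows "(norm (\<gamma> t - \<eta> t))\<^sup>2 + (coeff_dist1 d v w)\<^sup>2 \<le>
    ((norm (\<gamma> s - \<eta> s))\<^sup>2 + (coeff_dist1 d v w)\<^sup>2) * exp ((2 * field_lip d + 1) * \<bar>t - s\<bar>)"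
proof (rule abs_deriv_le_imp_exp_bound[of "\<lambda>t. (norm (\<gamma> t - \<eta> t))\<^sup>2 + (coeff_dist1 d v w)\<^sup>2"
    "\<lambda>t. 2 * ((\<gamma> t - \<eta> t) \<bullet> (vector_field d v (\<gamma> t) - vector_field d w (\<eta> t)))"])
  fix t
  let ?X = "vector_field d v (\<gamma> t) - vector_field d w (\<eta> t)"
  have "((\<lambda>t. \<gamma> t - \<eta> t) has_vector_derivative ?X) (at t)"
    using tr unfolding trajectory_def by (intro derivative_intros) auto
  from bounded_bilinear.has_vector_derivative[OF bounded_bilinear_inner this this]
  have "((\<lambda>t. (\<gamma> t - \<eta> t) \<bullet> (\<gamma> t - \<eta> t)) has_real_derivative 2 * ((\<gamma> t - \<eta> t) \<bullet> ?X)) (at t)"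
    by (simp add: has_real_derivative_iff_has_vector_derivative inner_commute)
  then show "((\<lambda>t. (norm (\<gamma> t - \<eta> t))\<^sup>2 + (coeff_dist1 d v w)\<^sup>2) has_real_derivative 2 * ((\<gamma> t - \<eta> t) \<bullet> ?X)) (at t)"
    unfolding power2_norm_eq_inner by (auto intro!: derivative_eq_intros)
  let ?n = "norm (\<gamma> t - \<eta> t)" and ?s = "coeff_dist1 d v w"
  have "\<bar>2 * ((\<gamma> t - \<eta> t) \<bullet> ?X)\<bar> \<le> 2 * (?n * norm ?X)"
    using Cauchy_Schwarz_ineq2[of "\<gamma> t - \<eta> t" ?X] by simp
  also have "\<dots> \<le> 2 * (?n * (field_lip d * ?n + ?s))"
    using vector_field_lipschitz[OF b(1) b(2) v] by (intro mult_left_mono) auto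
  also have "\<dots> \<le> (2 * field_lip d + 1) * (?n\<^sup>2 + ?s\<^sup>2)"
  proof -
    have "2 * (?n * ?s) \<le> ?n\<^sup>2 + ?s\<^sup>2" using sum_squares_bound[of ?n ?s] by simp
    moreover have "0 \<le> 2 * (field_lip d * ?s\<^sup>2)" by simp
    ultimately have "2 * (?n * ?s) + 2 * (field_lip d * ?n\<^sup>2) \<le> ?n\<^sup>2 + ?s\<^sup>2 + 2 * (field_lip d * ?s\<^sup>2) + 2 * (field_lip d * ?n\<^sup>2)"
      by linarith
    then show ?thesis by (simp add: algebra_simps power2_eq_square)
  qed
  finally show "\<bar>2 * ((\<gamma> t - \<eta> t) \<bullet> ?X)\<bar> \<le> (2 * field_lip d + 1) * (?n\<^sup>2 + ?s\<^sup>2)" .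
qed

lemma trajectory_unique:
  assumes tr: "trajectory d v \<gamma>" "trajectory d v \<eta>"
    and b: "\<And>t. norm (\<gamma> t) \<le> 1" "\<And>t. norm (\<eta> t) \<le> 1" and v: "coeff_norm d v \<le> 1"
    and eq: "\<gamma> s = \<eta> s"
  shows "\<gamma> = \<eta>"
proof
  fix t
  have "(norm (\<gamma> t - \<eta> t))\<^sup>2 \<le> 0" using trajectory_dist[OF tr b v, of t s] eq by simp
  then show "\<gamma> t = \<eta> t" by simp
qed

text \<open>No existence theorem for the limit system enters: Gronwall makes the sequence uniformly
  Cauchy on bounded time intervals, the fields converge uniformly along it, and so the limit is
  itself a trajectory of w.\<close>

lemma trajectory_limit:
  assumes tr: "\<And>n. trajectory d (v n) (\<gamma> n)" and b: "\<And>n t. norm (\<gamma> n t) \<le> R" and R: "R \<le> 1"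
    and v: "\<And>n. coeff_norm d (v n) \<le> 1"
    and lim: "(\<lambda>n. coeff_dist1 d (v n) w) \<longlonglongrightarrow> 0" and l0: "(\<lambda>n. \<gamma> n 0) \<longlonglongrightarrow> p"
  obtains \<eta> where "trajectory d w \<eta>" "\<And>t. (\<lambda>n. \<gamma> n t) \<longlonglongrightarrow> \<eta> t" "\<eta> 0 = p" "\<And>t. norm (\<eta> t) \<le> R"
proof -
  define K where "K = 2 * field_lip d + 1"
  have K: "K \<ge> 0" by (simp add: K_def)
  have tri: "coeff_dist1 d (v m) (v n) \<le> coeff_dist1 d (v m) w + coeff_dist1 d (v n) w" for m n
  proof -
    have *: "(\<Sum>p\<in>A. \<bar>f p - g p\<bar>) \<le> (\<Sum>p\<in>A. \<bar>f p - h p\<bar>) + (\<Sum>p\<in>A. \<bar>g p - h p\<bar>)"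
      for A and f g h :: "nat \<times> nat \<Rightarrow> real"
      unfolding sum.distrib[symmetric] by (intro sum_mono) linarith
    show ?thesis unfolding coeff_dist1_def
      using *[of "Poly_Mapping.lookup (fst (v m))" "Poly_Mapping.lookup (fst (v n))" "coeff_index d" "Poly_Mapping.lookup (fst w)"]
        *[of "Poly_Mapping.lookup (snd (v m))" "Poly_Mapping.lookup (snd (v n))" "coeff_index d" "Poly_Mapping.lookup (snd w)"]
      by linarith
  qed
  define a where "a n = norm (\<gamma> n 0 - p) + coeff_dist1 d (v n) w" for n
  have a: "a \<longlonglongrightarrow> 0" unfolding a_def
    using tendsto_add[OF tendsto_norm_zero[OF LIM_zero[OF l0]] lim] by simp
  have close: "norm (\<gamma> m t - \<gamma> n t) \<le> (a m + a n) * exp (K * r)" if t: "\<bar>t\<bar> \<le> r" for m n t r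
  proof (rule power2_le_imp_le)
    let ?A = "norm (\<gamma> m 0 - \<gamma> n 0)" and ?B = "coeff_dist1 d (v m) (v n)"
    have E: "1 \<le> exp (K * r)" using K t by simp
    have "(norm (\<gamma> m t - \<gamma> n t))\<^sup>2 \<le> (?A\<^sup>2 + ?B\<^sup>2) * exp (K * \<bar>t - 0\<bar>)"
      using trajectory_dist[OF tr tr order_trans[OF b R] order_trans[OF b R] v, of m t n 0] unfolding K_def
      by (meson add_increasing2 order_trans order_refl zero_le_power2 le_add_same_cancel1)
    also have "\<dots> \<le> (?A + ?B)\<^sup>2 * exp (K * r)"
      using K t by (intro mult_mono) (auto simp: power2_sum intro: mult_left_mono)
    \<comment> \<open>The exponential is at least 1 and may be squared, which makes the right side a
      perfect square.\<close>
    also have "\<dots> \<le> (?A + ?B)\<^sup>2 * (exp (K * r))\<^sup>2"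
      using E by (intro mult_left_mono) (auto simp: power2_eq_square)
    also have "\<dots> \<le> (a m + a n)\<^sup>2 * (exp (K * r))\<^sup>2"
    proof (intro mult_right_mono power_mono)
      have "?A \<le> norm (\<gamma> m 0 - p) + norm (\<gamma> n 0 - p)" by norm
      then show "?A + ?B \<le> a m + a n" using tri[of m n] unfolding a_def by linarith
    qed auto
    finally show "(norm (\<gamma> m t - \<gamma> n t))\<^sup>2 \<le> ((a m + a n) * exp (K * r))\<^sup>2" by (simp add: power_mult_distrib)
    show "0 \<le> (a m + a n) * exp (K * r)" by (simp add: a_def)
  qed
  have uc: "uniformly_Cauchy_on {-r..r} \<gamma>" for r
    unfolding uniformly_Cauchy_on_def
  proof (intro allI impI)
    fix e :: real assume "e > 0"
    then have "e / (2 * exp (K * r)) > 0" by simp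
    with a obtain M where M: "\<And>n. n \<ge> M \<Longrightarrow> norm (a n - 0) < e / (2 * exp (K * r))"
      unfolding LIMSEQ_iff by metis
    have "dist (\<gamma> m t) (\<gamma> n t) < e" if "t \<in> {-r..r}" "m \<ge> M" "n \<ge> M" for m n t
    proof -
      have "a m + a n < 2 * (e / (2 * exp (K * r)))" using M[OF that(2)] M[OF that(3)] by simp
      then have "(a m + a n) * exp (K * r) < e" by (simp add: field_simps)
      then show ?thesis using close[of t r m n] that(1) by (auto simp: dist_norm abs_le_iff)
    qed
    then show "\<exists>M. \<forall>t\<in>{-r..r}. \<forall>m\<ge>M. \<forall>n\<ge>M. dist (\<gamma> m t) (\<gamma> n t) < e" by blast
  qed
  define \<eta> where "\<eta> t = lim (\<lambda>n. \<gamma> n t)" for t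
  have ul: "uniform_limit {-r..r} \<gamma> \<eta> sequentially" for r
    using Cauchy_uniformly_convergent[OF uc[of r]] unfolding uniformly_convergent_uniform_limit_iff \<eta>_def .
  have pl: "(\<lambda>n. \<gamma> n t) \<longlonglongrightarrow> \<eta> t" for t
    by (rule tendsto_uniform_limitI[OF ul[of "\<bar>t\<bar>"]]) auto
  have \<eta>b: "norm (\<eta> t) \<le> R" for t
    by (rule Lim_norm_ubound[OF _ pl]) (use b in auto)
  have "(\<eta> has_vector_derivative vector_field d w (\<eta> t)) (at t)" for t
  proof -
    define r where "r = \<bar>t\<bar> + 1"
    let ?S = "{-r<..<r}"
    have tS: "t \<in> ?S" by (auto simp: r_def)
    have "\<exists>g. \<forall>x\<in>?S. (\<lambda>n. \<gamma> n x) \<longlonglongrightarrow> g x \<and> (g has_derivative (\<lambda>h. h *\<^sub>R vector_field d w (\<eta> x))) (at x within ?S)"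
    proof (rule has_derivative_sequence)
      show "(\<gamma> n has_derivative (\<lambda>h. h *\<^sub>R vector_field d (v n) (\<gamma> n x))) (at x within ?S)" for n x
        using tr[of n] unfolding trajectory_def has_vector_derivative_def
        by (blast intro: has_derivative_at_withinI)
      fix e :: real assume e: "e > 0"
      define e' where "e' = e / (field_lip d + 1)"
      have pos: "field_lip d + 1 > 0" using field_lip_nonneg[of d] by linarith
      then have e': "e' > 0" using e by (simp add: e'_def)
      have "\<forall>\<^sub>F n in sequentially. \<forall>x\<in>{-r..r}. dist (\<gamma> n x) (\<eta> x) < e'"
        using ul[of r] e' unfolding uniform_limit_iff by blast
      moreover have "\<forall>\<^sub>F n in sequentially. coeff_dist1 d (v n) w < e'"
        using lim e' by (rule order_tendstoD)
      ultimately show "\<forall>\<^sub>F n in sequentially. \<forall>x\<in>?S. \<forall>h. norm (h *\<^sub>R vector_field d (v n) (\<gamma> n x) - h *\<^sub>R vector_field d w (\<eta> x)) \<le> e * norm h"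
      proof eventually_elim
        case (elim n)
        show ?case
        proof (intro ballI allI)
          fix x h :: real assume x: "x \<in> ?S"
          have "norm (vector_field d (v n) (\<gamma> n x) - vector_field d w (\<eta> x)) \<le> field_lip d * norm (\<gamma> n x - \<eta> x) + coeff_dist1 d (v n) w"
            by (intro vector_field_lipschitz order_trans[OF b R] order_trans[OF \<eta>b R] v)
          also have "\<dots> \<le> field_lip d * e' + e'"
            using elim x by (intro add_mono mult_left_mono) (auto simp: dist_norm less_imp_le)
          also have "field_lip d * e' + e' = e' * (field_lip d + 1)" by (simp add: algebra_simps)
          also have "\<dots> = e" using pos by (simp add: e'_def)
          finally have "norm h * norm (vector_field d (v n) (\<gamma> n x) - vector_field d w (\<eta> x)) \<le> norm h * e"
            by (intro mult_left_mono) auto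
          then show "norm (h *\<^sub>R vector_field d (v n) (\<gamma> n x) - h *\<^sub>R vector_field d w (\<eta> x)) \<le> e * norm h"
            unfolding scaleR_diff_right[symmetric] norm_scaleR by (simp add: mult.commute)
        qed
      qed
    qed (use tS pl in auto)
    then obtain g where g: "\<And>x. x \<in> ?S \<Longrightarrow> (\<lambda>n. \<gamma> n x) \<longlonglongrightarrow> g x"
      "\<And>x. x \<in> ?S \<Longrightarrow> (g has_derivative (\<lambda>h. h *\<^sub>R vector_field d w (\<eta> x))) (at x within ?S)" by blast
    have "g x = \<eta> x" if "x \<in> ?S" for x using g(1)[OF that] pl LIMSEQ_unique by blast
    then have "(\<eta> has_derivative (\<lambda>h. h *\<^sub>R vector_field d w (\<eta> t))) (at t within ?S)"
      by (intro has_derivative_transform[OF tS _ g(2)[OF tS]]) auto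
    then show ?thesis unfolding has_vector_derivative_def at_within_open[OF tS open_greaterThanLessThan] .
  qed
  then have "trajectory d w \<eta>" unfolding trajectory_def by blast
  moreover have "\<eta> 0 = p" by (rule LIMSEQ_unique[OF pl l0])
  ultimately show ?thesis by (intro that[of \<eta>] pl \<eta>b)
qed

lemma closed_trajectory_alt:
  "closed_trajectory d v S \<longleftrightarrow> (\<exists>\<gamma> T. trajectory d v \<gamma> \<and> 0 < T \<and> (\<forall>t. \<gamma> (t + T) = \<gamma> t) \<and>
     (\<exists>t. \<gamma> t \<noteq> \<gamma> 0) \<and> S = range \<gamma>)"
  unfolding closed_trajectory_def trajectory_def ..

text \<open>Records each closed orbit by its crossing with the positive x-axis. Isolation is not
  asked for, since it need not survive limits of coefficients.\<close>

definition orbit_pts :: "nat \<Rightarrow> coeffs \<Rightarrow> real set" where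
  "orbit_pts d v = {x. 0 < x \<and> (\<exists>S. closed_trajectory d v S \<and> S \<subseteq> cball 0 (1/2) \<and> (x, 0) \<in> S)}"

lemma range_shift: "range (\<lambda>t. \<gamma> (t + s :: real)) = range \<gamma>"
proof -
  have "\<gamma> t \<in> range (\<lambda>t. \<gamma> (t + s))" for t by (rule range_eqI[of _ _ "t - s"]) simp
  then show ?thesis by auto
qed

lemma vector_field_0: "vector_field d v 0 = 0"
proof -
  have "poly_eval d a 0 0 = 0" for a
    unfolding poly_eval_def by (rule sum.neutral) (auto simp: coeff_index_def power_0_left)
  then show ?thesis by (simp add: vector_field_def zero_prod_def)
qed

section \<open>Closed trajectories as zeros of the displacement function\<close>

context small_field
begin

lemma coeff_norm_le_1: "coeff_norm d v \<le> 1"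
proof -
  have "1 * coeff_norm d v \<le> sqrt (real d) * coeff_norm d v"
    using d1 by (intro mult_right_mono) auto
  also have "\<dots> \<le> 1 / (40 * pi)" by (rule small)
  also have "\<dots> \<le> 1" using pi_gt3 by simp
  finally show ?thesis by simp
qed

text \<open>Time is shifted so that the orbit starts on the positive axis, and T is the duration of
  one turn, in general not the period supplied by \<open>closed_trajectory\<close>. Its bounds are
  uniform in the system, which later gives compactness. The radius 6/10 exceeds 1/2 to leave room
  for an isolating neighbourhood.\<close>

lemma closed_trajectory_normal_form:
  assumes S: "closed_trajectory d v S" "S \<subseteq> cball 0 (6/10)"
  obtains x \<gamma> T where "0 < x" "x \<le> 6/10" "trajectory d v \<gamma>" "\<gamma> 0 = (x, 0)" "S = range \<gamma>"
    "1 \<le> T" "T \<le> 10" "\<And>t. \<gamma> (t + T) = \<gamma> t" "displ (of_real x) = 0"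
    "\<And>y. 0 < y \<Longrightarrow> (y, 0) \<in> S \<Longrightarrow> y = x"
proof -
  obtain \<gamma>0 T0 where g: "trajectory d v \<gamma>0" "0 < T0" "\<And>t. \<gamma>0 (t + T0) = \<gamma>0 t"
    "\<exists>t. \<gamma>0 t \<noteq> \<gamma>0 0" "S = range \<gamma>0"
    using S(1) unfolding closed_trajectory_alt by blast
  have b: "norm (\<gamma>0 t) \<le> 6/10" for t
  proof -
    have "\<gamma>0 t \<in> cball 0 (6/10)" using S(2) g(5) by blast
    then show ?thesis by simp
  qed
  define z where "z t = Complex (fst (\<gamma>0 t)) (snd (\<gamma>0 t))" for t
  have nz: "norm (z t) = norm (\<gamma>0 t)" for t
    unfolding z_def by (simp add: cmod_def norm_prod_def)
  have bl: "bounded_linear (\<lambda>p. Complex (fst p) (snd p))"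
    unfolding linear_conv_bounded_linear[symmetric] by (auto intro!: linearI simp: complex_eq_iff)
  have z: "(z has_vector_derivative cfield (z t)) (at t)" for t
    using bounded_linear.has_vector_derivative[OF bl, of \<gamma>0 "vector_field d v (\<gamma>0 t)" "at t"] g(1)
    unfolding trajectory_def z_def cfield_def by simp
  have zb: "norm (z t) \<le> 6/10" for t using b nz by simp
  then have zb1: "norm (z t) \<le> 1" for t by (rule order_trans) simp
  obtain s where s: "z s \<noteq> 0"
  proof -
    obtain t where "\<gamma>0 t \<noteq> \<gamma>0 0" using g(4) by blast
    then have "z t \<noteq> 0 \<or> z 0 \<noteq> 0" using nz[of t] nz[of 0] by auto
    then show ?thesis using that by blast
  qed
  obtain \<tau> l where l: "\<And>\<theta>. z (\<tau> \<theta>) = of_real (exp (l \<theta>)) * cis \<theta>"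
    and lD: "\<And>\<theta>. (l has_real_derivative Re (slope d v \<theta> (of_real (exp (l \<theta>))))) (at \<theta>)"
    and \<tau>: "surj \<tau>" and T1: "\<And>a b. a \<le> b \<Longrightarrow> 60/61 * (b - a) \<le> \<tau> b - \<tau> a"
    and T2: "\<And>a b. a \<le> b \<Longrightarrow> \<tau> b - \<tau> a \<le> 60/59 * (b - a)"
    by (rule angle_parametrization[OF z zb1 s]) (rule that)
  have per: "l (\<theta> + 2 * pi) = l \<theta>" for \<theta>
    by (rule periodic_radius[OF z zb g(2) _ l lD \<tau>]) (simp add: z_def g(3))
  have pern: "l (\<theta> + of_nat n * (2 * pi)) = l \<theta>" for \<theta> n
  proof (induction n)
    case (Suc n)
    have "\<theta> + of_nat (Suc n) * (2 * pi) = \<theta> + of_nat n * (2 * pi) + 2 * pi" by (simp add: algebra_simps)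
    then show ?case using per[of "\<theta> + of_nat n * (2 * pi)"] Suc by (simp only:)
  qed simp
  have peri: "l (of_int n * (2 * pi)) = l 0" for n
  proof (cases "n \<ge> 0")
    case True
    then show ?thesis using pern[of 0 "nat n"] by simp
  next
    case False
    then show ?thesis using pern[of "of_int n * (2 * pi)" "nat (- n)"] by simp
  qed
  define x where "x = exp (l 0)"
  have nl: "norm (z (\<tau> \<theta>)) = exp (l \<theta>)" for \<theta> by (simp add: l norm_mult)
  have lle: "exp (l \<theta>) \<le> 6/10" for \<theta> using zb[of "\<tau> \<theta>"] nl by simp
  define \<gamma> where "\<gamma> t = \<gamma>0 (t + \<tau> 0)" for t
  have tr: "trajectory d v \<gamma>" unfolding \<gamma>_def by (rule trajectory_shift[OF g(1)])
  have rg: "S = range \<gamma>" unfolding \<gamma>_def range_shift g(5) ..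
  have z0: "z (\<tau> 0) = of_real x" unfolding l x_def by simp
  then have g0: "\<gamma> 0 = (x, 0)" unfolding \<gamma>_def z_def by (simp add: complex_eq_iff prod_eq_iff)
  define T where "T = \<tau> (2 * pi) - \<tau> 0"
  have "z (\<tau> (2 * pi)) = of_real x" unfolding l x_def using per[of 0] by simp
  then have gT: "\<gamma> T = (x, 0)" unfolding \<gamma>_def z_def T_def by (simp add: complex_eq_iff prod_eq_iff)
  have gb: "norm (\<gamma> t) \<le> 1" for t unfolding \<gamma>_def using b[of "t + \<tau> 0"] by linarith
  \<comment> \<open>After one turn the radius is the same, so the shifted trajectory agrees with the
    original at time 0 and uniqueness makes T a period.\<close>
  have "(\<lambda>t. \<gamma> (t + T)) = \<gamma>"
    by (rule trajectory_unique[OF trajectory_shift[OF tr] tr _ _ coeff_norm_le_1, of _ 0]) (use gb g0 gT in auto)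
  then have gper: "\<gamma> (t + T) = \<gamma> t" for t by (rule fun_cong)
  have "1 \<le> T" using T1[of 0 "2 * pi"] pi_gt3 unfolding T_def by simp
  moreover have "T \<le> 10" using T2[of 0 "2 * pi"] pi_less_4 unfolding T_def by simp
  moreover have "displ (of_real x) = 0" unfolding x_def
    using per[of 0] by (intro displ_zero lD lle) simp
  moreover have "y = x" if y: "0 < y" "(y, 0) \<in> S" for y
  proof -
    obtain t where t: "\<gamma>0 t = (y, 0)" using y(2) g(5) by (metis imageE)
    obtain \<theta> where \<theta>: "t = \<tau> \<theta>" using \<tau> by (metis surjD)
    have zy: "z (\<tau> \<theta>) = of_real y" unfolding z_def \<theta>[symmetric] t by (simp add: complex_eq_iff)
    then have ly: "exp (l \<theta>) = y" using nl[of \<theta>] y by simp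
    \<comment> \<open>A crossing of the positive axis happens at a multiple of 2 pi, where l takes
      the value l 0.\<close>
    then have "cis \<theta> = 1" using zy y unfolding l by simp
    then have "cos \<theta> = 1" by (simp add: complex_eq_iff)
    then obtain n :: int where "\<theta> = of_int n * 2 * pi" using cos_one_2pi_int by blast
    then have "l \<theta> = l 0" using peri[of n] by (simp add: mult.assoc)
    then show "y = x" using ly unfolding x_def by simp
  qed
  moreover have "0 < x" "x \<le> 6/10" unfolding x_def using lle by auto
  ultimately show ?thesis using tr g0 rg gper by (intro that[of x \<gamma> T])
qed

lemma closed_trajectory_same:
  assumes "closed_trajectory d v S" "S \<subseteq> cball 0 (6/10)" "(x, 0) \<in> S"
    and "closed_trajectory d v S'" "S' \<subseteq> cball 0 (6/10)" "(x, 0) \<in> S'" and "0 < x"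
  shows "S = S'"
proof -
  obtain y \<gamma> where 1: "trajectory d v \<gamma>" "\<gamma> 0 = (y, 0)" "S = range \<gamma>" "x = y"
    using closed_trajectory_normal_form[OF assms(1,2)] assms(3,7) by metis
  obtain y' \<gamma>' where 2: "trajectory d v \<gamma>'" "\<gamma>' 0 = (y', 0)" "S' = range \<gamma>'" "x = y'"
    using closed_trajectory_normal_form[OF assms(4,5)] assms(6,7) by metis
  have "norm (\<gamma> t) \<le> 1" for t
  proof -
    have "\<gamma> t \<in> S" using 1 by simp
    then have "norm (\<gamma> t) \<le> 6/10" using assms(2) by (auto simp: subset_eq)
    then show ?thesis by linarith
  qed
  moreover have "norm (\<gamma>' t) \<le> 1" for t
  proof -
    have "\<gamma>' t \<in> S'" using 2 by simp
    then have "norm (\<gamma>' t) \<le> 6/10" using assms(5) by (auto simp: subset_eq)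
    then show ?thesis by linarith
  qed
  ultimately have "\<gamma> = \<gamma>'"
    using trajectory_unique[OF 1(1) 2(1) _ _ coeff_norm_le_1, of 0] 1 2 by metis
  then show ?thesis using 1 2 by simp
qed

text \<open>Zeros of \<open>displ\<close> are isolated unless it vanishes identically, which the
  value at 0 excludes. Removing from a ball the part of the axis at distance at least r from x
  leaves an open set; a closed orbit inside it must cross near x and hence at x.\<close>

lemma closed_trajectory_imp_limit_cycle:
  assumes S: "closed_trajectory d v S" "S \<subseteq> cball 0 (1/2)" and nz: "displ 0 \<noteq> 0"
  shows "limit_cycle d v S"
proof -
  have S6: "S \<subseteq> cball 0 (6/10)" using S(2) by (auto simp: subset_eq intro: order_trans)
  obtain x \<gamma> T where x: "0 < x" "x \<le> 6/10" "S = range \<gamma>" "\<gamma> 0 = (x, 0)" "displ (of_real x) = 0"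
    "\<And>y. 0 < y \<Longrightarrow> (y, 0) \<in> S \<Longrightarrow> y = x" and g: "trajectory d v \<gamma>"
    by (rule closed_trajectory_normal_form[OF S(1) S6]) (rule that, assumption+)
  have xS: "(x, 0) \<in> S" using x(3,4) by (metis rangeI)
  have xb: "complex_of_real x \<in> ball 0 (7/10)" using x(1,2) by simp
  obtain r where r: "0 < r" "ball (complex_of_real x) r \<subseteq> ball 0 (7/10)"
    "\<And>z. z \<in> ball (of_real x) r - {of_real x} \<Longrightarrow> displ z \<noteq> 0"
  proof (rule isolated_zeros[OF displ_holomorphic _ _ xb x(5) _ nz])
    show "open (ball 0 (7/10) :: complex set)" "connected (ball 0 (7/10) :: complex set)" "(0::complex) \<in> ball 0 (7/10)"
      by auto
  qed (rule that)
  \<comment> \<open>The condition fst p >= 0 is not strict in order to make \<open>C\<close> closed;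
    therefore the origin may lie in it and has to be treated separately.\<close>
  define C where "C = {p :: real \<times> real. snd p = 0 \<and> fst p \<ge> 0 \<and> \<bar>fst p - x\<bar> \<ge> r}"
  have "closed C" unfolding C_def
    by (intro closed_Collect_conj closed_Collect_eq closed_Collect_le continuous_intros)
  then have "open (ball 0 (6/10) - C)" by (intro open_Diff) auto
  moreover have "S \<subseteq> ball 0 (6/10) - C"
  proof
    fix p assume p: "p \<in> S"
    then have "norm p \<le> 1/2" using S(2) by (auto simp: subset_eq)
    moreover have "p \<notin> C"
    proof
      assume "p \<in> C"
      then have pc: "p = (fst p, 0)" "fst p \<ge> 0" "\<bar>fst p - x\<bar> \<ge> r" by (auto simp: C_def prod_eq_iff)
      show False
      proof (cases "fst p = 0")
        case False
        then show False using x(6)[of "fst p"] pc p r(1) by auto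
      next
        case True
        then have p0: "p = 0" using pc(1) by (simp add: prod_eq_iff)
        obtain t where t: "\<gamma> t = 0" using p p0 x(3) by (metis imageE)
        \<comment> \<open>The origin is an equilibrium, so by uniqueness an orbit through it would
          be constant.\<close>
        have g0: "trajectory d v (\<lambda>_. 0)"
          unfolding trajectory_def by (simp add: vector_field_0)
        have "norm (\<gamma> s) \<le> 1" for s
        proof -
          have "\<gamma> s \<in> S" using x(3) by simp
          then have "norm (\<gamma> s) \<le> 1/2" using S(2) by (auto simp: subset_eq)
          then show ?thesis by linarith
        qed
        then have "\<gamma> = (\<lambda>_. 0)"
          using trajectory_unique[OF g g0 _ _ coeff_norm_le_1, of t] t by simp
        then show False using x(1,4) by (simp add: zero_prod_def)
      qed
    qed
    ultimately show "p \<in> ball 0 (6/10) - C" by simp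
  qed
  moreover have "S' = S" if S': "closed_trajectory d v S'" "S' \<subseteq> ball 0 (6/10) - C" for S'
  proof -
    have S6': "S' \<subseteq> cball 0 (6/10)" using S'(2) by (auto simp: subset_eq)
    obtain x' \<gamma>' where x': "0 < x'" "trajectory d v \<gamma>'" "S' = range \<gamma>'" "\<gamma>' 0 = (x', 0)" "displ (of_real x') = 0"
      by (rule closed_trajectory_normal_form[OF S'(1) S6']) (rule that, assumption+)
    have xS': "(x', 0) \<in> S'" using x'(3,4) by (metis rangeI)
    then have "(x', 0) \<notin> C" using S'(2) by blast
    then have "\<bar>x' - x\<bar> < r" using x'(1) by (auto simp: C_def)
    then have "complex_of_real x' \<in> ball (of_real x) r"
      by (simp add: dist_norm norm_minus_commute flip: of_real_diff)
    then have "complex_of_real x' = of_real x" using r(3) x'(5) by blast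
    then have "x' = x" by simp
    then show ?thesis using closed_trajectory_same[OF S'(1) S6' _ S(1) S6 xS x(1)] xS' by simp
  qed
  ultimately show ?thesis unfolding limit_cycle_def using S(1) by blast
qed

lemma orbit_pts_sub: "orbit_pts d v \<subseteq> {x. 0 < x \<and> x \<le> 1/2 \<and> displ (of_real x) = 0}"
proof
  fix x assume "x \<in> orbit_pts d v"
  then obtain S where S: "0 < x" "closed_trajectory d v S" "S \<subseteq> cball 0 (1/2)" "(x, 0) \<in> S"
    unfolding orbit_pts_def by blast
  have S6: "S \<subseteq> cball 0 (6/10)" using S(3) by (auto simp: subset_eq intro: order_trans)
  have "displ (of_real x) = 0" using closed_trajectory_normal_form[OF S(2) S6] S(1,4) by metis
  moreover have "norm (x, 0::real) \<le> 1/2" using S(3,4) by (auto simp: subset_eq)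
  ultimately show "x \<in> {x. 0 < x \<and> x \<le> 1/2 \<and> displ (of_real x) = 0}" using S(1) by (simp add: norm_Pair)
qed

lemma orbit_pts_card_le:
  assumes tr: "tr \<noteq> 0"
  shows "finite (orbit_pts d v)" "real (card (orbit_pts d v)) \<le> 3 * ln (13 * \<kappa> / (2 * \<bar>tr\<bar>))"
proof -
  have d0: "displ 0 \<noteq> 0" using displ_0_ge tr by auto
  \<comment> \<open>Jensen's bound is stated for every finite subset first, since finiteness of the
    whole set is deduced from it.\<close>
  have le: "real (card A) \<le> 3 * ln (13 * \<kappa> / norm (displ 0))" if "finite A" "A \<subseteq> orbit_pts d v" for A
    by (rule card_zeros_le_ln[OF displ_holomorphic displ_le]) (use that orbit_pts_sub d0 in auto)
  show fin: "finite (orbit_pts d v)"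
  proof (rule finite_if_finite_subsets_card_bdd[THEN conjunct1])
    fix A assume A: "A \<subseteq> orbit_pts d v" "finite A"
    from le[OF A(2,1)] show "card A \<le> nat \<lceil>3 * ln (13 * \<kappa> / norm (displ 0))\<rceil>"
      by linarith
  qed
  have "13 * \<kappa> > 0" using displ_le[of 0] d0 by (metis norm_zero zero_less_divide_iff zero_less_numeral zero_less_norm_iff order_less_le_trans)
  then have "13 * \<kappa> / norm (displ 0) \<le> 13 * \<kappa> / (2 * \<bar>tr\<bar>)"
    using displ_0_ge tr d0 by (intro divide_left_mono mult_pos_pos) auto
  then have "ln (13 * \<kappa> / norm (displ 0)) \<le> ln (13 * \<kappa> / (2 * \<bar>tr\<bar>))"
    using \<open>13 * \<kappa> > 0\<close> d0 by (intro ln_mono) auto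
  then show "real (card (orbit_pts d v)) \<le> 3 * ln (13 * \<kappa> / (2 * \<bar>tr\<bar>))" using le[OF fin] by simp
qed

text \<open>A nonzero trace makes every closed orbit in the disk isolated, so limit cycles
  correspond bijectively to crossings of the positive axis.\<close>

lemma num_limit_cycles_eq:
  assumes tr: "tr \<noteq> 0"
  shows "num_limit_cycles d v = of_nat (card (orbit_pts d v))"
proof -
  have d0: "displ 0 \<noteq> 0" using displ_0_ge tr by auto
  let ?L = "{S. limit_cycle d v S \<and> S \<subseteq> cball 0 (1/2)}"
  define c where "c x = (THE S. closed_trajectory d v S \<and> S \<subseteq> cball 0 (1/2) \<and> (x, 0::real) \<in> S)" for x :: real
  have sub: "S \<subseteq> cball 0 (6/10)" if "S \<subseteq> cball (0::real\<times>real) (1/2)" for S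
    using that by (auto simp: subset_eq intro: order_trans)
  have cI: "c x = S" if "0 < x" "closed_trajectory d v S" "S \<subseteq> cball 0 (1/2)" "(x, 0) \<in> S" for x S
    unfolding c_def using that closed_trajectory_same[OF _ sub _ _ sub] by (intro the_equality) blast+
  have "bij_betw c (orbit_pts d v) ?L"
    unfolding bij_betw_def
  proof (intro conjI inj_onI set_eqI iffI)
    fix x y assume xy: "x \<in> orbit_pts d v" "y \<in> orbit_pts d v" "c x = c y"
    then obtain S where S: "0 < x" "closed_trajectory d v S" "S \<subseteq> cball 0 (1/2)" "(x, 0) \<in> S"
      unfolding orbit_pts_def by blast
    obtain S' where S': "0 < y" "closed_trajectory d v S'" "S' \<subseteq> cball 0 (1/2)" "(y, 0) \<in> S'"
      using xy unfolding orbit_pts_def by blast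
    have "S = S'" using cI[OF S] cI[OF S'] xy by simp
    obtain q where q: "\<And>y. 0 < y \<Longrightarrow> (y, 0) \<in> S \<Longrightarrow> y = q"
      by (rule closed_trajectory_normal_form[OF S(2) sub[OF S(3)]]) (rule that, assumption)
    show "x = y" using q[OF S(1,4)] q[OF S'(1)] S'(4) \<open>S = S'\<close> by simp
  next
    fix S assume "S \<in> c ` orbit_pts d v"
    then obtain x S' where "S = c x" "0 < x" "closed_trajectory d v S'" "S' \<subseteq> cball 0 (1/2)" "(x, 0) \<in> S'"
      unfolding orbit_pts_def by blast
    then show "S \<in> ?L" using cI closed_trajectory_imp_limit_cycle[OF _ _ d0] by auto
  next
    fix S assume "S \<in> ?L"
    then have S: "closed_trajectory d v S" "S \<subseteq> cball 0 (1/2)" by (auto simp: limit_cycle_def)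
    obtain x \<gamma> where x: "0 < x" "trajectory d v \<gamma>" "S = range \<gamma>" "\<gamma> 0 = (x, 0)"
      by (rule closed_trajectory_normal_form[OF S(1) sub[OF S(2)]]) (rule that, assumption+)
    have "(x, 0) \<in> S" using x by (metis rangeI)
    then show "S \<in> c ` orbit_pts d v" using cI[OF x(1) S] x(1) S unfolding orbit_pts_def by blast
  qed
  then have "finite ?L" "card ?L = card (orbit_pts d v)"
    using bij_betw_finite bij_betw_same_card orbit_pts_card_le(1)[OF tr] by metis+
  then show ?thesis unfolding num_limit_cycles_def by (simp add: emeasure_count_space_finite)
qed

end

text \<open>The topological fact behind measurability. Crossings and periods lie in a compact
  rectangle, so along a subsequence the orbits converge to a periodic trajectory; a > 0 prevents it
  from collapsing to the origin.\<close>

lemma orbit_pts_closed: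
  assumes sv: "\<And>n. small_field d (v n)" and sw: "small_field d w"
    and lim: "(\<lambda>n. coeff_dist1 d (v n) w) \<longlonglongrightarrow> 0" and a: "0 < a"
    and ex: "\<And>n. \<exists>x\<in>orbit_pts d (v n). a \<le> x \<and> x \<le> b"
  shows "\<exists>x\<in>orbit_pts d w. a \<le> x \<and> x \<le> b"
proof -
  have "\<exists>x T \<gamma>. a \<le> x \<and> x \<le> b \<and> 1 \<le> T \<and> T \<le> 10 \<and> trajectory d (v n) \<gamma> \<and> \<gamma> 0 = (x, 0) \<and>
     (\<forall>t. \<gamma> (t + T) = \<gamma> t) \<and> (\<forall>t. norm (\<gamma> t) \<le> 1/2)" for n
  proof -
    interpret small_field d "v n" by (rule sv)
    obtain x S where S: "a \<le> x" "x \<le> b" "0 < x" "closed_trajectory d (v n) S" "S \<subseteq> cball 0 (1/2)" "(x, 0) \<in> S"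
      using ex[of n] unfolding orbit_pts_def by blast
    have S6: "S \<subseteq> cball 0 (6/10)" using S(5) by (auto simp: subset_eq intro: order_trans)
    obtain y \<gamma> T where y: "trajectory d (v n) \<gamma>" "\<gamma> 0 = (y, 0)" "S = range \<gamma>"
      "1 \<le> T" "T \<le> 10" "\<And>t. \<gamma> (t + T) = \<gamma> t" "y = x"
      using closed_trajectory_normal_form[OF S(4) S6] S(3,6) by metis
    have "norm (\<gamma> t) \<le> 1/2" for t
    proof -
      have "\<gamma> t \<in> S" using y by simp
      then show ?thesis using S(5) by (auto simp: subset_eq)
    qed
    then show ?thesis using S y by blast
  qed
  then obtain x T \<gamma> where *: "\<And>n. a \<le> x n" "\<And>n. x n \<le> b" "\<And>n. 1 \<le> T n" "\<And>n. T n \<le> 10"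
    "\<And>n. trajectory d (v n) (\<gamma> n)" "\<And>n. \<gamma> n 0 = (x n, 0)" "\<And>n t. \<gamma> n (t + T n) = \<gamma> n t"
    "\<And>n t. norm (\<gamma> n t) \<le> 1/2" by metis
  have "compact ({a..b} \<times> {1..10::real})" by (intro compact_Times) auto
  then have "seq_compact ({a..b} \<times> {1..10::real})" by (simp add: compact_imp_seq_compact)
  moreover have "\<forall>n. (x n, T n) \<in> {a..b} \<times> {1..10}" using * by simp
  ultimately obtain L r where L: "L \<in> {a..b} \<times> {1..10}" and r: "strict_mono r" "((\<lambda>n. (x n, T n)) \<circ> r) \<longlonglongrightarrow> L"
    unfolding seq_compact_def by meson
  obtain x0 T0 where xT: "L = (x0, T0)" by (cases L)
  have lx: "(\<lambda>n. x (r n)) \<longlonglongrightarrow> x0" and lT: "(\<lambda>n. T (r n)) \<longlonglongrightarrow> T0"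
    using tendsto_fst[OF r(2)] tendsto_snd[OF r(2)] by (simp_all add: o_def xT)
  have cn: "coeff_norm d (v n) \<le> 1" for n by (rule small_field.coeff_norm_le_1[OF sv])
  have lim': "(\<lambda>n. coeff_dist1 d (v (r n)) w) \<longlonglongrightarrow> 0"
    using LIMSEQ_subseq_LIMSEQ[OF lim r(1)] by (simp add: o_def)
  have l0: "(\<lambda>n. \<gamma> (r n) 0) \<longlonglongrightarrow> (x0, 0)" unfolding *(6) by (intro tendsto_intros lx)
  obtain \<eta> where \<eta>: "trajectory d w \<eta>" "\<And>t. (\<lambda>n. \<gamma> (r n) t) \<longlonglongrightarrow> \<eta> t" "\<eta> 0 = (x0, 0)" "\<And>t. norm (\<eta> t) \<le> 1/2"
    by (rule trajectory_limit[OF *(5) *(8) _ cn lim' l0]) auto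
  have x0: "a \<le> x0" "x0 \<le> b" and T0: "T0 \<ge> 1" using L by (auto simp: xT)
  \<comment> \<open>A common speed bound allows the varying periods \<open>T (r n)\<close> to be
    replaced by their limit.\<close>
  have speed: "norm (\<gamma> n s - \<gamma> n t) \<le> field_lip d * norm (s - t)" for n s t
  proof (rule differentiable_bound[of UNIV])
    fix u
    show "(\<gamma> n has_derivative (\<lambda>h. h *\<^sub>R vector_field d (v n) (\<gamma> n u))) (at u within UNIV)"
      using *(5)[of n] unfolding trajectory_def has_vector_derivative_def by blast
    have "norm (vector_field d (v n) (\<gamma> n u) - vector_field d (v n) 0) \<le> field_lip d * norm (\<gamma> n u - 0) + coeff_dist1 d (v n) (v n)"
      by (intro vector_field_lipschitz cn) (use *(8)[of n u] in auto)
    also have "\<dots> \<le> field_lip d * 1" using *(8)[of n u] by (simp add: mult_left_le)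
    finally have fl: "norm (vector_field d (v n) (\<gamma> n u)) \<le> field_lip d" by (simp add: vector_field_0)
    have "norm (h *\<^sub>R vector_field d (v n) (\<gamma> n u)) \<le> field_lip d * norm h" for h :: real
      using mult_right_mono[OF fl, of "\<bar>h\<bar>"] by (simp add: mult.commute)
    then show "onorm (\<lambda>h. h *\<^sub>R vector_field d (v n) (\<gamma> n u)) \<le> field_lip d"
      by (rule onorm_le)
  qed auto
  have per: "\<eta> (t + T0) = \<eta> t" for t
  proof -
    have "(\<lambda>n. \<gamma> (r n) (t + T0) - \<gamma> (r n) (t + T (r n))) \<longlonglongrightarrow> 0"
    proof (rule Lim_null_comparison)
      show "\<forall>\<^sub>F n in sequentially. norm (\<gamma> (r n) (t + T0) - \<gamma> (r n) (t + T (r n))) \<le> field_lip d * norm (T0 - T (r n))"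
        using speed[of _ "t + T0" "t + T (r _)"] by (intro always_eventually allI) (metis add_diff_cancel_left speed)
      have "(\<lambda>n. field_lip d * norm (T0 - T (r n))) \<longlonglongrightarrow> field_lip d * norm (T0 - T0)"
        by (intro tendsto_intros lT)
      then show "(\<lambda>n. field_lip d * norm (T0 - T (r n))) \<longlonglongrightarrow> 0" by simp
    qed
    then have "(\<lambda>n. \<gamma> (r n) (t + T0) - \<gamma> (r n) t) \<longlonglongrightarrow> 0" by (simp add: *(7))
    moreover have "(\<lambda>n. \<gamma> (r n) (t + T0) - \<gamma> (r n) t) \<longlonglongrightarrow> \<eta> (t + T0) - \<eta> t"
      by (intro tendsto_intros \<eta>)
    ultimately have "\<eta> (t + T0) - \<eta> t = 0" using LIMSEQ_unique by blast
    then show ?thesis by simp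
  qed
  \<comment> \<open>A constant limit would be an equilibrium (x0, 0) with x0 > 0, but there the
    second component of the field is x0 * (1 + c) with |c| < 1.\<close>
  have nonconst: "\<exists>t. \<eta> t \<noteq> \<eta> 0"
  proof (rule ccontr)
    assume "\<nexists>t. \<eta> t \<noteq> \<eta> 0"
    then have "\<eta> = (\<lambda>_. (x0, 0))" using \<eta>(3) by (metis ext)
    then have "((\<lambda>_. (x0, 0)) has_vector_derivative vector_field d w (x0, 0)) (at (0::real))"
      using \<eta>(1) unfolding trajectory_def by metis
    then have "vector_field d w (x0, 0) = 0"
      using vector_derivative_unique_at[OF _ has_vector_derivative_const] by blast
    then have z: "x0 + poly_eval d (snd w) x0 0 = 0" by (simp add: vector_field_def zero_prod_def)
    interpret small_field d w by (rule sw)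
    define c where "c = Re (pol d (snd w) 0 (of_real x0))"
    have pe: "poly_eval d (snd w) x0 0 = x0 * c"
      using poly_eval_polar[of d "snd w" x0 0] by (simp add: c_def)
    have "x0 \<le> 1/2" using \<eta>(4)[of 0] \<eta>(3) by (simp add: norm_Pair)
    then have "norm (complex_of_real x0) \<le> 1" using x0 a by simp
    from pol_le_coeff_norm(2)[OF this, of d w 0] small
    have "\<bar>c\<bar> \<le> 1 / (40 * pi)" using abs_Re_le_cmod[of "pol d (snd w) 0 (of_real x0)"] unfolding c_def by linarith
    also have "1 / (40 * pi) < 1" using pi_gt3 by simp
    finally have "1 + c > 0" by linarith
    moreover have "x0 * (1 + c) = 0" using z pe by (simp add: algebra_simps)
    ultimately show False using x0 a by simp
  qed
  have "closed_trajectory d w (range \<eta>)"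
    unfolding closed_trajectory_alt using \<eta>(1) per nonconst T0 by (intro exI[of _ \<eta>] exI[of _ T0]) auto
  moreover have "range \<eta> \<subseteq> cball 0 (1/2)" using \<eta>(4) by auto
  moreover have "(x0, 0) \<in> range \<eta>" using \<eta>(3) by (metis rangeI)
  ultimately have "x0 \<in> orbit_pts d w" unfolding orbit_pts_def using x0 a by auto
  then show ?thesis using x0 by blast
qed

section \<open>Convex bodies and sublevel sets of affine functions\<close>

abbreviation lborel_n :: "nat \<Rightarrow> (nat \<Rightarrow> real) measure" where
  "lborel_n m \<equiv> \<Pi>\<^sub>M j\<in>{..<m}. (lborel :: real measure)"

lemma space_lborel_n: "space (lborel_n m) = {..<m} \<rightarrow>\<^sub>E UNIV"
  by (simp add: space_PiM)

text \<open>Works in the product topology on all functions from nat to real, where coordinates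
  beyond m are frozen at \<open>undefined\<close>. There the set is closed, hence Borel, and the
  identity from the finite product is measurable.\<close>

lemma seq_closed_measurable:
  assumes sub: "S \<subseteq> {..<m} \<rightarrow>\<^sub>E UNIV"
    and cl: "\<And>X l. (\<And>n. X n \<in> S) \<Longrightarrow> l \<in> {..<m} \<rightarrow>\<^sub>E UNIV \<Longrightarrow> (\<And>j. j < m \<Longrightarrow> (\<lambda>n. X n j) \<longlonglongrightarrow> l j) \<Longrightarrow> l \<in> S"
  shows "S \<in> sets (lborel_n m)"
proof -
  have "closed S"
    unfolding closed_sequential_limits
  proof (intro allI impI, elim conjE)
    fix X l assume X: "\<forall>n. X n \<in> S" "X \<longlonglongrightarrow> l"
    have c: "(\<lambda>n. X n j) \<longlonglongrightarrow> l j" for j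
      using continuous_on_tendsto_compose[OF continuous_on_product_coordinates[of j] X(2)] by simp
    have "l j = undefined" if "j \<ge> m" for j
    proof -
      have "X n j = undefined" for n using X(1) sub that by (auto simp: PiE_iff extensional_def subset_eq)
      then show ?thesis using c[of j] LIMSEQ_unique[OF _ tendsto_const] by simp
    qed
    then have "l \<in> {..<m} \<rightarrow>\<^sub>E UNIV" by (auto simp: PiE_iff extensional_def)
    then show "l \<in> S" using cl X(1) c by blast
  qed
  then have S: "S \<in> sets borel" by simp
  have "(\<lambda>x. x) \<in> borel_measurable (lborel_n m)"
  proof (rule measurable_coordinatewise_then_product)
    fix i :: nat
    show "(\<lambda>x. x i) \<in> borel_measurable (lborel_n m)"
    proof (cases "i < m")
      case True
      then show ?thesis using measurable_component_singleton[of i "{..<m}" "\<lambda>_. lborel"] by simp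
    next
      case False
      have "(\<lambda>x. x i) \<in> borel_measurable (lborel_n m) \<longleftrightarrow> (\<lambda>x. undefined :: real) \<in> borel_measurable (lborel_n m)"
        by (rule measurable_cong) (use False in \<open>auto simp: space_PiM PiE_iff extensional_def\<close>)
      then show ?thesis by simp
    qed
  qed
  from measurable_sets[OF this S] have "S \<inter> space (lborel_n m) \<in> sets (lborel_n m)" by simp
  moreover have "S \<inter> space (lborel_n m) = S" using sub by (auto simp: space_PiM)
  ultimately show ?thesis by simp
qed

text \<open>Equals (1 - t) p + t x coordinatewise, so the same map also expresses convex
  combinations; the restriction keeps values extensional.\<close>

definition homothety :: "nat \<Rightarrow> real \<Rightarrow> (nat \<Rightarrow> real) \<Rightarrow> (nat \<Rightarrow> real) \<Rightarrow> nat \<Rightarrow> real" where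
  "homothety m t p x = (\<lambda>j\<in>{..<m}. p j + t * (x j - p j))"

lemma homothety_in [simp]: "homothety m t p x \<in> {..<m} \<rightarrow>\<^sub>E UNIV"
  by (simp add: homothety_def)

lemma homothety_inverse:
  assumes "t \<noteq> 0" "x \<in> {..<m} \<rightarrow>\<^sub>E UNIV"
  shows "homothety m (1/t) p (homothety m t p x) = x" "homothety m t p (homothety m (1/t) p x) = x"
  using assms by (auto simp: homothety_def fun_eq_iff PiE_iff extensional_def)

lemma emeasure_lborel_affine_vimage:
  fixes c a :: real
  assumes c: "c > 0" and A: "A \<in> sets borel"
  shows "emeasure lborel ((\<lambda>x. a + c * x) -` A) = ennreal (1/c) * emeasure lborel A"
proof -
  have "emeasure lborel A = emeasure (density (distr lborel borel (\<lambda>x. a + c * x)) (\<lambda>_. ennreal \<bar>c\<bar>)) A"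
    using lborel_real_affine[of c a] c by simp
  also have "\<dots> = ennreal c * emeasure lborel ((\<lambda>x. a + c * x) -` A)"
    using A c by (simp add: emeasure_density_const emeasure_distr)
  finally have "ennreal (1/c) * emeasure lborel A = ennreal (1/c) * ennreal c * emeasure lborel ((\<lambda>x. a + c * x) -` A)"
    by (simp add: mult.assoc)
  also have "ennreal (1/c) * ennreal c = 1" using c by (simp add: ennreal_mult[symmetric] del: ennreal_1 flip: ennreal_1)
  finally show ?thesis by simp
qed

lemma measurable_homothety: "homothety m t p \<in> measurable (lborel_n m) (lborel_n m)"
  unfolding homothety_def by measurable

text \<open>The push-forward under the inverse homothety, rescaled, agrees with the product measure
  on boxes, and this characterizes the product measure.\<close>

lemma emeasure_homothety:
  assumes t: "t > 0" and S: "S \<in> sets (lborel_n m)"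
  shows "homothety m t p ` S \<in> sets (lborel_n m)"
    and "emeasure (lborel_n m) (homothety m t p ` S) = ennreal (t ^ m) * emeasure (lborel_n m) S"
proof -
  interpret product_sigma_finite "\<lambda>_::nat. lborel :: real measure" by standard
  let ?g = "homothety m (1/t) p"
  have SE: "S \<subseteq> {..<m} \<rightarrow>\<^sub>E UNIV" using sets.sets_into_space[OF S] by (simp add: space_PiM)
  have im: "homothety m t p ` S = ?g -` S \<inter> space (lborel_n m)"
  proof (intro set_eqI iffI)
    fix x assume "x \<in> homothety m t p ` S"
    then obtain y where y: "y \<in> S" "x = homothety m t p y" by blast
    have "?g x = y" unfolding y(2) using y(1) SE t by (intro homothety_inverse(1)) auto
    then show "x \<in> ?g -` S \<inter> space (lborel_n m)"
      using y by (simp add: space_lborel_n del: PiE_iff)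
  next
    fix x assume "x \<in> ?g -` S \<inter> space (lborel_n m)"
    then show "x \<in> homothety m t p ` S"
      using homothety_inverse(2)[of t x m p] t by (auto simp: space_lborel_n intro: image_eqI[of _ _ "?g x"])
  qed
  show "homothety m t p ` S \<in> sets (lborel_n m)"
    unfolding im by (rule measurable_sets[OF measurable_homothety S])
  have "density (distr (lborel_n m) (lborel_n m) ?g) (\<lambda>_. ennreal ((1/t) ^ m)) = lborel_n m"
  proof (rule PiM_eqI)
    fix A :: "nat \<Rightarrow> real set" assume A: "\<And>i. i \<in> {..<m} \<Longrightarrow> A i \<in> sets lborel"
    have PA: "Pi\<^sub>E {..<m} A \<in> sets (lborel_n m)" using A by (intro sets_PiM_I_finite) auto
    let ?f = "\<lambda>i. (\<lambda>x. (p i - p i / t) + (1/t) * x)"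
    have "?g -` Pi\<^sub>E {..<m} A \<inter> space (lborel_n m) = Pi\<^sub>E {..<m} (\<lambda>i. ?f i -` A i)"
      by (auto simp: homothety_def space_PiM PiE_iff algebra_simps diff_divide_distrib)
    then have "emeasure (distr (lborel_n m) (lborel_n m) ?g) (Pi\<^sub>E {..<m} A) = emeasure (lborel_n m) (Pi\<^sub>E {..<m} (\<lambda>i. ?f i -` A i))"
      using PA by (simp add: emeasure_distr[OF measurable_homothety])
    also have "\<dots> = (\<Prod>i<m. emeasure lborel (?f i -` A i))"
    proof (rule emeasure_PiM)
      fix i assume "i \<in> {..<m}"
      then have "A i \<in> sets borel" using A by simp
      moreover have "?f i \<in> borel_measurable borel" by measurable
      ultimately have "?f i -` A i \<inter> space borel \<in> sets borel" by (metis measurable_sets)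
      then show "?f i -` A i \<in> sets lborel" by simp
    qed simp
    also have "\<dots> = (\<Prod>i<m. ennreal t * emeasure lborel (A i))"
    proof (rule prod.cong)
      fix i assume "i \<in> {..<m}"
      then show "emeasure lborel (?f i -` A i) = ennreal t * emeasure lborel (A i)"
        using emeasure_lborel_affine_vimage[of "1/t" "A i" "p i - p i / t"] A t by simp
    qed simp
    also have "\<dots> = ennreal (t ^ m) * (\<Prod>i<m. emeasure lborel (A i))"
      using t by (simp add: prod.distrib ennreal_power)
    finally have e: "emeasure (distr (lborel_n m) (lborel_n m) ?g) (Pi\<^sub>E {..<m} A) = ennreal (t ^ m) * (\<Prod>i<m. emeasure lborel (A i))" .
    have one: "ennreal ((1/t) ^ m) * ennreal (t ^ m) = 1"
      using t by (simp add: ennreal_mult[symmetric] power_one_over del: ennreal_1 flip: ennreal_1)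
    show "emeasure (density (distr (lborel_n m) (lborel_n m) ?g) (\<lambda>_. ennreal ((1/t) ^ m))) (Pi\<^sub>E {..<m} A) = (\<Prod>i<m. emeasure lborel (A i))"
      using PA by (simp add: emeasure_density_const e mult.assoc[symmetric] one)
  qed simp_all
  then have "emeasure (lborel_n m) S = emeasure (density (distr (lborel_n m) (lborel_n m) ?g) (\<lambda>_. ennreal ((1/t) ^ m))) S"
    by simp
  also have "\<dots> = ennreal ((1/t) ^ m) * emeasure (lborel_n m) (homothety m t p ` S)"
    using S by (simp add: emeasure_density_const emeasure_distr[OF measurable_homothety] im)
  finally have "ennreal (t ^ m) * emeasure (lborel_n m) S = ennreal (t ^ m) * ennreal ((1/t) ^ m) * emeasure (lborel_n m) (homothety m t p ` S)"
    by (simp add: mult.assoc)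
  also have "ennreal (t ^ m) * ennreal ((1/t) ^ m) = 1"
    using t by (simp add: ennreal_mult[symmetric] power_one_over del: ennreal_1 flip: ennreal_1)
  finally show "emeasure (lborel_n m) (homothety m t p ` S) = ennreal (t ^ m) * emeasure (lborel_n m) S" by simp
qed

lemma lborel_n_box: "(\<And>j. j < m \<Longrightarrow> B j \<in> sets borel) \<Longrightarrow> emeasure (lborel_n m) (Pi\<^sub>E {..<m} B) = (\<Prod>j<m. emeasure lborel (B j))"
proof -
  assume B: "\<And>j. j < m \<Longrightarrow> B j \<in> sets borel"
  interpret product_sigma_finite "\<lambda>_::nat. lborel :: real measure" by standard
  show ?thesis using B by (intro emeasure_PiM) auto
qed

text \<open>Closure in the maximum metric. It is always measurable for the uncompleted product
  measure, whereas a convex set itself may fail to be.\<close>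

definition coord_closure :: "nat \<Rightarrow> (nat \<Rightarrow> real) set \<Rightarrow> (nat \<Rightarrow> real) set" where
  "coord_closure m K = {x \<in> {..<m} \<rightarrow>\<^sub>E UNIV. \<forall>\<epsilon>>0. \<exists>y\<in>K. \<forall>j<m. \<bar>y j - x j\<bar> < \<epsilon>}"

lemma coord_closure_measurable: "coord_closure m K \<in> sets (lborel_n m)"
proof (rule seq_closed_measurable)
  show "coord_closure m K \<subseteq> {..<m} \<rightarrow>\<^sub>E UNIV" unfolding coord_closure_def by blast
  fix X l assume X: "\<And>n. X n \<in> coord_closure m K" and l: "l \<in> {..<m} \<rightarrow>\<^sub>E UNIV"
    and lim: "\<And>j. j < m \<Longrightarrow> (\<lambda>n. X n j) \<longlonglongrightarrow> l j"
  have "\<exists>y\<in>K. \<forall>j<m. \<bar>y j - l j\<bar> < \<epsilon>" if "\<epsilon> > 0" for \<epsilon> :: real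
  proof -
    have "\<forall>\<^sub>F n in sequentially. \<forall>j\<in>{..<m}. dist (X n j) (l j) < \<epsilon>/2"
      by (rule eventually_ball_finite) (use tendstoD[OF lim half_gt_zero[OF that]] in auto)
    then obtain n where n: "\<forall>j<m. \<bar>X n j - l j\<bar> < \<epsilon>/2"
      by (auto simp: dist_real_def dest!: eventually_happens)
    have "\<epsilon>/2 > 0" using that by simp
    then obtain y where y: "y \<in> K" "\<forall>j<m. \<bar>y j - X n j\<bar> < \<epsilon>/2" using X[of n] unfolding coord_closure_def by blast
    have "\<bar>y j - l j\<bar> < \<epsilon>" if "j < m" for j
    proof -
      have "\<bar>X n j - l j\<bar> < \<epsilon>/2" "\<bar>y j - X n j\<bar> < \<epsilon>/2" using n y that by auto
      then show ?thesis by linarith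
    qed
    then show ?thesis using y by blast
  qed
  then show "l \<in> coord_closure m K" unfolding coord_closure_def using l by blast
qed

text \<open>Nonempty interior is expressed through a cube around \<open>p0\<close>, the shape that
  suits the product measure.\<close>

locale convex_body =
  fixes m :: nat and K :: "(nat \<Rightarrow> real) set" and p0 :: "nat \<Rightarrow> real" and \<epsilon>0 R :: real
  assumes K_sub: "K \<subseteq> {..<m} \<rightarrow>\<^sub>E UNIV"
    and K_convex: "\<And>x y t. x \<in> K \<Longrightarrow> y \<in> K \<Longrightarrow> 0 \<le> t \<Longrightarrow> t \<le> 1 \<Longrightarrow> homothety m t x y \<in> K"
    and inner: "\<And>q. q \<in> {..<m} \<rightarrow>\<^sub>E UNIV \<Longrightarrow> (\<And>j. j < m \<Longrightarrow> \<bar>q j - p0 j\<bar> \<le> \<epsilon>0) \<Longrightarrow> q \<in> K"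
    and eps: "\<epsilon>0 > 0"
    and bounded: "\<And>x j. x \<in> K \<Longrightarrow> j < m \<Longrightarrow> \<bar>x j\<bar> \<le> R"
begin

abbreviation C where "C \<equiv> coord_closure m K"

lemma C_sub: "C \<subseteq> {..<m} \<rightarrow>\<^sub>E UNIV" unfolding coord_closure_def by blast

lemma K_sub_C: "K \<subseteq> C" 
proof
  fix x assume x: "x \<in> K"
  then have "\<forall>\<epsilon>>0. \<exists>y\<in>K. \<forall>j<m. \<bar>y j - x j\<bar> < \<epsilon>" by (intro allI impI bexI[of _ x]) simp_all
  then show "x \<in> C" unfolding coord_closure_def using x K_sub by blast
qed

lemma C_convex:
  assumes x: "x \<in> C" and y: "y \<in> C" and t: "0 \<le> t" "t \<le> 1"
  shows "homothety m t x y \<in> C"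
  unfolding coord_closure_def
proof (intro CollectI conjI allI impI)
  fix \<epsilon> :: real assume "\<epsilon> > 0"
  then obtain x' y' where x': "x' \<in> K" "\<And>j. j < m \<Longrightarrow> \<bar>x' j - x j\<bar> < \<epsilon>" and y': "y' \<in> K" "\<And>j. j < m \<Longrightarrow> \<bar>y' j - y j\<bar> < \<epsilon>"
    using x y unfolding coord_closure_def by blast
  have "\<bar>homothety m t x' y' j - homothety m t x y j\<bar> < \<epsilon>" if "j < m" for j
  proof -
    have "homothety m t x' y' j - homothety m t x y j = (1-t) * (x' j - x j) + t * (y' j - y j)"
      using that by (simp add: homothety_def algebra_simps)
    also have "\<bar>\<dots>\<bar> \<le> (1-t) * \<bar>x' j - x j\<bar> + t * \<bar>y' j - y j\<bar>"
      using t by (intro order_trans[OF abs_triangle_ineq]) (simp add: abs_mult)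
    also have "\<dots> < \<epsilon>"
      using x'(2)[OF that] y'(2)[OF that] t by (intro convex_bound_lt) auto
    finally show ?thesis .
  qed
  then show "\<exists>z\<in>K. \<forall>j<m. \<bar>z j - homothety m t x y j\<bar> < \<epsilon>" using K_convex[OF x'(1) y'(1) t] by blast
qed simp

text \<open>The interior point \<^term>\<open>p0\<close> absorbs the error made when a point of the closure is replaced by a point of \<^term>\<open>K\<close>.\<close>

lemma shrink_closure:
  assumes x: "x \<in> C" and t: "0 < t" "t < 1"
  shows "homothety m t p0 x \<in> K"
proof -
  have "\<epsilon>0 * (1-t) / t > 0" using eps t by simp
  then obtain y where y: "y \<in> K" "\<And>j. j < m \<Longrightarrow> \<bar>y j - x j\<bar> < \<epsilon>0 * (1-t) / t"
    using x unfolding coord_closure_def by blast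
  \<comment> \<open>Solves (1 - t) q + t y = (1 - t) p0 + t x for q; the choice of the approximation
    y keeps q in the cube around \<open>p0\<close>.\<close>
  define q where "q = (\<lambda>j\<in>{..<m}. p0 j + t / (1-t) * (x j - y j))"
  have "q \<in> K"
  proof (rule inner)
    show "q \<in> {..<m} \<rightarrow>\<^sub>E UNIV" by (simp add: q_def)
    fix j assume j: "j < m"
    have "\<bar>q j - p0 j\<bar> = t / (1-t) * \<bar>y j - x j\<bar>" using j t by (simp add: q_def abs_mult abs_minus_commute)
    also have "\<dots> \<le> t / (1-t) * (\<epsilon>0 * (1-t) / t)" using y(2)[OF j] t by (intro mult_left_mono) auto
    also have "\<dots> = \<epsilon>0" using t by simp
    finally show "\<bar>q j - p0 j\<bar> \<le> \<epsilon>0" .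
  qed
  moreover have "homothety m t q y = homothety m t p0 x"
    unfolding homothety_def
  proof (rule restrict_ext)
    fix j assume "j \<in> {..<m}"
    then have "(1-t) * q j = (1-t) * p0 j + t * (x j - y j)" using t by (simp add: q_def distrib_left)
    then show "q j + t * (y j - q j) = p0 j + t * (x j - p0 j)" by (simp add: algebra_simps)
  qed
  ultimately show ?thesis using K_convex[of q y t] y(1) t by simp
qed

lemma emeasure_C_finite: "emeasure (lborel_n m) C < \<infinity>"
proof -
  have "C \<subseteq> Pi\<^sub>E {..<m} (\<lambda>_. {-(R+1)..R+1})"
  proof
    fix x assume x: "x \<in> C"
    obtain y where y: "y \<in> K" "\<And>j. j < m \<Longrightarrow> \<bar>y j - x j\<bar> < 1"
      using x zero_less_one unfolding coord_closure_def by blast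
    have "-(R+1) \<le> x j \<and> x j \<le> R+1" if "j < m" for j using y(2)[OF that] bounded[OF y(1) that] by linarith
    then show "x \<in> Pi\<^sub>E {..<m} (\<lambda>_. {-(R+1)..R+1})" using x C_sub by (auto simp: PiE_iff)
  qed
  then have "emeasure (lborel_n m) C \<le> emeasure (lborel_n m) (Pi\<^sub>E {..<m} (\<lambda>_. {-(R+1)..R+1}))"
    by (intro emeasure_mono sets_PiM_I_finite) auto
  also have "\<dots> = (\<Prod>j<m. emeasure lborel {-(R+1)..R+1})" by (intro lborel_n_box) auto
  also have "\<dots> = emeasure lborel {-(R+1)..R+1} ^ m" by simp
  also have "\<dots> < \<infinity>" using emeasure_lborel_cbox_finite[of "-(R+1)" "R+1"] by (simp add: power_less_top_ennreal)
  finally show ?thesis .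
qed

lemma emeasure_C_pos: "emeasure (lborel_n m) C > 0"
proof -
  have "Pi\<^sub>E {..<m} (\<lambda>j. {p0 j - \<epsilon>0..p0 j + \<epsilon>0}) \<subseteq> K"
  proof
    fix q assume q: "q \<in> Pi\<^sub>E {..<m} (\<lambda>j. {p0 j - \<epsilon>0..p0 j + \<epsilon>0})"
    have "\<bar>q j - p0 j\<bar> \<le> \<epsilon>0" if "j < m" for j
    proof -
      have "q j \<in> {p0 j - \<epsilon>0..p0 j + \<epsilon>0}" by (rule PiE_mem[OF q]) (simp add: that)
      then show ?thesis unfolding atLeastAtMost_iff by linarith
    qed
    moreover have "q \<in> {..<m} \<rightarrow>\<^sub>E UNIV" using q by (simp add: PiE_iff)
    ultimately show "q \<in> K" by (intro inner)
  qed
  then have "emeasure (lborel_n m) (Pi\<^sub>E {..<m} (\<lambda>j. {p0 j - \<epsilon>0..p0 j + \<epsilon>0})) \<le> emeasure (lborel_n m) C"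
    using K_sub_C by (intro emeasure_mono coord_closure_measurable) auto
  moreover have "emeasure (lborel_n m) (Pi\<^sub>E {..<m} (\<lambda>j. {p0 j - \<epsilon>0..p0 j + \<epsilon>0})) = (\<Prod>j<m. ennreal (2 * \<epsilon>0))"
    using eps by (subst lborel_n_box) auto
  moreover have "(\<Prod>j<m. ennreal (2 * \<epsilon>0)) > 0" using eps by (simp add: ennreal_power)
  ultimately show ?thesis by simp
qed

text \<open>The boundary is a null set: copies of \<open>C\<close> shrunk towards \<open>p0\<close>
  by ratios tending to 1 lie in \<open>K\<close> and exhaust the volume of \<open>C\<close>, so
  \<open>K\<close> is squeezed between two measurable sets of equal finite measure.\<close>

lemma K_completion:
  shows "K \<in> sets (completion (lborel_n m))"
    and "emeasure (completion (lborel_n m)) K = emeasure (lborel_n m) C"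
proof -
  define t where "t n = 1 - 1 / (real n + 2)" for n
  have t: "0 < t n" "t n < 1" for n by (auto simp: t_def field_simps)
  define K' where "K' = (\<Union>n. homothety m (t n) p0 ` C)"
  have K'm: "K' \<in> sets (lborel_n m)"
    unfolding K'_def by (intro sets.countable_UN') (use emeasure_homothety(1)[OF t(1) coord_closure_measurable] in auto)
  have K'K: "K' \<subseteq> K" unfolding K'_def using shrink_closure[OF _ t] by blast
  obtain c where c: "emeasure (lborel_n m) C = ennreal c" "c \<ge> 0"
    using emeasure_C_finite by (metis ennreal_cases infinity_ennreal_def less_irrefl)
  have "ennreal (t n ^ m * c) \<le> emeasure (lborel_n m) K'" for n
  proof -
    have "ennreal (t n ^ m * c) = emeasure (lborel_n m) (homothety m (t n) p0 ` C)"
      using emeasure_homothety(2)[OF t(1)[of n] coord_closure_measurable] t[of n] c by (simp add: ennreal_mult)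
    also have "\<dots> \<le> emeasure (lborel_n m) K'" by (intro emeasure_mono K'm) (auto simp: K'_def)
    finally show ?thesis .
  qed
  moreover have "(\<lambda>n. ennreal (t n ^ m * c)) \<longlonglongrightarrow> ennreal (1 ^ m * c)"
  proof (intro tendsto_ennrealI tendsto_intros)
    have "(\<lambda>n. 1 - 1 / (real n + 2)) \<longlonglongrightarrow> 1" by real_asymp
    then show "t \<longlonglongrightarrow> 1" unfolding t_def .
  qed
  ultimately have "ennreal (1 ^ m * c) \<le> emeasure (lborel_n m) K'" by (intro LIMSEQ_le_const2) auto
  moreover have "emeasure (lborel_n m) K' \<le> emeasure (lborel_n m) C"
    using K'K K_sub_C by (intro emeasure_mono coord_closure_measurable) auto
  ultimately have eq: "emeasure (lborel_n m) K' = emeasure (lborel_n m) C" using c by simp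
  show *: "K \<in> sets (completion (lborel_n m))"
    by (rule completion.complete_sets_sandwich[OF _ _ K'K K_sub_C])
       (use K'm coord_closure_measurable eq emeasure_C_finite in auto)
  show "emeasure (completion (lborel_n m)) K = emeasure (lborel_n m) C"
  proof (rule antisym)
    have "emeasure (completion (lborel_n m)) K \<le> emeasure (completion (lborel_n m)) C"
      by (intro emeasure_mono K_sub_C) (simp add: coord_closure_measurable)
    then show "emeasure (completion (lborel_n m)) K \<le> emeasure (lborel_n m) C"
      by (simp add: coord_closure_measurable)
    have "emeasure (completion (lborel_n m)) K' \<le> emeasure (completion (lborel_n m)) K"
      by (intro emeasure_mono K'K *)
    then show "emeasure (lborel_n m) C \<le> emeasure (completion (lborel_n m)) K"
      using K'm eq by simp
  qed
qed

end

section \<open>The mean of the logarithm of an affine function over a convex body\<close>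

lemma ln_le_suminf_indicator:
  fixes e0 M y :: real
  assumes e0: "0 < e0" "e0 \<le> M" and y: "0 \<le> y"
  shows "ennreal (ln (M / y)) \<le> ennreal (ln (M / e0)) + (suminf (\<lambda>k. indicator {z. z < e0 * exp (- real k)} y))"
proof (cases "y = 0 \<or> y \<ge> e0")
  case True
  have "ln (M / y) \<le> ln (M / e0)"
  proof (cases "y = 0")
    \<comment> \<open>Here M / y = 0 and ln 0 = 0 by convention, so the left side vanishes.\<close>
    case True
    then show ?thesis using e0 by simp
  next
    case False
    then have "y \<ge> e0" using True by simp
    then show ?thesis using e0 by (intro ln_mono divide_left_mono mult_pos_pos divide_pos_pos) auto
  qed
  then have "ennreal (ln (M / y)) \<le> ennreal (ln (M / e0))" by (rule ennreal_leI)
  then show ?thesis by (rule order_trans) simp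
next
  case False
  then have y0: "0 < y" "y < e0" using y by auto
  \<comment> \<open>Each k < n lies below ln (e0 / y), hence y is in the k-th layer; so at least n
    terms of the series equal 1.\<close>
  define n where "n = nat \<lceil>ln (e0 / y)\<rceil>"
  have l0: "ln (e0 / y) > 0" using y0 by simp
  have "ln (M / y) = ln (M / e0) + ln (e0 / y)" using e0 y0 by (simp add: ln_div)
  also have "\<dots> \<le> ln (M / e0) + real n" unfolding n_def by (simp add: real_nat_ceiling_ge)
  finally have "ennreal (ln (M / y)) \<le> ennreal (ln (M / e0) + real n)" by (rule ennreal_leI)
  also have "\<dots> = ennreal (ln (M / e0)) + of_nat n" using e0 by (simp add: ennreal_plus ennreal_of_nat_eq_real_of_nat)
  also have "(of_nat n :: ennreal) = (\<Sum>k<n. indicator {z. z < e0 * exp (- real k)} y)"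
  proof -
    have "y < e0 * exp (- real k)" if "k < n" for k
    proof -
      have "real k < ln (e0 / y)" using that l0 unfolding n_def by linarith
      then have "exp (real k) < exp (ln (e0 / y))" by simp
      also have "\<dots> = e0 / y" using e0 y0 by simp
      finally have "exp (real k) < e0 / y" .
      then show ?thesis using y0 by (simp add: exp_minus field_simps)
    qed
    then show ?thesis by simp
  qed
  also have "\<dots> \<le> (suminf (\<lambda>k. indicator {z. z < e0 * exp (- real k)} y))"
    by (intro sum_le_suminf) auto
  finally show ?thesis by (simp add: add_left_mono)
qed

lemma suminf_exp_le_2: "(suminf (\<lambda>k. ennreal (exp (- real k)))) \<le> 2"
proof -
  have e: "exp (1::real) \<ge> 2" using exp_ge_add_one_self[of 1] by simp
  then have lt: "exp (-1::real) \<le> 1/2" by (simp add: exp_minus field_simps)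
  then have "norm (exp (-1::real)) < 1" by simp
  from geometric_sums[OF this] have s: "(\<lambda>k. exp (-1::real) ^ k) sums (1 / (1 - exp (-1)))" .
  have "(\<lambda>k. exp (-1::real) ^ k) = (\<lambda>k. exp (- real k))" by (simp add: fun_eq_iff flip: exp_of_nat_mult)
  then have s: "(\<lambda>k. exp (- real k)) sums (1 / (1 - exp (-1)))" using s by simp
  then have "(suminf (\<lambda>k. ennreal (exp (- real k)))) = ennreal (1 / (1 - exp (-1)))"
    by (intro suminf_ennreal_eq) auto
  also have "\<dots> \<le> ennreal 2" using lt by (intro ennreal_leI) (simp add: field_simps)
  finally show ?thesis by simp
qed

text \<open>In the application \<open>lf\<close> is the trace and \<open>p\<close> a point where it
  is large. The bound \<open>s\<close> on the dimension is kept apart from \<open>m\<close>, so that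
  estimates depend on d only.\<close>

locale convex_body_affine = convex_body +
  fixes lf :: "(nat \<Rightarrow> real) \<Rightarrow> real" and p :: "nat \<Rightarrow> real" and s :: nat and L :: real
  assumes lf_measurable: "lf \<in> borel_measurable (lborel_n m)"
    and lf_affine: "\<And>x y t. x \<in> {..<m} \<rightarrow>\<^sub>E UNIV \<Longrightarrow> y \<in> {..<m} \<rightarrow>\<^sub>E UNIV \<Longrightarrow> lf (homothety m t x y) = (1 - t) * lf x + t * lf y"
    and p: "p \<in> K" and L: "0 < L" "L \<le> \<bar>lf p\<bar>" and s: "m \<le> s" "1 \<le> s"
begin

lemma strip_measurable [measurable]: "{x \<in> C. \<bar>lf x\<bar> < e} \<in> sets (lborel_n m)"
proof -
  note lf_measurable[measurable] coord_closure_measurable[measurable]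
  have "{x \<in> C. \<bar>lf x\<bar> < e} = C \<inter> {x \<in> space (lborel_n m). \<bar>lf x\<bar> < e}" using C_sub by (auto simp: space_lborel_n)
  also have "\<dots> \<in> sets (lborel_n m)" by measurable
  finally show ?thesis .
qed

text \<open>Homotheties towards \<^term>\<open>p\<close> with ratios between 1 - 1/(2s) and 1 move the strip to pairwise disjoint
  subsets of \<^term>\<open>C\<close>; each retains at least half of the volume of the strip.\<close>

lemma strip_le:
  assumes e: "e > 0"
  shows "emeasure (lborel_n m) {x \<in> C. \<bar>lf x\<bar> < e} \<le> ennreal (8 * real s * e / L) * emeasure (lborel_n m) C"
proof -
  define S where "S = {x \<in> C. \<bar>lf x\<bar> < e}"
  define l where "l = \<bar>lf p\<bar>"
  have l: "l > 0" "L \<le> l" using L by (auto simp: l_def)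
  \<comment> \<open>The i-th copy is shifted by 2 e i in the values of \<open>lf\<close>, just
    enough for disjointness; i <= l / (4 e s) keeps the ratio at least 1 - 1/(2 s).\<close>
  define n where "n = nat \<lfloor>l / (4 * e * s)\<rfloor>"
  define t where "t i = 1 - 2 * e * real i / l" for i
  define A where "A i = homothety m (t i) p ` S" for i
  have Sm: "S \<in> sets (lborel_n m)" unfolding S_def by (rule strip_measurable)
  have SE: "S \<subseteq> {..<m} \<rightarrow>\<^sub>E UNIV" using C_sub by (auto simp: S_def)
  have pE: "p \<in> {..<m} \<rightarrow>\<^sub>E UNIV" using p K_sub by blast
  have pC: "p \<in> C" using p K_sub_C by blast
  have ti: "1 - 1 / (2 * real s) \<le> t i" "t i \<le> 1" if "i \<le> n" for i
  proof -
    have "real i \<le> l / (4 * e * s)" using that l e s unfolding n_def by (simp add: le_nat_iff le_floor_iff)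
    then have "2 * e * real i \<le> 2 * e * (l / (4 * e * s))" using e by (intro mult_left_mono) auto
    also have "\<dots> = l * (1 / (2 * real s))" using e s by (simp add: field_simps)
    finally show "1 - 1 / (2 * real s) \<le> t i" using l by (simp add: t_def field_simps)
    show "t i \<le> 1" using e l by (simp add: t_def)
  qed
  have s2: "1 / (2 * real s) \<le> 1/2" using s by (simp add: field_simps)
  have t0: "0 < t i" if "i \<le> n" for i using ti(1)[OF that] s2 by linarith
  have Am: "A i \<in> sets (lborel_n m)" if "i \<le> n" for i
    unfolding A_def by (rule emeasure_homothety(1)[OF t0[OF that] Sm])
  have Ae: "ennreal (1/2) * emeasure (lborel_n m) S \<le> emeasure (lborel_n m) (A i)" if "i \<le> n" for i
  proof -
    \<comment> \<open>Bernoulli gives (1 - 1/(2 s))^s >= 1/2, and passing from exponent s to m <= s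
      only helps.\<close>
    have "1/2 = 1 + real s * (- 1 / (2 * real s))" using s by simp
    also have "\<dots> \<le> (1 + (- 1 / (2 * real s))) ^ s" using s2 by (intro Bernoulli_inequality) auto
    also have "\<dots> \<le> t i ^ s" using ti[OF that] s2 by (intro power_mono) auto
    also have "\<dots> \<le> t i ^ m" using ti[OF that] t0[OF that] s by (intro power_decreasing) auto
    finally show ?thesis unfolding A_def emeasure_homothety(2)[OF t0[OF that] Sm]
      by (intro mult_right_mono ennreal_leI) auto
  qed
  have AC: "A i \<subseteq> C" if "i \<le> n" for i
    unfolding A_def S_def using C_convex[OF pC] ti[OF that] t0[OF that] by auto
  have dist: "\<bar>lf z - sgn (lf p) * (2 * e * real i)\<bar> < e" if i: "i \<le> n" and zA: "z \<in> A i" for i z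
  proof -
    obtain x where x: "x \<in> S" "z = homothety m (t i) p x" using zA unfolding A_def by blast
    have "lf p = sgn (lf p) * l" unfolding l_def by (simp add: sgn_mult_abs)
    then have "(1 - t i) * lf p = 2 * e * real i / l * (sgn (lf p) * l)" by (simp add: t_def)
    also have "\<dots> = sgn (lf p) * (2 * e * real i)" using l by simp
    finally have "(1 - t i) * lf p = sgn (lf p) * (2 * e * real i)" .
    then have "lf z - sgn (lf p) * (2 * e * real i) = t i * lf x" using lf_affine[OF pE] x SE by auto
    also have "\<bar>\<dots>\<bar> \<le> 1 * \<bar>lf x\<bar>" using ti[OF i] t0[OF i] by (simp add: abs_mult mult_left_le_one_le)
    also have "\<dots> < e" using x by (simp add: S_def)
    finally show ?thesis .
  qed
  have disj: "disjoint_family_on A {..n}"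
    unfolding disjoint_family_on_def
  proof (intro ballI impI equals0I)
    fix i j z assume ij: "i \<in> {..n}" "j \<in> {..n}" "i \<noteq> j" and z: "z \<in> A i \<inter> A j"
    have "\<bar>sgn (lf p) * (2 * e * real i) - sgn (lf p) * (2 * e * real j)\<bar> < 2 * e"
      using dist[of i z] dist[of j z] ij z by auto
    also have "sgn (lf p) * (2 * e * real i) - sgn (lf p) * (2 * e * real j) = sgn (lf p) * (2 * e * (real i - real j))"
      by (simp add: algebra_simps)
    also have "\<bar>\<dots>\<bar> = 2 * e * \<bar>real i - real j\<bar>" using l e by (simp add: abs_mult l_def sgn_if)
    finally have "\<bar>real i - real j\<bar> < 1" using e by simp
    then show False using ij by simp
  qed
  have "(\<Sum>i\<le>n. ennreal (1/2) * emeasure (lborel_n m) S) \<le> (\<Sum>i\<le>n. emeasure (lborel_n m) (A i))"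
    by (intro sum_mono Ae) simp
  also have "\<dots> = emeasure (lborel_n m) (\<Union>i\<le>n. A i)"
    using Am by (intro sum_emeasure disj) auto
  also have "\<dots> \<le> emeasure (lborel_n m) C" using AC by (intro emeasure_mono coord_closure_measurable) auto
  finally have le: "of_nat (Suc n) * (ennreal (1/2) * emeasure (lborel_n m) S) \<le> emeasure (lborel_n m) C" by simp
  \<comment> \<open>So n + 1 disjoint copies, each of at least half the volume of S, fit into
    \<open>C\<close>; this yields the factor 2 * 4 e s / l.\<close>
  have n: "l / (4 * e * s) \<le> real (Suc n)" unfolding n_def by linarith
  have "1 \<le> (8 * real s * e / L) * (real (Suc n) * (1/2))"
  proof -
    have "l \<le> real (Suc n) * (4 * e * s)" using n e s by (simp add: field_simps)
    then have "L \<le> real (Suc n) * (4 * e * s)" using l by linarith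
    then show ?thesis using L by (simp add: field_simps)
  qed
  then have "1 * emeasure (lborel_n m) S \<le> ennreal ((8 * real s * e / L) * (real (Suc n) * (1/2))) * emeasure (lborel_n m) S"
    by (intro mult_right_mono) (simp_all flip: ennreal_1 add: ennreal_leI del: ennreal_1)
  also have "\<dots> = ennreal (8 * real s * e / L) * (of_nat (Suc n) * (ennreal (1/2) * emeasure (lborel_n m) S))"
    using e L unfolding ennreal_of_nat_eq_real_of_nat by (subst ennreal_mult; (subst ennreal_mult)?) (auto simp: mult.assoc)
  also have "\<dots> \<le> ennreal (8 * real s * e / L) * emeasure (lborel_n m) C" by (intro mult_left_mono le) auto
  finally show ?thesis unfolding S_def by simp
qed

text \<open>Limit of the strip estimate as the width tends to 0. On this set the trace gives no
  control over the count, so it has to be negligible.\<close>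

lemma kernel_null: "{x \<in> C. lf x = 0} \<in> null_sets (lborel_n m)"
proof -
  note lf_measurable[measurable] coord_closure_measurable[measurable]
  have m: "{x \<in> C. lf x = 0} \<in> sets (lborel_n m)"
  proof -
    have "{x \<in> C. lf x = 0} = C \<inter> {x \<in> space (lborel_n m). lf x = 0}" using C_sub by (auto simp: space_lborel_n)
    also have "\<dots> \<in> sets (lborel_n m)" by measurable
    finally show ?thesis .
  qed
  obtain c where c: "emeasure (lborel_n m) C = ennreal c" "c \<ge> 0"
    using emeasure_C_finite by (metis ennreal_cases infinity_ennreal_def less_irrefl)
  have "emeasure (lborel_n m) {x \<in> C. lf x = 0} \<le> ennreal (8 * real s * (1 / real (Suc n)) / L * c)" for n
  proof -
    have "emeasure (lborel_n m) {x \<in> C. lf x = 0} \<le> emeasure (lborel_n m) {x \<in> C. \<bar>lf x\<bar> < 1 / real (Suc n)}"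
      by (intro emeasure_mono strip_measurable) auto
    also have "\<dots> \<le> ennreal (8 * real s * (1 / real (Suc n)) / L) * emeasure (lborel_n m) C" by (rule strip_le) simp
    also have "\<dots> = ennreal (8 * real s * (1 / real (Suc n)) / L * c)" using c L by (subst ennreal_mult) auto
    finally show ?thesis .
  qed
  moreover have "(\<lambda>n. ennreal (8 * real s * (1 / real (Suc n)) / L * c)) \<longlonglongrightarrow> ennreal (8 * real s * 0 / L * c)"
    using L by (intro tendsto_ennrealI tendsto_intros LIMSEQ_Suc[OF lim_1_over_n]) auto
  ultimately have "emeasure (lborel_n m) {x \<in> C. lf x = 0} \<le> ennreal (8 * real s * 0 / L * c)"
    by (intro LIMSEQ_le_const) auto
  then show ?thesis using m by (simp add: null_sets_def)
qed

lemma log_integral_le: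
  assumes M: "L / (8 * real s) \<le> M"
  shows "(\<integral>\<^sup>+x\<in>C. ennreal (ln (M / \<bar>lf x\<bar>)) \<partial>lborel_n m)
    \<le> ennreal (ln (8 * real s * M / L) + 2) * emeasure (lborel_n m) C"
proof -
  note lf_measurable[measurable] coord_closure_measurable[measurable]
  \<comment> \<open>The width at which the strip estimate reaches factor 1; below it the layers of
    width e0 * exp (-k) have relative volume at most exp (-k), summing to at most 2.\<close>
  define e0 where "e0 = L / (8 * real s)"
  have e0: "e0 > 0" "e0 \<le> M" using L s M by (auto simp: e0_def)
  have "(\<integral>\<^sup>+x\<in>C. ennreal (ln (M / \<bar>lf x\<bar>)) \<partial>lborel_n m)
     \<le> (\<integral>\<^sup>+x. ennreal (ln (M / e0)) * indicator C x + (suminf (\<lambda>k. indicator {x \<in> C. \<bar>lf x\<bar> < e0 * exp (- real k)} x)) \<partial>lborel_n m)"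
  proof (rule nn_integral_mono)
    fix x
    show "ennreal (ln (M / \<bar>lf x\<bar>)) * indicator C x \<le> ennreal (ln (M / e0)) * indicator C x + (suminf (\<lambda>k. indicator {x \<in> C. \<bar>lf x\<bar> < e0 * exp (- real k)} x))"
    proof (cases "x \<in> C")
      case True
      then have "(\<lambda>k. indicator {x \<in> C. \<bar>lf x\<bar> < e0 * exp (- real k)} x :: ennreal) = (\<lambda>k. indicator {z. z < e0 * exp (- real k)} \<bar>lf x\<bar>)"
        by (auto simp: indicator_def)
      then show ?thesis using ln_le_suminf_indicator[OF e0, of "\<bar>lf x\<bar>"] True by simp
    qed simp
  qed
  also have "\<dots> = ennreal (ln (M / e0)) * emeasure (lborel_n m) C + (\<integral>\<^sup>+x. (suminf (\<lambda>k. indicator {x \<in> C. \<bar>lf x\<bar> < e0 * exp (- real k)} x)) \<partial>lborel_n m)"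
    by (subst nn_integral_add) (auto simp: nn_integral_cmult_indicator)
  also have "(\<integral>\<^sup>+x. (suminf (\<lambda>k. indicator {x \<in> C. \<bar>lf x\<bar> < e0 * exp (- real k)} x)) \<partial>lborel_n m)
    = (suminf (\<lambda>k. emeasure (lborel_n m) {x \<in> C. \<bar>lf x\<bar> < e0 * exp (- real k)}))"
    by (subst nn_integral_suminf) auto
  also have "\<dots> \<le> (suminf (\<lambda>k. ennreal (exp (- real k)) * emeasure (lborel_n m) C))"
  proof (intro suminf_le)
    fix k
    have "8 * real s * (e0 * exp (- real k)) / L = exp (- real k)" using L s by (simp add: e0_def)
    then show "emeasure (lborel_n m) {x \<in> C. \<bar>lf x\<bar> < e0 * exp (- real k)} \<le> ennreal (exp (- real k)) * emeasure (lborel_n m) C"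
      using strip_le[of "e0 * exp (- real k)"] e0 by simp
  qed auto
  also have "\<dots> = (suminf (\<lambda>k. ennreal (exp (- real k)))) * emeasure (lborel_n m) C" by simp
  also have "\<dots> \<le> 2 * emeasure (lborel_n m) C" by (intro mult_right_mono suminf_exp_le_2) auto
  also have "ennreal (ln (M / e0)) * emeasure (lborel_n m) C + 2 * emeasure (lborel_n m) C = (ennreal (ln (M / e0)) + ennreal 2) * emeasure (lborel_n m) C"
    by (simp add: distrib_right)
  also have "ennreal (ln (M / e0)) + ennreal 2 = ennreal (ln (M / e0) + 2)" using e0 by (intro ennreal_plus[symmetric]) auto
  also have "M / e0 = 8 * real s * M / L" by (simp add: e0_def)
  finally show ?thesis by (simp add: add_left_mono)
qed

end

section \<open>Isometric charts\<close>

text \<open>Merges the two coefficient families into one, so that the Euclidean structure is a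
  single sum over a disjoint union.\<close>

definition coeff_vec :: "coeffs \<Rightarrow> (nat \<times> nat) + (nat \<times> nat) \<Rightarrow> real" where
  "coeff_vec v = case_sum (Poly_Mapping.lookup (fst v)) (Poly_Mapping.lookup (snd v))"

abbreviation coeff_index2 :: "nat \<Rightarrow> ((nat \<times> nat) + (nat \<times> nat)) set" where
  "coeff_index2 d \<equiv> coeff_index d <+> coeff_index d"

lemma lookup_scaleR: "Poly_Mapping.lookup (r *\<^sub>R a) i = r * Poly_Mapping.lookup (a :: 'b \<Rightarrow>\<^sub>0 real) i"
proof -
  have "finite {i. r *\<^sub>R Poly_Mapping.lookup a i \<noteq> 0}"
    by (rule finite_subset[OF _ finite_lookup[of a]]) auto
  then show ?thesis unfolding scaleR_poly_mapping_def by (simp add: Abs_poly_mapping_inverse)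
qed

lemma coeff_vec_simps [simp]:
  "coeff_vec (v + w) i = coeff_vec v i + coeff_vec w i"
  "coeff_vec (v - w) i = coeff_vec v i - coeff_vec w i"
  "coeff_vec (c *\<^sub>R v) i = c * coeff_vec v i"
  "coeff_vec 0 i = 0"
  by (cases i; simp add: coeff_vec_def lookup_add lookup_minus lookup_scaleR zero_prod_def)+

lemma coeff_vec_sum [simp]: "coeff_vec (sum f A) i = (\<Sum>a\<in>A. coeff_vec (f a) i)"
  by (induction A rule: infinite_finite_induct) auto

lemma coeff_space_iff: "v \<in> coeff_space d \<longleftrightarrow> (\<forall>i. i \<notin> coeff_index2 d \<longrightarrow> coeff_vec v i = 0)"
proof -
  have "(\<forall>i. i \<notin> coeff_index2 d \<longrightarrow> coeff_vec v i = 0) \<longleftrightarrow>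
    (\<forall>p. p \<notin> coeff_index d \<longrightarrow> Poly_Mapping.lookup (fst v) p = 0) \<and> (\<forall>p. p \<notin> coeff_index d \<longrightarrow> Poly_Mapping.lookup (snd v) p = 0)"
    unfolding split_sum_all by (auto simp: coeff_vec_def)
  moreover have "v \<in> coeff_space d \<longleftrightarrow> (\<forall>p. p \<notin> coeff_index d \<longrightarrow> Poly_Mapping.lookup (fst v) p = 0) \<and>
      (\<forall>p. p \<notin> coeff_index d \<longrightarrow> Poly_Mapping.lookup (snd v) p = 0)"
    by (cases v) (auto simp: coeff_space_def in_keys_iff subset_iff)
  ultimately show ?thesis by blast
qed

lemma subspace_coeff_space: "subspace (coeff_space d)"
  by (auto simp: subspace_def coeff_space_iff)

definition coeff_inner :: "nat \<Rightarrow> coeffs \<Rightarrow> coeffs \<Rightarrow> real" where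
  "coeff_inner d v w = (\<Sum>i\<in>coeff_index2 d. coeff_vec v i * coeff_vec w i)"

lemma coeff_inner_simps [simp]:
  "coeff_inner d (u + v) w = coeff_inner d u w + coeff_inner d v w"
  "coeff_inner d w (u + v) = coeff_inner d w u + coeff_inner d w v"
  "coeff_inner d (u - v) w = coeff_inner d u w - coeff_inner d v w"
  "coeff_inner d w (u - v) = coeff_inner d w u - coeff_inner d w v"
  "coeff_inner d (c *\<^sub>R u) w = c * coeff_inner d u w"
  "coeff_inner d w (c *\<^sub>R u) = c * coeff_inner d w u"
  "coeff_inner d 0 w = 0"
  "coeff_inner d w 0 = 0"
  by (simp_all add: coeff_inner_def algebra_simps sum.distrib sum_subtractf sum_distrib_left)

lemma coeff_inner_sum [simp]:
  "coeff_inner d (sum f A) w = (\<Sum>a\<in>A. coeff_inner d (f a) w)"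
  "coeff_inner d w (sum f A) = (\<Sum>a\<in>A. coeff_inner d w (f a))"
  by (induction A rule: infinite_finite_induct) auto

lemma coeff_inner_commute: "coeff_inner d v w = coeff_inner d w v"
  by (simp add: coeff_inner_def mult.commute)

lemma coeff_norm_square: "(coeff_norm d v)\<^sup>2 = coeff_inner d v v"
proof -
  have "coeff_inner d v v = (\<Sum>p\<in>coeff_index d. \<bar>Poly_Mapping.lookup (fst v) p\<bar>\<^sup>2) + (\<Sum>p\<in>coeff_index d. \<bar>Poly_Mapping.lookup (snd v) p\<bar>\<^sup>2)"
    unfolding coeff_inner_def by (subst sum.Plus) (auto simp: coeff_vec_def power2_eq_square)
  then show ?thesis unfolding coeff_norm_def by (simp add: sum_nonneg)
qed

lemma coeff_norm_eq_sqrt: "coeff_norm d v = sqrt (coeff_inner d v v)"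
  using coeff_norm_square[of d v] coeff_norm_nonneg[of d v] by (metis real_sqrt_abs abs_of_nonneg)

lemma coeff_inner_nonneg [simp]: "coeff_inner d v v \<ge> 0"
  by (simp add: coeff_norm_square[symmetric])

lemma coeff_inner_eq_0:
  assumes "v \<in> coeff_space d" "coeff_inner d v v = 0"
  shows "v = 0"
proof -
  have "\<forall>i\<in>coeff_index2 d. coeff_vec v i * coeff_vec v i = 0"
    using assms(2) unfolding coeff_inner_def by (subst (asm) sum_nonneg_eq_0_iff) auto
  then have "coeff_vec v i = 0" for i using assms(1) by (auto simp: coeff_space_iff)
  then have "Poly_Mapping.lookup (fst v) p = 0 \<and> Poly_Mapping.lookup (snd v) p = 0" for p
    unfolding coeff_vec_def by (metis old.sum.simps(5,6))
  then show ?thesis by (intro prod_eqI poly_mapping_eqI) auto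
qed

definition orthonormal :: "nat \<Rightarrow> nat \<Rightarrow> (nat \<Rightarrow> coeffs) \<Rightarrow> bool" where
  "orthonormal d n w \<longleftrightarrow> (\<forall>j<n. w j \<in> coeff_space d) \<and>
     (\<forall>j<n. \<forall>k<n. coeff_inner d (w j) (w k) = (if j = k then 1 else 0))"

lemma orthonormal_comb_inner:
  assumes "orthonormal d n w"
  shows "k < n \<Longrightarrow> coeff_inner d (\<Sum>j<n. c j *\<^sub>R w j) (w k) = c k"
    and "coeff_inner d (\<Sum>j<n. c j *\<^sub>R w j) (\<Sum>j<n. c j *\<^sub>R w j) = (\<Sum>j<n. (c j)\<^sup>2)"
proof -
  show *: "coeff_inner d (\<Sum>j<n. c j *\<^sub>R w j) (w k) = c k" if "k < n" for k
  proof -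
    have "coeff_inner d (\<Sum>j<n. c j *\<^sub>R w j) (w k) = (\<Sum>j<n. if j = k then c j else 0)"
      unfolding coeff_inner_sum coeff_inner_simps
      by (rule sum.cong) (use assms that in \<open>auto simp: orthonormal_def\<close>)
    then show ?thesis using that by simp
  qed
  show "coeff_inner d (\<Sum>j<n. c j *\<^sub>R w j) (\<Sum>j<n. c j *\<^sub>R w j) = (\<Sum>j<n. (c j)\<^sup>2)"
    unfolding coeff_inner_sum(2)[of d "\<Sum>j<n. c j *\<^sub>R w j"] coeff_inner_simps(6)
    by (rule sum.cong) (auto simp: * power2_eq_square simp del: coeff_inner_sum)
qed

text \<open>Bessel's inequality applied to the coordinate functionals.\<close>

lemma orthonormal_card_le:
  assumes w: "orthonormal d n w"
  shows "n \<le> d * (d + 3)"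
proof -
  have "(\<Sum>j<n. (coeff_vec (w j) i)\<^sup>2) \<le> 1" if i: "i \<in> coeff_index2 d" for i
  proof -
    define a where "a = (\<Sum>j<n. (coeff_vec (w j) i)\<^sup>2)"
    \<comment> \<open>The orthogonal projection of the i-th unit vector to the span; its i-th
      coordinate equals its squared norm.\<close>
    define u where "u = (\<Sum>j<n. coeff_vec (w j) i *\<^sub>R w j)"
    have uu: "coeff_inner d u u = a" unfolding u_def a_def by (rule orthonormal_comb_inner(2)[OF w])
    have ui: "coeff_vec u i = a" unfolding u_def a_def by (simp add: power2_eq_square)
    have "coeff_vec u i * coeff_vec u i \<le> (\<Sum>i\<in>coeff_index2 d. coeff_vec u i * coeff_vec u i)"
      using i by (intro member_le_sum) auto
    then have "a * a \<le> a * 1" using uu ui unfolding coeff_inner_def by simp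
    moreover have "a \<ge> 0" unfolding a_def by (intro sum_nonneg) auto
    ultimately have "a \<le> 1" by (metis mult_le_cancel_left_pos less_eq_real_def zero_le_one)
    then show ?thesis unfolding a_def .
  qed
  then have "(\<Sum>i\<in>coeff_index2 d. \<Sum>j<n. (coeff_vec (w j) i)\<^sup>2) \<le> (\<Sum>i\<in>coeff_index2 d. 1)" by (rule sum_mono)
  also have "\<dots> = real (d * (d + 3))" using card_coeff_index[of d] by (simp add: card_Plus mult_2)
  finally have "(\<Sum>i\<in>coeff_index2 d. \<Sum>j<n. (coeff_vec (w j) i)\<^sup>2) \<le> real (d * (d + 3))" .
  also have "(\<Sum>i\<in>coeff_index2 d. \<Sum>j<n. (coeff_vec (w j) i)\<^sup>2) = (\<Sum>j<n. coeff_inner d (w j) (w j))"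
    unfolding coeff_inner_def by (subst sum.swap) (simp add: power2_eq_square)
  also have "\<dots> = real n" using w by (simp add: orthonormal_def)
  finally show ?thesis by (simp only: of_nat_le_iff)
qed

text \<open>Takes an orthonormal family of maximal length, which exists by the length bound; the
  residual of a vector that is not expanded would, after normalization, extend it.\<close>

lemma orthonormal_basis_exists:
  assumes W: "subspace W" "W \<subseteq> coeff_space d"
  obtains n w where "orthonormal d n w" "\<And>j. j < n \<Longrightarrow> w j \<in> W" "\<And>u. u \<in> W \<Longrightarrow> u = (\<Sum>j<n. coeff_inner d u (w j) *\<^sub>R w j)"
proof -
  let ?P = "\<lambda>n. \<exists>w. orthonormal d n w \<and> (\<forall>j<n. w j \<in> W)"
  have "?P 0" by (simp add: orthonormal_def)
  moreover have "\<forall>n. ?P n \<longrightarrow> n \<le> d * (d + 3)" using orthonormal_card_le by blast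
  ultimately obtain n where n: "?P n" "\<forall>k. ?P k \<longrightarrow> k \<le> n" using Nat.ex_has_greatest_nat[where P = ?P and k = 0 and b = "d * (d + 3)"] by blast
  from n(1) obtain w where w: "orthonormal d n w" "\<And>j. j < n \<Longrightarrow> w j \<in> W" by blast
  have expand: "u = (\<Sum>j<n. coeff_inner d u (w j) *\<^sub>R w j)" if u: "u \<in> W" for u
  proof (rule ccontr)
    define r where "r = u - (\<Sum>j<n. coeff_inner d u (w j) *\<^sub>R w j)"
    assume "u \<noteq> (\<Sum>j<n. coeff_inner d u (w j) *\<^sub>R w j)"
    then have r0: "r \<noteq> 0" by (simp add: r_def)
    have rW: "r \<in> W" unfolding r_def using u w(2) W(1)
      by (intro subspace_diff subspace_sum subspace_scale) auto
    have rk: "coeff_inner d r (w k) = 0" if "k < n" for k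
      unfolding r_def coeff_inner_simps(3) orthonormal_comb_inner(1)[OF w(1) that] by simp
    define c where "c = 1 / coeff_norm d r"
    have nr: "coeff_norm d r > 0"
    proof -
      have "coeff_inner d r r \<noteq> 0" using coeff_inner_eq_0 rW W(2) r0 by blast
      then show ?thesis by (simp add: coeff_norm_eq_sqrt less_le)
    qed
    have "c * c * coeff_inner d r r = 1" using nr by (simp add: c_def coeff_norm_square[symmetric] power2_eq_square)
    then have rr: "coeff_inner d (c *\<^sub>R r) (c *\<^sub>R r) = 1" by simp
    have rk': "coeff_inner d (w k) r = 0" if "k < n" for k using rk[OF that] by (simp add: coeff_inner_commute)
    have cW: "c *\<^sub>R r \<in> W" using rW W(1) by (intro subspace_scale)
    define w' where "w' = w(n := c *\<^sub>R r)"
    have "orthonormal d (Suc n) w'"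
      using w(1) rr rk rk' cW W(2) unfolding orthonormal_def w'_def by (auto simp: less_Suc_eq)
    moreover have "\<forall>j<Suc n. w' j \<in> W" using w(2) cW by (auto simp: w'_def less_Suc_eq)
    ultimately have "Suc n \<le> n" using n(2) by blast
    then show False by simp
  qed
  show ?thesis by (rule that[of n w]) (fact w(1), erule w(2), erule expand)
qed

text \<open>Guarantees that the choice inside \<open>affine_lebesgue\<close> selects an actual
  chart.\<close>

lemma isometric_chart_exists:
  assumes A: "affine A" "A \<noteq> {}" "A \<subseteq> coeff_space d"
  shows "\<exists>m \<phi>. isometric_chart d A m \<phi>"
proof -
  obtain o' where o: "o' \<in> A" using A(2) by blast
  define W where "W = (\<lambda>x. x - o') ` A"
  have W: "subspace W" unfolding W_def by (rule affine_diffs_subspace_subtract[OF A(1) o])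
  have Ws: "W \<subseteq> coeff_space d" unfolding W_def using A(3) o subspace_diff[OF subspace_coeff_space] by blast
  obtain m w where w: "orthonormal d m w" "\<And>j. j < m \<Longrightarrow> w j \<in> W" "\<And>u. u \<in> W \<Longrightarrow> u = (\<Sum>j<m. coeff_inner d u (w j) *\<^sub>R w j)"
    using orthonormal_basis_exists[OF W Ws] by blast
  define \<phi> where "\<phi> x = o' + (\<Sum>j<m. x j *\<^sub>R w j)" for x
  have "\<phi> x \<in> A" for x
  proof -
    have "(\<Sum>j<m. x j *\<^sub>R w j) \<in> W" using w(2) W by (intro subspace_sum subspace_scale) auto
    then show ?thesis unfolding \<phi>_def W_def by force
  qed
  moreover have "a \<in> \<phi> ` ({..<m} \<rightarrow>\<^sub>E UNIV)" if "a \<in> A" for a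
  proof -
    define x where "x = (\<lambda>j\<in>{..<m}. coeff_inner d (a - o') (w j))"
    have "a - o' \<in> W" using that by (simp add: W_def)
    from w(3)[OF this] have "a = \<phi> x" unfolding \<phi>_def x_def by (simp add: algebra_simps del: coeff_inner_simps)
    then show ?thesis by (intro image_eqI[of _ _ x]) (auto simp: x_def)
  qed
  moreover have "coeff_norm d (\<phi> x - \<phi> y) = L2_set (\<lambda>j. x j - y j) {..<m}" for x y
  proof -
    have "\<phi> x - \<phi> y = (\<Sum>j<m. (x j - y j) *\<^sub>R w j)"
      by (simp add: \<phi>_def scaleR_diff_left sum_subtractf)
    then show ?thesis unfolding coeff_norm_eq_sqrt L2_set_def using orthonormal_comb_inner(2)[OF w(1)] by (simp only:)
  qed
  ultimately have "isometric_chart d A m \<phi>" unfolding isometric_chart_def by auto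
  then show ?thesis by blast
qed

text \<open>Isometries of Euclidean spaces are affine, by polarization.\<close>

lemma isometric_chart_affine:
  assumes ch: "isometric_chart d A m \<phi>" and A: "A \<subseteq> coeff_space d"
  obtains o' w where "o' \<in> A" "orthonormal d m w" "\<And>x. x \<in> {..<m} \<rightarrow>\<^sub>E UNIV \<Longrightarrow> \<phi> x = o' + (\<Sum>j<m. x j *\<^sub>R w j)"
    "\<And>j. j < m \<Longrightarrow> o' + w j \<in> A"
proof -
  let ?E = "{..<m} \<rightarrow>\<^sub>E (UNIV :: real set)"
  define z where "z = (\<lambda>j\<in>{..<m}. 0 :: real)"
  define e where "e k = (\<lambda>j\<in>{..<m}. if j = k then 1 else 0 :: real)" for k
  define o' where "o' = \<phi> z"
  define w where "w k = \<phi> (e k) - o'" for k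
  have zE: "z \<in> ?E" and eE: "e k \<in> ?E" for k by (auto simp: z_def e_def)
  have \<phi>A: "\<phi> x \<in> A" if "x \<in> ?E" for x using ch that unfolding isometric_chart_def by blast
  have sq: "coeff_inner d (\<phi> x - \<phi> y) (\<phi> x - \<phi> y) = (\<Sum>j<m. (x j - y j)\<^sup>2)" if "x \<in> ?E" "y \<in> ?E" for x y
  proof -
    have "coeff_norm d (\<phi> x - \<phi> y) = L2_set (\<lambda>j. x j - y j) {..<m}" using ch that unfolding isometric_chart_def by blast
    then show ?thesis unfolding coeff_norm_square[symmetric] L2_set_def by (simp add: sum_nonneg)
  qed
  \<comment> \<open>Polarization relative to the image of the origin, which an isometry is free to
    move.\<close>
  have ip: "coeff_inner d (\<phi> x - o') (\<phi> y - o') = (\<Sum>j<m. x j * y j)" if x: "x \<in> ?E" and y: "y \<in> ?E" for x y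
  proof -
    have "\<phi> x - \<phi> y = (\<phi> x - o') - (\<phi> y - o')" by simp
    then have "coeff_inner d (\<phi> x - \<phi> y) (\<phi> x - \<phi> y) =
      coeff_inner d (\<phi> x - o') (\<phi> x - o') + coeff_inner d (\<phi> y - o') (\<phi> y - o') - 2 * coeff_inner d (\<phi> x - o') (\<phi> y - o')"
      by (simp only: coeff_inner_simps coeff_inner_commute[of d "\<phi> y - o'" "\<phi> x - o'"]) (simp add: coeff_inner_commute)
    moreover have "(\<Sum>j<m. (x j - y j)\<^sup>2) = (\<Sum>j<m. (x j)\<^sup>2) + (\<Sum>j<m. (y j)\<^sup>2) - 2 * (\<Sum>j<m. x j * y j)"
      by (simp add: power2_diff sum.distrib sum_subtractf sum_distrib_left mult.assoc)
    moreover have "(\<Sum>j<m. (x j - z j)\<^sup>2) = (\<Sum>j<m. (x j)\<^sup>2)" "(\<Sum>j<m. (y j - z j)\<^sup>2) = (\<Sum>j<m. (y j)\<^sup>2)"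
      by (simp_all add: z_def)
    ultimately show ?thesis using sq[OF x y] sq[OF x zE] sq[OF y zE] unfolding o'_def by linarith
  qed
  have xe: "(\<Sum>j<m. x j * e k j) = x k" if "k < m" for x k
  proof -
    have "(\<Sum>j<m. x j * e k j) = (\<Sum>j<m. if j = k then x j else 0)" by (rule sum.cong) (auto simp: e_def)
    then show ?thesis using that by simp
  qed
  have wsp: "w k \<in> coeff_space d" for k
    unfolding w_def o'_def using \<phi>A[OF eE] \<phi>A[OF zE] A by (intro subspace_diff[OF subspace_coeff_space]) auto
  have on: "orthonormal d m w"
    unfolding orthonormal_def
  proof (intro conjI allI impI wsp)
    fix j k assume "j < m" "k < m"
    then show "coeff_inner d (w j) (w k) = (if j = k then 1 else 0)"
      unfolding w_def ip[OF eE eE] by (subst xe) (auto simp: e_def)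
  qed
  have "\<phi> x = o' + (\<Sum>j<m. x j *\<^sub>R w j)" if x: "x \<in> ?E" for x
  proof -
    let ?u = "\<Sum>j<m. x j *\<^sub>R w j"
    have xw: "coeff_inner d (\<phi> x - o') ?u = (\<Sum>j<m. (x j)\<^sup>2)"
    proof -
      have "coeff_inner d (\<phi> x - o') ?u = (\<Sum>j<m. x j * coeff_inner d (\<phi> x - o') (w j))"
        unfolding coeff_inner_sum(2) coeff_inner_simps(6) ..
      also have "\<dots> = (\<Sum>j<m. (x j)\<^sup>2)"
        unfolding w_def ip[OF x eE] by (rule sum.cong) (auto simp: xe power2_eq_square)
      finally show ?thesis .
    qed
    have xx: "coeff_inner d (\<phi> x - o') (\<phi> x - o') = (\<Sum>j<m. (x j)\<^sup>2)" unfolding ip[OF x x] by (simp add: power2_eq_square)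
    \<comment> \<open>Both vectors have the same squared norm, and it equals their inner product; so
      their difference has norm 0.\<close>
    have "coeff_inner d ((\<phi> x - o') - ?u) ((\<phi> x - o') - ?u) = 0"
      unfolding coeff_inner_simps(3)[of d "\<phi> x - o'"] coeff_inner_simps(4)[of d _ "\<phi> x - o'"]
        coeff_inner_commute[of d ?u "\<phi> x - o'"] xw xx orthonormal_comb_inner(2)[OF on] by simp
    moreover have "(\<phi> x - o') - ?u \<in> coeff_space d"
      using \<phi>A[OF x] \<phi>A[OF zE] A wsp unfolding o'_def
      by (intro subspace_diff[OF subspace_coeff_space] subspace_sum[OF subspace_coeff_space] subspace_scale[OF subspace_coeff_space]) auto
    ultimately have "(\<phi> x - o') - ?u = 0" by (rule coeff_inner_eq_0[rotated])
    then show ?thesis by (simp add: algebra_simps)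
  qed
  moreover have "o' \<in> A" "o' + w j \<in> A" for j unfolding w_def o'_def using \<phi>A[OF zE] \<phi>A[OF eE] by simp_all
  ultimately show ?thesis using on that by blast
qed

text \<open>The directions in which some point of V can move both ways inside V form a subspace: for
  a sum, take the midpoint of the two base points and half the amplitude. It contains all
  differences v - v0, hence their span.\<close>

lemma convex_inner_segment:
  fixes V :: "'a::real_vector set"
  assumes V: "convex V" and v0: "v0 \<in> V" and w: "w \<in> span ((\<lambda>v. v - v0) ` V)"
  shows "\<exists>q\<in>V. \<exists>\<epsilon>>0. \<forall>c. \<bar>c\<bar> \<le> \<epsilon> \<longrightarrow> q + c *\<^sub>R w \<in> V"
  using w
proof (induction rule: span_induct)
  case base
  show ?case
  proof (rule subspaceI)
    show "0 \<in> {w. \<exists>q\<in>V. \<exists>\<epsilon>>0. \<forall>c. \<bar>c\<bar> \<le> \<epsilon> \<longrightarrow> q + c *\<^sub>R w \<in> V}" using v0 by (auto intro!: exI[of _ "1::real"])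
  next
    fix w w'
    assume "w \<in> {w. \<exists>q\<in>V. \<exists>\<epsilon>>0. \<forall>c. \<bar>c\<bar> \<le> \<epsilon> \<longrightarrow> q + c *\<^sub>R w \<in> V}"
      "w' \<in> {w. \<exists>q\<in>V. \<exists>\<epsilon>>0. \<forall>c. \<bar>c\<bar> \<le> \<epsilon> \<longrightarrow> q + c *\<^sub>R w \<in> V}"
    then obtain q q' \<epsilon> \<epsilon>' where q: "q \<in> V" "\<epsilon> > 0" "\<And>c. \<bar>c\<bar> \<le> \<epsilon> \<Longrightarrow> q + c *\<^sub>R w \<in> V"
      and q': "q' \<in> V" "\<epsilon>' > 0" "\<And>c. \<bar>c\<bar> \<le> \<epsilon>' \<Longrightarrow> q' + c *\<^sub>R w' \<in> V" by blast
    have "(1/2) *\<^sub>R q + (1/2) *\<^sub>R q' + c *\<^sub>R (w + w') \<in> V" if c: "\<bar>c\<bar> \<le> min \<epsilon> \<epsilon>' / 2" for c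
    proof -
      have "(1/2) *\<^sub>R (q + (2 * c) *\<^sub>R w) + (1/2) *\<^sub>R (q' + (2 * c) *\<^sub>R w') \<in> V"
        using c by (intro convexD[OF V] q(3) q'(3)) auto
      then show ?thesis by (simp add: algebra_simps)
    qed
    moreover have "(1/2) *\<^sub>R q + (1/2) *\<^sub>R q' \<in> V" using q q' by (intro convexD[OF V]) auto
    moreover have "min \<epsilon> \<epsilon>' / 2 > 0" using q q' by simp
    ultimately show "w + w' \<in> {w. \<exists>q\<in>V. \<exists>\<epsilon>>0. \<forall>c. \<bar>c\<bar> \<le> \<epsilon> \<longrightarrow> q + c *\<^sub>R w \<in> V}" by blast
  next
    fix a w assume "w \<in> {w. \<exists>q\<in>V. \<exists>\<epsilon>>0. \<forall>c. \<bar>c\<bar> \<le> \<epsilon> \<longrightarrow> q + c *\<^sub>R w \<in> V}"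
    then obtain q \<epsilon> where q: "q \<in> V" "\<epsilon> > 0" "\<And>c. \<bar>c\<bar> \<le> \<epsilon> \<Longrightarrow> q + c *\<^sub>R w \<in> V" by blast
    have "q + c *\<^sub>R (a *\<^sub>R w) \<in> V" if c: "\<bar>c\<bar> \<le> \<epsilon> / (\<bar>a\<bar> + 1)" for c
    proof -
      have "\<bar>c * a\<bar> \<le> \<bar>c\<bar> * (\<bar>a\<bar> + 1)" by (simp add: abs_mult mult_left_mono)
      also have "\<dots> \<le> \<epsilon>" using c by (simp add: pos_le_divide_eq add_nonneg_pos)
      finally show ?thesis using q(3)[of "c * a"] by simp
    qed
    moreover have "\<epsilon> / (\<bar>a\<bar> + 1) > 0" using q by (simp add: add_nonneg_pos)
    ultimately show "a *\<^sub>R w \<in> {w. \<exists>q\<in>V. \<exists>\<epsilon>>0. \<forall>c. \<bar>c\<bar> \<le> \<epsilon> \<longrightarrow> q + c *\<^sub>R w \<in> V}" using q(1) by blast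
  qed
next
  case (step x)
  then obtain v where v: "v \<in> V" "x = v - v0" by blast
  have "(1/2) *\<^sub>R v + (1/2) *\<^sub>R v0 + c *\<^sub>R x \<in> V" if "\<bar>c\<bar> \<le> 1/2" for c
  proof -
    have "(1/2 + c) *\<^sub>R v + (1/2 - c) *\<^sub>R v0 \<in> V" using that v v0 by (intro convexD[OF V]) auto
    then show ?thesis by (simp add: v algebra_simps)
  qed
  moreover have "(1/2) *\<^sub>R v + (1/2) *\<^sub>R v0 \<in> V" using v v0 by (intro convexD[OF V]) auto
  moreover have "(1/2::real) > 0" by simp
  ultimately show ?case by blast
qed

text \<open>Averaging base points adds one direction at a time. For directions that span the space
  parallel to the affine hull, the point found lies in the relative interior of V.\<close>

lemma convex_inner_box:
  fixes V :: "'a::real_vector set"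
  assumes V: "convex V" and v0: "v0 \<in> V" and J: "finite J" and w: "\<And>j. j \<in> J \<Longrightarrow> w j \<in> span ((\<lambda>v. v - v0) ` V)"
  shows "\<exists>p\<in>V. \<exists>\<epsilon>>0. \<forall>c. (\<forall>j\<in>J. \<bar>c j\<bar> \<le> \<epsilon>) \<longrightarrow> p + (\<Sum>j\<in>J. c j *\<^sub>R w j) \<in> V"
  using J w
proof (induction J rule: finite_induct)
  case empty
  show ?case using v0 by (auto intro!: bexI[of _ v0] exI[of _ "1::real"])
next
  case (insert i J)
  obtain p \<epsilon> where p: "p \<in> V" "\<epsilon> > 0" "\<And>c. (\<forall>j\<in>J. \<bar>c j\<bar> \<le> \<epsilon>) \<Longrightarrow> p + (\<Sum>j\<in>J. c j *\<^sub>R w j) \<in> V"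
    using insert by blast
  obtain q \<eta> where q: "q \<in> V" "\<eta> > 0" "\<And>c. \<bar>c\<bar> \<le> \<eta> \<Longrightarrow> q + c *\<^sub>R w i \<in> V"
    using convex_inner_segment[OF V v0] insert.prems by blast
  have "(1/2) *\<^sub>R p + (1/2) *\<^sub>R q + (\<Sum>j\<in>insert i J. c j *\<^sub>R w j) \<in> V" if c: "\<forall>j\<in>insert i J. \<bar>c j\<bar> \<le> min \<epsilon> \<eta> / 2" for c
  proof -
    have "(1/2) *\<^sub>R (p + (\<Sum>j\<in>J. (2 * c j) *\<^sub>R w j)) + (1/2) *\<^sub>R (q + (2 * c i) *\<^sub>R w i) \<in> V"
      using c by (intro convexD[OF V] p(3) q(3)) auto
    also have "(1/2) *\<^sub>R (p + (\<Sum>j\<in>J. (2 * c j) *\<^sub>R w j)) + (1/2) *\<^sub>R (q + (2 * c i) *\<^sub>R w i)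
      = (1/2) *\<^sub>R p + (1/2) *\<^sub>R q + (\<Sum>j\<in>insert i J. c j *\<^sub>R w j)"
      using insert.hyps by (simp add: scaleR_add_right scaleR_sum_right algebra_simps)
    finally show ?thesis .
  qed
  moreover have "(1/2) *\<^sub>R p + (1/2) *\<^sub>R q \<in> V" using p q by (intro convexD[OF V]) auto
  moreover have "min \<epsilon> \<eta> / 2 > 0" using p q by simp
  ultimately show ?case by blast
qed

section \<open>The mean number of limit cycles\<close>

lemma vector_4 [simp]:
  "(vector [w, x, y, z] :: 'a::zero ^ 4) $ 1 = w"
  "(vector [w, x, y, z] :: 'a::zero ^ 4) $ 2 = x"
  "(vector [w, x, y, z] :: 'a::zero ^ 4) $ 3 = y"
  "(vector [w, x, y, z] :: 'a::zero ^ 4) $ 4 = z"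
  by (simp_all add: vector_def)

text \<open>A shear of determinant 1 makes w1 + w4 a coordinate, and the slab becomes part of a box
  with one side 2 \<eta> and three sides 2 N.\<close>

lemma emeasure_slab_le:
  fixes N \<eta> :: real
  assumes N: "N \<ge> 0" "\<eta> \<ge> 0" and T: "T \<subseteq> {w :: real ^ 4. (\<forall>i. \<bar>w $ i\<bar> \<le> N) \<and> \<bar>w $ 1 + w $ 4\<bar> \<le> \<eta>}"
  shows "emeasure lebesgue T \<le> ennreal (16 * N ^ 3 * \<eta>)"
proof -
  define f :: "real ^ 4 \<Rightarrow> real ^ 4" where "f u = (\<chi> i. if i = 1 then u $ 1 - u $ 4 else u $ i)" for u
  define b :: "real ^ 4" where "b = (\<chi> i. if i = 1 then \<eta> else N)"
  have ne: "(4::4) \<noteq> 1" "(2::4) \<noteq> 1" "(3::4) \<noteq> 1" by simp_all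
  have lin: "linear f" unfolding f_def by (rule linearI) (auto simp: vec_eq_iff algebra_simps)
  have m: "matrix f = (\<chi> k. if k = 1 then row 1 (mat 1) + (-1) *s row 4 (mat 1) else row k (mat 1))"
    by (auto simp: vec_eq_iff matrix_def f_def row_def mat_def axis_def)
  have det: "det (matrix f) = 1" unfolding m using ne by (subst det_row_operation) auto
  have "T \<subseteq> f ` cbox (- b) b"
  proof
    fix w assume "w \<in> T"
    then have w: "\<bar>w $ i\<bar> \<le> N" "\<bar>w $ 1 + w $ 4\<bar> \<le> \<eta>" for i using T by auto
    define u :: "real ^ 4" where "u = (\<chi> i. if i = 1 then w $ 1 + w $ 4 else w $ i)"
    have "w = f u" using ne by (simp add: f_def u_def vec_eq_iff)
    moreover have "u \<in> cbox (- b) b" unfolding mem_box_cart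
    proof
      fix i show "(- b) $ i \<le> u $ i \<and> u $ i \<le> b $ i" using w(1)[of i] w(2) by (auto simp: u_def b_def abs_le_iff)
    qed
    ultimately show "w \<in> f ` cbox (- b) b" by blast
  qed
  then have "emeasure lebesgue T \<le> emeasure lebesgue (f ` cbox (- b) b)"
    using measurable_linear_image_interval[OF lin] by (intro emeasure_mono) (auto simp: fmeasurableD)
  also have "\<dots> = ennreal (measure lebesgue (f ` cbox (- b) b))"
    using measurable_linear_image_interval[OF lin] by (intro emeasure_eq_measure2) auto
  also have "measure lebesgue (f ` cbox (- b) b) = measure lebesgue (cbox (- b) b)"
    using measure_linear_image[OF lin, of "cbox (- b) b"] det by simp
  also have "\<dots> = (\<Prod>i\<in>UNIV. b $ i - (- b) $ i)"
  proof -
    have "- b \<in> cbox (- b) b" using N by (auto simp: mem_box_cart b_def)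
    then have "cbox (- b) b \<noteq> {}" by blast
    from content_cbox_cart[OF this] show ?thesis by simp
  qed
  also have "\<dots> = 16 * N ^ 3 * \<eta>" unfolding UNIV_4 b_def by (simp add: power3_eq_cube)
  finally show ?thesis .
qed

lemma norm_linear_part_le:
  assumes "d \<ge> 1"
  shows "norm (linear_part v) \<le> coeff_norm d v"
proof -
  have sub: "{(1, 0), (0, 1)} \<subseteq> coeff_index d" using assms by (auto simp: coeff_index_def)
  have "(\<Sum>p\<in>{(1, 0), (0, 1)}. \<bar>Poly_Mapping.lookup a p\<bar>\<^sup>2) \<le> (\<Sum>p\<in>coeff_index d. \<bar>Poly_Mapping.lookup a p\<bar>\<^sup>2)" for a :: "nat \<times> nat \<Rightarrow>\<^sub>0 real"
    using sub by (intro sum_mono2) auto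
  from add_mono[OF this[of "fst v"] this[of "snd v"]] show ?thesis
    unfolding norm_vec_def L2_set_def coeff_norm_def sum_4 linear_part_def
    by (intro real_sqrt_le_mono) (simp add: ac_simps)
qed

text \<open>If the trace were below N/(32 \<delta>) on all of V, the slab bound would give the
  projection volume at most N^4/(2 \<delta>), less than the required (pi^2/2) N^4/\<delta>.\<close>

lemma small_trace_points:
  fixes N \<delta> :: real
  assumes d: "d \<ge> 1" and N: "N > 0" and \<delta>: "\<delta> > 0" and V: "V \<subseteq> coeff_ball d N"
    and vol: "emeasure lebesgue (ball (0 :: real ^ 4) N) / emeasure lebesgue (linear_part ` V) \<le> ennreal \<delta>"
  shows "1 \<le> \<delta>" and "\<exists>v\<in>V. N / (32 * \<delta>) \<le> \<bar>Poly_Mapping.lookup (fst v) (1,0) + Poly_Mapping.lookup (snd v) (0,1)\<bar>"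
proof -
  define B where "B = pi\<^sup>2 / 2 * N ^ 4"
  have B: "emeasure lebesgue (ball (0 :: real ^ 4) N) = ennreal B"
    using emeasure_ball[of N "0 :: real ^ 4"] N by (simp add: unit_ball_vol_4 B_def)
  have B0: "B > 0" using N by (simp add: B_def)
  have nl: "norm (linear_part v) < N" if "v \<in> V" for v
    by (rule le_less_trans[OF norm_linear_part_le[OF d]]) (use that V in \<open>auto simp: coeff_ball_def\<close>)
  then have "linear_part ` V \<subseteq> ball 0 N" by auto
  then have le: "emeasure lebesgue (linear_part ` V) \<le> ennreal B" unfolding B[symmetric] by (intro emeasure_mono) auto
  then obtain x where x: "emeasure lebesgue (linear_part ` V) = ennreal x" "x \<ge> 0"
    by (cases "emeasure lebesgue (linear_part ` V)") (auto simp: top_unique)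
  \<comment> \<open>A positive number divided by 0 is infinite in \<open>ennreal\<close>, so the
    volume hypothesis itself forces a projection of positive measure.\<close>
  have x0: "x > 0"
  proof (rule ccontr)
    assume "\<not> x > 0"
    then have "x = 0" using x by simp
    then have "emeasure lebesgue (ball (0 :: real ^ 4) N) / emeasure lebesgue (linear_part ` V) = \<infinity>"
      using B B0 x by (simp add: ennreal_divide_zero)
    then show False using vol by (simp add: top_unique)
  qed
  have "ennreal (B / x) \<le> ennreal \<delta>" using vol unfolding B x(1) using B0 x0 by (simp add: divide_ennreal)
  then have Bx: "B \<le> \<delta> * x" using \<delta> x0 by (simp add: field_simps)
  have "x \<le> B" using le x B0 by simp
  then have "\<delta> * x \<le> \<delta> * B" using \<delta> by simp
  then have "B * 1 \<le> B * \<delta>" using Bx by (simp add: mult.commute)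
  then show "1 \<le> \<delta>" using B0 by (simp only: mult_le_cancel_left_pos)
  show "\<exists>v\<in>V. N / (32 * \<delta>) \<le> \<bar>Poly_Mapping.lookup (fst v) (1,0) + Poly_Mapping.lookup (snd v) (0,1)\<bar>"
  proof (rule ccontr)
    assume neg: "\<not> ?thesis"
    have "linear_part ` V \<subseteq> {w :: real ^ 4. (\<forall>i. \<bar>w $ i\<bar> \<le> N) \<and> \<bar>w $ 1 + w $ 4\<bar> \<le> N / (32 * \<delta>)}"
    proof (intro image_subsetI CollectI conjI allI)
      fix v and i :: 4 assume v: "v \<in> V"
      have "norm (linear_part v) \<le> N" using nl[OF v] by simp
      then show "\<bar>linear_part v $ i\<bar> \<le> N" using component_le_norm_cart[of "linear_part v" i] by simp
      show "\<bar>linear_part v $ 1 + linear_part v $ 4\<bar> \<le> N / (32 * \<delta>)" using neg v by (auto simp: linear_part_def not_le intro: less_imp_le)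
    qed
    then have "emeasure lebesgue (linear_part ` V) \<le> ennreal (16 * N ^ 3 * (N / (32 * \<delta>)))"
      using N \<delta> by (intro emeasure_slab_le) auto
    then have "x \<le> 16 * N ^ 3 * (N / (32 * \<delta>))" using x N \<delta> by simp
    then have "\<delta> * x \<le> \<delta> * (16 * N ^ 3 * (N / (32 * \<delta>)))" using \<delta> by (intro mult_left_mono) auto
    also have "\<dots> = N ^ 4 / 2" using \<delta> by (simp add: field_simps power_numeral_reduce)
    also have "\<dots> < B"
    proof -
      have "1 < pi\<^sup>2" using pi_gt3 by (simp add: one_less_power)
      then show ?thesis using N unfolding B_def by (simp add: mult_less_cancel_right2)
    qed
    finally show False using Bx by simp
  qed
qed

text \<open>Counts the half-open cells (j/(n+1), (j+1)/(n+1)] that meet \<^term>\<open>Z\<close>.\<close>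

definition cell_count :: "real set \<Rightarrow> nat \<Rightarrow> nat" where
  "cell_count Z n = card {j. j < Suc n \<and> (\<exists>z\<in>Z. real j / real (Suc n) < z \<and> z \<le> real (Suc j) / real (Suc n))}"

text \<open>A grid never overcounts, and once its mesh is below the smallest gap every point has its
  own cell. This writes a cardinality as a countable supremum, which preserves
  measurability.\<close>

lemma card_eq_SUP_cell_count:
  assumes Z: "finite Z" "Z \<subseteq> {0<..1}"
  shows "(of_nat (card Z) :: ennreal) = (SUP n. of_nat (cell_count Z n))"
proof -
  \<comment> \<open>Cells are open on the left and closed on the right, hence the ceiling minus
    1.\<close>
  define idx where "idx n z = nat (\<lceil>z * real (Suc n)\<rceil> - 1)" for n :: nat and z :: real
  have cell: "real j / real (Suc n) < z \<and> z \<le> real (Suc j) / real (Suc n) \<longleftrightarrow> j = idx n z" if "z > 0" for j n z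
  proof -
    have "z * real (Suc n) > 0" using that by simp
    then have "j = idx n z \<longleftrightarrow> \<lceil>z * real (Suc n)\<rceil> = int j + 1" unfolding idx_def by linarith
    also have "\<dots> \<longleftrightarrow> real j < z * real (Suc n) \<and> z * real (Suc n) \<le> real (Suc j)" unfolding ceiling_eq_iff by auto
    also have "\<dots> \<longleftrightarrow> real j / real (Suc n) < z \<and> z \<le> real (Suc j) / real (Suc n)"
      by (simp add: pos_divide_less_eq pos_le_divide_eq del: of_nat_Suc)
    finally show ?thesis by simp
  qed
  have lt: "idx n z < Suc n" if "z \<in> Z" for n z
  proof -
    have "z * real (Suc n) \<le> 1 * real (Suc n)" using that Z by (intro mult_right_mono) auto
    then have "\<lceil>z * real (Suc n)\<rceil> \<le> int (Suc n)" by (simp add: ceiling_le_iff)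
    then show ?thesis unfolding idx_def by linarith
  qed
  have "{j. j < Suc n \<and> (\<exists>z\<in>Z. real j / real (Suc n) < z \<and> z \<le> real (Suc j) / real (Suc n))} = idx n ` Z" for n
  proof (intro set_eqI iffI)
    fix j assume "j \<in> {j. j < Suc n \<and> (\<exists>z\<in>Z. real j / real (Suc n) < z \<and> z \<le> real (Suc j) / real (Suc n))}"
    then obtain z where z: "z \<in> Z" "real j / real (Suc n) < z \<and> z \<le> real (Suc j) / real (Suc n)" by blast
    then have "j = idx n z" using cell[of z j n] Z(2) by auto
    then show "j \<in> idx n ` Z" using z(1) by blast
  next
    fix j assume "j \<in> idx n ` Z"
    then obtain z where z: "z \<in> Z" "j = idx n z" by blast
    then have "real j / real (Suc n) < z \<and> z \<le> real (Suc j) / real (Suc n)" using cell[of z j n] Z(2) by auto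
    then show "j \<in> {j. j < Suc n \<and> (\<exists>z\<in>Z. real j / real (Suc n) < z \<and> z \<le> real (Suc j) / real (Suc n))}"
      using z lt by blast
  qed
  then have cc: "cell_count Z n = card (idx n ` Z)" for n unfolding cell_count_def by simp
  have le: "cell_count Z n \<le> card Z" for n unfolding cc by (rule card_image_le[OF Z(1)])
  have "\<exists>n. inj_on (idx n) Z"
  proof -
    define D where "D = (\<lambda>(x, y). \<bar>x - y\<bar>) ` {(x, y). x \<in> Z \<and> y \<in> Z \<and> x \<noteq> y}"
    have "finite {(x, y). x \<in> Z \<and> y \<in> Z \<and> x \<noteq> y}" by (rule finite_subset[of _ "Z \<times> Z"]) (use Z in auto)
    then have "finite D" unfolding D_def by (rule finite_imageI)
    moreover have "\<forall>r\<in>D. r > 0" unfolding D_def by auto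
    ultimately obtain r where r: "r > 0" "\<forall>q\<in>D. r \<le> q"
    proof (cases "D = {}")
      case True
      then show ?thesis using that[of 1] by simp
    next
      case False
      then show ?thesis using that[of "Min D"] \<open>finite D\<close> \<open>\<forall>r\<in>D. r > 0\<close> by simp
    qed
    obtain n where n: "1 / real (Suc n) < r" using r(1) reals_Archimedean[of r] by (auto simp: inverse_eq_divide)
    have "inj_on (idx n) Z"
    proof (rule inj_onI, rule ccontr)
      fix x y assume xy: "x \<in> Z" "y \<in> Z" "idx n x = idx n y" "x \<noteq> y"
      have "real (idx n x) / real (Suc n) < x \<and> x \<le> real (Suc (idx n x)) / real (Suc n)"
        "real (idx n x) / real (Suc n) < y \<and> y \<le> real (Suc (idx n x)) / real (Suc n)"
        using cell[of x "idx n x" n] cell[of y "idx n y" n] xy Z by auto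
      moreover have "real (Suc (idx n x)) / real (Suc n) = real (idx n x) / real (Suc n) + 1 / real (Suc n)"
        by (simp add: add_divide_distrib)
      ultimately have "\<bar>x - y\<bar> < 1 / real (Suc n)" by linarith
      moreover have "\<bar>x - y\<bar> \<in> D" unfolding D_def using xy by force
      ultimately show False using n r(2) by force
    qed
    then show ?thesis by blast
  qed
  then obtain n where "inj_on (idx n) Z" by blast
  then have "cell_count Z n = card Z" unfolding cc by (rule card_image)
  then show ?thesis using le by (intro antisym SUP_least SUP_upper2[of n]) auto
qed

section \<open>The set V in chart coordinates and measurability of the count\<close>

locale chart_body =
  fixes d :: nat and N :: real and V :: "coeffs set" and m :: nat and \<phi> :: "(nat \<Rightarrow> real) \<Rightarrow> coeffs"
    and o' :: coeffs and w :: "nat \<Rightarrow> coeffs"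
  assumes d: "2 \<le> d" and N: "0 < N" "N \<le> 1 / (40 * pi * sqrt (real d))"
    and V: "V \<subseteq> coeff_ball d N" "convex V" "V \<noteq> {}"
    and chart: "isometric_chart d (affine hull V) m \<phi>"
    and w: "orthonormal d m w"
    and \<phi>: "\<And>x. x \<in> {..<m} \<rightarrow>\<^sub>E UNIV \<Longrightarrow> \<phi> x = o' + (\<Sum>j<m. x j *\<^sub>R w j)"
    and o': "o' \<in> affine hull V" and o'w: "\<And>j. j < m \<Longrightarrow> o' + w j \<in> affine hull V"
begin

abbreviation E :: "(nat \<Rightarrow> real) set" where "E \<equiv> {..<m} \<rightarrow>\<^sub>E UNIV"

definition K :: "(nat \<Rightarrow> real) set" where "K = {x \<in> E. \<phi> x \<in> V}"

lemma \<phi>_image: "\<phi> ` E = affine hull V" using chart by (simp add: isometric_chart_def)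

lemma \<phi>_inj: "inj_on \<phi> E"
proof (rule inj_onI)
  fix x y assume xy: "x \<in> E" "y \<in> E" "\<phi> x = \<phi> y"
  have "coeff_norm d (\<phi> x - \<phi> y) = L2_set (\<lambda>j. x j - y j) {..<m}" using chart xy unfolding isometric_chart_def by blast
  then have "L2_set (\<lambda>j. x j - y j) {..<m} = 0" using xy(3) by (simp add: coeff_norm_eq_sqrt)
  then have "\<forall>j<m. x j = y j" by (simp add: L2_set_eq_0_iff)
  then show "x = y" using xy(1,2) by (intro PiE_ext[of x "{..<m}" "\<lambda>_. UNIV"]) auto
qed

lemma coeff_vec_\<phi>: "x \<in> E \<Longrightarrow> coeff_vec (\<phi> x) i = coeff_vec o' i + (\<Sum>j<m. x j * coeff_vec (w j) i)"
  using \<phi> by simp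

lemma \<phi>_homothety:
  assumes "x \<in> E" "y \<in> E"
  shows "\<phi> (homothety m t x y) = (1 - t) *\<^sub>R \<phi> x + t *\<^sub>R \<phi> y"
proof -
  have "(\<Sum>j<m. homothety m t x y j *\<^sub>R w j) = (1 - t) *\<^sub>R (\<Sum>j<m. x j *\<^sub>R w j) + t *\<^sub>R (\<Sum>j<m. y j *\<^sub>R w j)"
    unfolding scaleR_sum_right sum.distrib[symmetric]
    by (rule sum.cong) (auto simp: homothety_def algebra_simps)
  then have "\<phi> (homothety m t x y) = o' + ((1 - t) *\<^sub>R (\<Sum>j<m. x j *\<^sub>R w j) + t *\<^sub>R (\<Sum>j<m. y j *\<^sub>R w j))"
    unfolding \<phi>[OF homothety_in] by (rule arg_cong)
  also have "\<dots> = (1 - t) *\<^sub>R (o' + (\<Sum>j<m. x j *\<^sub>R w j)) + t *\<^sub>R (o' + (\<Sum>j<m. y j *\<^sub>R w j))"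
    by (simp add: scaleR_add_right scaleR_diff_left)
  finally show ?thesis unfolding \<phi>[OF assms(1)] \<phi>[OF assms(2)] .
qed

lemma coeff_norm_\<phi>_less: "x \<in> K \<Longrightarrow> coeff_norm d (\<phi> x) < N"
  using V(1) by (auto simp: K_def coeff_ball_def)

lemma small_fieldI:
  assumes "coeff_norm d v \<le> N" shows "small_field d v"
proof
  show "1 \<le> d" using d by simp
  have "sqrt (real d) * coeff_norm d v \<le> sqrt (real d) * (1 / (40 * pi * sqrt (real d)))"
    using assms N by (intro mult_left_mono) auto
  also have "\<dots> = 1 / (40 * pi)" using d by simp
  finally show "sqrt (real d) * coeff_norm d v \<le> 1 / (40 * pi)" .
qed

lemma abs_coeff_vec_le: "i \<in> coeff_index2 d \<Longrightarrow> \<bar>coeff_vec v i\<bar> \<le> coeff_norm d v"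
  using lookup_le_coeff_norm[of _ d v] by (cases v) (auto simp: coeff_vec_def)

text \<open>The directions \<open>w j\<close> are differences of points of the affine hull, hence
  lie in the span of V - v0, so V contains a box spanned by them. Boundedness holds because the
  chart is isometric and V lies in a ball.\<close>

lemma chart_convex_body: "\<exists>p0 \<epsilon> R. convex_body m K p0 \<epsilon> R"
proof -
  obtain v0 where v0: "v0 \<in> V" using V(3) by blast
  have "w j \<in> span ((\<lambda>v. v - v0) ` V)" if "j < m" for j
  proof -
    have sub: "(\<lambda>x. - v0 + x) ` (V - {v0}) \<subseteq> (\<lambda>v. v - v0) ` V" by auto
    have "u - v0 \<in> span ((\<lambda>v. v - v0) ` V)" if u: "u \<in> affine hull V" for u
    proof -
      obtain s where "u = v0 + s" "s \<in> span ((\<lambda>x. - v0 + x) ` (V - {v0}))"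
        using u unfolding affine_hull_span2[OF v0] by blast
      then show ?thesis using span_mono[OF sub] by auto
    qed
    from span_diff[OF this[OF o'w[OF that]] this[OF o']] show ?thesis by simp
  qed
  then obtain p \<epsilon> where p: "p \<in> V" "\<epsilon> > 0" "\<And>c. (\<forall>j\<in>{..<m}. \<bar>c j\<bar> \<le> \<epsilon>) \<Longrightarrow> p + (\<Sum>j<m. c j *\<^sub>R w j) \<in> V"
    using convex_inner_box[OF V(2) v0 finite_lessThan[of m], of w] by blast
  have "p \<in> affine hull V" using p(1) by (rule hull_inc)
  then obtain p0 where p0: "p0 \<in> E" "\<phi> p0 = p" unfolding \<phi>_image[symmetric] by blast
  define B where "B = (\<Sum>i\<in>coeff_index2 d. (N + \<bar>coeff_vec o' i\<bar>)\<^sup>2)"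
  have "convex_body m K p0 \<epsilon> (B + 1)"
  proof
    show "K \<subseteq> E" by (auto simp: K_def)
    fix x y t assume "x \<in> K" "y \<in> K" "0 \<le> t" "t \<le> (1::real)"
    then show "homothety m t x y \<in> K" using convexD[OF V(2), of "\<phi> x" "\<phi> y" "1 - t" t] unfolding K_def by (simp add: \<phi>_homothety)
  next
    fix q assume q: "q \<in> E" "\<And>j. j < m \<Longrightarrow> \<bar>q j - p0 j\<bar> \<le> \<epsilon>"
    have "\<phi> q = \<phi> p0 + (\<Sum>j<m. (q j - p0 j) *\<^sub>R w j)"
      unfolding \<phi>[OF q(1)] \<phi>[OF p0(1)] by (simp add: scaleR_diff_left sum_subtractf)
    then show "q \<in> K" using p(3)[of "\<lambda>j. q j - p0 j"] q unfolding K_def p0(2) by simp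
  next
    fix x j assume x: "x \<in> K" and j: "j < m"
    have xE: "x \<in> E" using x by (simp add: K_def)
    have eq: "\<phi> x - o' = (\<Sum>j<m. x j *\<^sub>R w j)" unfolding \<phi>[OF xE] by simp
    have "(x j)\<^sup>2 \<le> (\<Sum>j<m. (x j)\<^sup>2)" using j by (intro member_le_sum) auto
    also have "\<dots> = coeff_inner d (\<phi> x - o') (\<phi> x - o')" unfolding eq orthonormal_comb_inner(2)[OF w] ..
    also have "\<dots> \<le> B"
      unfolding B_def coeff_inner_def
    proof (rule sum_mono)
      fix i assume i: "i \<in> coeff_index2 d"
      have "\<bar>coeff_vec (\<phi> x - o') i\<bar> \<le> N + \<bar>coeff_vec o' i\<bar>"
        using abs_coeff_vec_le[OF i, of "\<phi> x"] coeff_norm_\<phi>_less[OF x] by simp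
      then have "\<bar>coeff_vec (\<phi> x - o') i\<bar>\<^sup>2 \<le> (N + \<bar>coeff_vec o' i\<bar>)\<^sup>2" by (intro power_mono) auto
      then show "coeff_vec (\<phi> x - o') i * coeff_vec (\<phi> x - o') i \<le> (N + \<bar>coeff_vec o' i\<bar>)\<^sup>2"
        by (simp only: power2_abs power2_eq_square[of "coeff_vec (\<phi> x - o') i"])
    qed
    finally have xB: "\<bar>x j\<bar>\<^sup>2 \<le> B" by simp
    \<comment> \<open>The bound covers both cases |x j| <= 1 and |x j| <= |x j|^2 without a square
      root.\<close>
    show "\<bar>x j\<bar> \<le> B + 1"
    proof (cases "\<bar>x j\<bar> \<le> 1")
      case True
      then show ?thesis using xB zero_le_power2[of "\<bar>x j\<bar>"] by linarith
    next
      case False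
      then have "\<bar>x j\<bar> * 1 \<le> \<bar>x j\<bar> * \<bar>x j\<bar>" by (intro mult_left_mono) auto
      then show ?thesis using xB by (simp add: power2_eq_square)
    qed
  qed (use p in auto)
  then show ?thesis by blast
qed

lemma coeff_dist1_eq: "coeff_dist1 d u v = (\<Sum>i\<in>coeff_index2 d. \<bar>coeff_vec u i - coeff_vec v i\<bar>)"
  by (subst sum.Plus) (auto simp: coeff_dist1_def coeff_vec_def)

text \<open>Norm bound and interval are closed conditions, so that the limit theorem for orbit
  crossings shows the set to be sequentially closed when a > 0.\<close>

definition orbit_set :: "real \<Rightarrow> real \<Rightarrow> (nat \<Rightarrow> real) set" where
  "orbit_set a b = {x \<in> E. coeff_norm d (\<phi> x) \<le> N \<and> (\<exists>z\<in>orbit_pts d (\<phi> x). a \<le> z \<and> z \<le> b)}"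

lemma orbit_set_measurable:
  assumes a: "0 < a"
  shows "orbit_set a b \<in> sets (lborel_n m)"
proof (rule seq_closed_measurable)
  show "orbit_set a b \<subseteq> E" by (auto simp: orbit_set_def)
  fix X l assume X: "\<And>n. X n \<in> orbit_set a b" and l: "l \<in> E" and lim: "\<And>j. j < m \<Longrightarrow> (\<lambda>n. X n j) \<longlonglongrightarrow> l j"
  have XE: "X n \<in> E" and Xn: "coeff_norm d (\<phi> (X n)) \<le> N" and Xo: "\<exists>z\<in>orbit_pts d (\<phi> (X n)). a \<le> z \<and> z \<le> b" for n
    using X[of n] by (auto simp: orbit_set_def)
  have cv: "(\<lambda>n. coeff_vec (\<phi> (X n)) i) \<longlonglongrightarrow> coeff_vec (\<phi> l) i" for i
    unfolding coeff_vec_\<phi>[OF XE] coeff_vec_\<phi>[OF l] by (intro tendsto_intros) (use lim in auto)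
  have "(\<lambda>n. coeff_dist1 d (\<phi> (X n)) (\<phi> l)) \<longlonglongrightarrow> (\<Sum>i\<in>coeff_index2 d. \<bar>coeff_vec (\<phi> l) i - coeff_vec (\<phi> l) i\<bar>)"
    unfolding coeff_dist1_eq by (intro tendsto_intros cv)
  then have d0: "(\<lambda>n. coeff_dist1 d (\<phi> (X n)) (\<phi> l)) \<longlonglongrightarrow> 0" by simp
  have "(\<lambda>n. coeff_norm d (\<phi> (X n))) \<longlonglongrightarrow> coeff_norm d (\<phi> l)"
    unfolding coeff_norm_eq_sqrt coeff_inner_def by (intro tendsto_intros cv)
  then have ln: "coeff_norm d (\<phi> l) \<le> N" by (rule LIMSEQ_le_const2) (use Xn in auto)
  have "\<exists>z\<in>orbit_pts d (\<phi> l). a \<le> z \<and> z \<le> b"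
    by (rule orbit_pts_closed[OF small_fieldI[OF Xn] small_fieldI[OF ln] d0 a Xo])
  then show "l \<in> orbit_set a b" using l ln by (simp add: orbit_set_def)
qed

text \<open>A measurable stand-in for the number of limit cycles: each half-open grid cell is a
  countable union of compact intervals with positive left end, including the cell j = 0.\<close>

definition orbit_count :: "(nat \<Rightarrow> real) \<Rightarrow> ennreal" where
  "orbit_count x = (SUP n. \<Sum>j<Suc n. indicator (\<Union>k. orbit_set (real j / real (Suc n) + 1 / real (Suc k)) (real (Suc j) / real (Suc n))) x)"

lemma orbit_count_measurable: "orbit_count \<in> borel_measurable (lborel_n m)"
proof -
  have "(\<Union>k. orbit_set (real j / real (Suc n) + 1 / real (Suc k)) (real (Suc j) / real (Suc n))) \<in> sets (lborel_n m)" for j n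
    by (intro sets.countable_UN image_subsetI orbit_set_measurable add_nonneg_pos) auto
  then show ?thesis unfolding orbit_count_def
    by (intro borel_measurable_SUP borel_measurable_sum borel_measurable_indicator) auto
qed

definition tr_at :: "(nat \<Rightarrow> real) \<Rightarrow> real" where
  "tr_at x = coeff_vec (\<phi> x) (Inl (1, 0)) + coeff_vec (\<phi> x) (Inr (0, 1))"

lemma tr_at_tr: "x \<in> K \<Longrightarrow> small_field.tr (\<phi> x) = tr_at x"
  using small_field.tr_def[OF small_fieldI[OF less_imp_le[OF coeff_norm_\<phi>_less]]] by (simp add: tr_at_def coeff_vec_def)

lemma tr_at_measurable: "tr_at \<in> borel_measurable (lborel_n m)"
proof -
  have "tr_at \<in> borel_measurable (lborel_n m) \<longleftrightarrow>
    (\<lambda>x. (coeff_vec o' (Inl (1, 0)) + (\<Sum>j<m. x j * coeff_vec (w j) (Inl (1, 0)))) +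
         (coeff_vec o' (Inr (0, 1)) + (\<Sum>j<m. x j * coeff_vec (w j) (Inr (0, 1))))) \<in> borel_measurable (lborel_n m)"
    by (rule measurable_cong) (simp add: tr_at_def coeff_vec_\<phi> space_lborel_n)
  also have "\<dots>"
  proof -
    have [measurable]: "(\<lambda>x. x j) \<in> borel_measurable (lborel_n m)" if "j \<in> {..<m}" for j
      using measurable_component_singleton[OF that, of "\<lambda>_. lborel :: real measure"] by simp
    show ?thesis by (intro borel_measurable_add borel_measurable_sum borel_measurable_times borel_measurable_const) measurable
  qed
  finally show ?thesis .
qed

lemma tr_at_affine: "x \<in> E \<Longrightarrow> y \<in> E \<Longrightarrow> tr_at (homothety m t x y) = (1 - t) * tr_at x + t * tr_at y"
  by (simp add: tr_at_def \<phi>_homothety algebra_simps)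

text \<open>For nonzero trace, limit cycles correspond to crossings, so both counts agree pointwise;
  where the trace vanishes they may differ, which later costs only a null set.\<close>

lemma num_limit_cycles_chart:
  assumes x: "x \<in> K" and tr: "tr_at x \<noteq> 0"
  shows "num_limit_cycles d (\<phi> x) = orbit_count x"
    and "num_limit_cycles d (\<phi> x) \<le> ennreal (3 * ln (13 * sqrt (real d) * N / \<bar>tr_at x\<bar>))"
proof -
  have cn: "coeff_norm d (\<phi> x) < N" by (rule coeff_norm_\<phi>_less[OF x])
  interpret small_field d "\<phi> x" by (rule small_fieldI) (use cn in simp)
  have tr': "tr \<noteq> 0" using tr_at_tr[OF x] tr by simp
  have Z: "finite (orbit_pts d (\<phi> x))" by (rule orbit_pts_card_le(1)[OF tr'])
  have Zs: "orbit_pts d (\<phi> x) \<subseteq> {0<..1}" using orbit_pts_sub by force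
  have "x \<in> (\<Union>k. orbit_set (real j / real (Suc n) + 1 / real (Suc k)) (real (Suc j) / real (Suc n))) \<longleftrightarrow>
     (\<exists>z\<in>orbit_pts d (\<phi> x). real j / real (Suc n) < z \<and> z \<le> real (Suc j) / real (Suc n))" (is "?L \<longleftrightarrow> ?R") for j n
  proof
    assume ?L
    then obtain k z where z: "z \<in> orbit_pts d (\<phi> x)" "real j / real (Suc n) + 1 / real (Suc k) \<le> z" "z \<le> real (Suc j) / real (Suc n)"
      unfolding orbit_set_def by blast
    moreover have "1 / real (Suc k) > 0" by simp
    ultimately have "real j / real (Suc n) < z" by linarith
    then show ?R using z by blast
  next
    assume ?R
    then obtain z where z: "z \<in> orbit_pts d (\<phi> x)" "real j / real (Suc n) < z" "z \<le> real (Suc j) / real (Suc n)" by blast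
    have "z - real j / real (Suc n) > 0" using z by linarith
    then obtain k where "inverse (real (Suc k)) < z - real j / real (Suc n)" using reals_Archimedean by blast
    then have "real j / real (Suc n) + 1 / real (Suc k) \<le> z" by (simp add: inverse_eq_divide del: of_nat_Suc)
    moreover have "x \<in> E" using x by (simp add: K_def)
    ultimately show ?L unfolding orbit_set_def using z cn by (blast intro: less_imp_le)
  qed
  then have "(\<Sum>j<Suc n. indicator (\<Union>k. orbit_set (real j / real (Suc n) + 1 / real (Suc k)) (real (Suc j) / real (Suc n))) x :: ennreal)
    = (\<Sum>j<Suc n. if \<exists>z\<in>orbit_pts d (\<phi> x). real j / real (Suc n) < z \<and> z \<le> real (Suc j) / real (Suc n) then 1 else 0)" for n
    unfolding indicator_def of_bool_def by (simp only:)
  also have "\<dots> n = of_nat (cell_count (orbit_pts d (\<phi> x)) n)" for n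
  proof -
    have "{j. j < Suc n \<and> (\<exists>z\<in>orbit_pts d (\<phi> x). real j / real (Suc n) < z \<and> z \<le> real (Suc j) / real (Suc n))}
      = {..<Suc n} \<inter> {j. \<exists>z\<in>orbit_pts d (\<phi> x). real j / real (Suc n) < z \<and> z \<le> real (Suc j) / real (Suc n)}" by auto
    then show ?thesis unfolding cell_count_def by (simp only: sum.If_cases[OF finite_lessThan]) simp
  qed
  finally have "orbit_count x = (SUP n. of_nat (cell_count (orbit_pts d (\<phi> x)) n))" unfolding orbit_count_def by (simp only:)
  also have "\<dots> = of_nat (card (orbit_pts d (\<phi> x)))" by (rule card_eq_SUP_cell_count[OF Z Zs, symmetric])
  finally show "num_limit_cycles d (\<phi> x) = orbit_count x" using num_limit_cycles_eq[OF tr'] by simp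
  have "real (card (orbit_pts d (\<phi> x))) \<le> 3 * ln (13 * \<kappa> / (2 * \<bar>tr\<bar>))" by (rule orbit_pts_card_le(2)[OF tr'])
  also have "\<dots> \<le> 3 * ln (13 * sqrt (real d) * N / \<bar>tr_at x\<bar>)"
  proof -
    have "13 * \<kappa> / (2 * \<bar>tr\<bar>) = 13 * sqrt (real d) * coeff_norm d (\<phi> x) / \<bar>tr_at x\<bar>"
      by (simp add: tr_at_tr[OF x])
    moreover have "13 * sqrt (real d) * coeff_norm d (\<phi> x) / \<bar>tr_at x\<bar> \<le> 13 * sqrt (real d) * N / \<bar>tr_at x\<bar>"
      using cn by (intro divide_right_mono mult_left_mono) auto
    \<comment> \<open>Monotonicity of ln is used between positive arguments; a zero norm would force
      a zero trace.\<close>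
    moreover have "13 * sqrt (real d) * coeff_norm d (\<phi> x) / \<bar>tr_at x\<bar> > 0"
    proof -
      have "coeff_norm d (\<phi> x) \<noteq> 0"
      proof
        assume "coeff_norm d (\<phi> x) = 0"
        moreover have "Inl (1, 0) \<in> coeff_index2 d" "Inr (0, 1) \<in> coeff_index2 d" using d by (auto simp: coeff_index_def)
        ultimately show False using tr abs_coeff_vec_le[of _ "\<phi> x"] unfolding tr_at_def by (metis abs_le_zero_iff add.left_neutral)
      qed
      then show ?thesis using d tr by (simp add: less_le)
    qed
    ultimately show ?thesis by simp
  qed
  finally show "num_limit_cycles d (\<phi> x) \<le> ennreal (3 * ln (13 * sqrt (real d) * N / \<bar>tr_at x\<bar>))"
    unfolding num_limit_cycles_eq[OF tr'] ennreal_of_nat_eq_real_of_nat by (rule ennreal_leI)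
qed

end

context chart_body
begin

text \<open>Everything is pulled back along the chart, where V has the same measure as its closure
  and the pointwise logarithmic bound can be integrated against the product measure.\<close>

lemma mean_num_limit_cycles_le:
  fixes \<delta> :: real
  assumes \<delta>: "1 \<le> \<delta>" and v: "v \<in> V"
    and tv: "N / (32 * \<delta>) \<le> \<bar>Poly_Mapping.lookup (fst v) (1,0) + Poly_Mapping.lookup (snd v) (0,1)\<bar>"
  defines "M \<equiv> embed_measure (completion (lborel_n m)) \<phi>"
  shows "(\<lambda>v. num_limit_cycles d v * indicator V v) \<in> borel_measurable M"
    and "(\<integral>\<^sup>+v\<in>V. num_limit_cycles d v \<partial>M) / emeasure M V \<le> ennreal (60 * (ln \<delta> + ln (real d)))"
proof -
  obtain p0 \<epsilon> R where body: "convex_body m K p0 \<epsilon> R" using chart_convex_body by blast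
  have "v \<in> affine hull V" using v by (rule hull_inc)
  then obtain p where p: "p \<in> E" "\<phi> p = v" unfolding \<phi>_image[symmetric] by blast
  define s where "s = d * (d + 3)"
  define L where "L = N / (32 * \<delta>)"
  define M0 where "M0 = 13 * sqrt (real d) * N"
  have L: "L > 0" using N \<delta> by (simp add: L_def)
  have M0: "M0 > 0" using N d by (simp add: M0_def)
  interpret convex_body_affine m K p0 \<epsilon> R tr_at p s L
  proof (intro convex_body_affine.intro body convex_body_affine_axioms.intro)
    show "p \<in> K" using p v by (simp add: K_def)
    show "L \<le> \<bar>tr_at p\<bar>" using tv by (simp add: tr_at_def p(2) coeff_vec_def L_def)
    show "m \<le> s" unfolding s_def by (rule orthonormal_card_le[OF w])
    show "1 \<le> s" using d by (simp add: s_def)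
  qed (fact tr_at_measurable tr_at_affine L)+
  let ?P = "lborel_n m"
  let ?Q = "completion (lborel_n m)"
  have spQ: "space ?Q = E" by (simp add: space_lborel_n)
  have inj: "inj_on \<phi> (space ?Q)" unfolding spQ by (rule \<phi>_inj)
  define F where "F x = num_limit_cycles d (\<phi> x) * indicator V (\<phi> x)" for x
  define H where "H x = orbit_count x * indicator K x" for x
  define Z where "Z = {x \<in> C. tr_at x = 0}"
  have Z: "Z \<in> null_sets ?P" unfolding Z_def by (rule kernel_null)
  have FH: "F x = H x" if "x \<in> E" "x \<notin> Z" for x
  proof (cases "x \<in> K")
    case True
    then have "tr_at x \<noteq> 0" using that K_sub_C by (auto simp: Z_def)
    then show ?thesis using True num_limit_cycles_chart(1)[OF True] by (simp add: F_def H_def K_def)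
  next
    case False
    then show ?thesis using that by (simp add: F_def H_def K_def)
  qed
  have Hm: "H \<in> borel_measurable ?Q"
    unfolding H_def
    by (intro borel_measurable_times_ennreal measurable_completion[OF orbit_count_measurable] borel_measurable_indicator K_completion(1))
  \<comment> \<open>Completeness is essential: inside the null set \<open>Z\<close> the preimage may
    be an arbitrary set.\<close>
  have Fm: "F \<in> borel_measurable ?Q"
  proof (rule measurableI)
    fix A :: "ennreal set" assume A: "A \<in> sets borel"
    have "F -` A \<inter> space ?Q = ((H -` A \<inter> space ?Q) - Z) \<union> (F -` A \<inter> space ?Q \<inter> Z)"
      using FH unfolding spQ by auto
    also have "\<dots> \<in> sets ?Q"
    proof (intro sets.Un sets.Diff measurable_sets[OF Hm A])
      show "Z \<in> sets ?Q" using Z by (intro sets_completionI_sets) auto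
      show "F -` A \<inter> space ?Q \<inter> Z \<in> sets ?Q" by (rule sets_completionI_sub[OF Z]) auto
    qed
    finally show "F -` A \<inter> space ?Q \<in> sets ?Q" .
  qed simp
  show meas: "(\<lambda>v. num_limit_cycles d v * indicator V v) \<in> borel_measurable M"
    unfolding M_def by (rule measurable_embed_measure1) (use Fm in \<open>simp add: F_def[abs_def]\<close>)
  have KV: "\<phi> ` K = V"
  proof
    show "V \<subseteq> \<phi> ` K"
    proof
      fix u assume u: "u \<in> V"
      then have "u \<in> \<phi> ` E" unfolding \<phi>_image by (rule hull_inc)
      then show "u \<in> \<phi> ` K" using u by (auto simp: K_def)
    qed
    show "\<phi> ` K \<subseteq> V"
    proof (rule image_subsetI)
      fix x assume "x \<in> K"
      then show "\<phi> x \<in> V" by (simp add: K_def)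
    qed
  qed
  have eV: "emeasure M V = emeasure ?P C"
  proof -
    have "emeasure M (\<phi> ` K) = emeasure ?P C"
      unfolding M_def emeasure_embed_measure_image'[OF inj K_completion(1)] by (rule K_completion(2))
    then show ?thesis unfolding KV .
  qed
  have "(\<integral>\<^sup>+v\<in>V. num_limit_cycles d v \<partial>M) = (\<integral>\<^sup>+x. F x \<partial>?P)"
    using nn_integral_embed_measure'[OF inj meas[unfolded M_def]] unfolding M_def F_def nn_integral_completion .
  also have "\<dots> \<le> (\<integral>\<^sup>+x. 3 * (ennreal (ln (M0 / \<bar>tr_at x\<bar>)) * indicator C x) \<partial>?P)"
  proof (rule nn_integral_mono_AE)
    have "AE x in ?P. x \<notin> Z" by (rule AE_not_in[OF Z])
    then show "AE x in ?P. F x \<le> 3 * (ennreal (ln (M0 / \<bar>tr_at x\<bar>)) * indicator C x)"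
    proof (rule AE_mp, intro AE_I2 impI)
      fix x assume x: "x \<in> space ?P" "x \<notin> Z"
      show "F x \<le> 3 * (ennreal (ln (M0 / \<bar>tr_at x\<bar>)) * indicator C x)"
      proof (cases "x \<in> K")
        case True
        then have xC: "x \<in> C" using K_sub_C by blast
        then have "tr_at x \<noteq> 0" using x by (auto simp: Z_def)
        then have "num_limit_cycles d (\<phi> x) \<le> ennreal (3 * ln (M0 / \<bar>tr_at x\<bar>))"
          using num_limit_cycles_chart(2)[OF True] by (simp add: M0_def)
        also have "\<dots> = 3 * ennreal (ln (M0 / \<bar>tr_at x\<bar>))" by (simp add: ennreal_mult')
        finally show ?thesis using True xC by (simp add: F_def K_def)
      next
        case False
        then show ?thesis using x(1) by (simp add: F_def K_def space_lborel_n)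
      qed
    qed
  qed
  also have "\<dots> = 3 * (\<integral>\<^sup>+x\<in>C. ennreal (ln (M0 / \<bar>tr_at x\<bar>)) \<partial>?P)"
  proof (rule nn_integral_cmult)
    note tr_at_measurable[measurable] coord_closure_measurable[measurable]
    show "(\<lambda>x. ennreal (ln (M0 / \<bar>tr_at x\<bar>)) * indicator C x) \<in> borel_measurable ?P" by measurable
  qed
  also have "\<dots> \<le> 3 * (ennreal (ln (8 * real s * M0 / L) + 2) * emeasure ?P C)"
  proof (intro mult_left_mono log_integral_le)
    have "L \<le> N * 1" using \<delta> N unfolding L_def by (simp add: divide_le_eq)
    also have "\<dots> \<le> 8 * real s * M0"
    proof -
      have "1 \<le> 8 * real s" using s(2) by simp
      moreover have "1 \<le> sqrt (real d)" using d by simp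
      then have "1 \<le> 13 * sqrt (real d)" by linarith
      ultimately have "1 * 1 \<le> 8 * real s * (13 * sqrt (real d))" by (intro mult_mono) auto
      then have "1 \<le> 8 * real s * (13 * sqrt (real d))" by simp
      from mult_left_mono[OF this, of N] show ?thesis using N by (simp add: M0_def ac_simps)
    qed
    finally show "L / (8 * real s) \<le> M0" using s(2) by (simp add: divide_le_eq ac_simps)
  qed simp
  also have "\<dots> = ennreal (3 * (ln (8 * real s * M0 / L) + 2)) * emeasure ?P C"
  proof -
    have "ennreal (3 * y) = 3 * ennreal y" for y by (simp add: ennreal_mult')
    then show ?thesis by (simp only: mult.assoc)
  qed
  also have "\<dots> \<le> ennreal (60 * (ln \<delta> + ln (real d))) * emeasure ?P C"
  proof (intro mult_right_mono ennreal_leI)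
    have d2: "real d \<ge> 2" using d by simp
    \<comment> \<open>Here 3328 = 8 * 13 * 32; then d + 3 <= 4 d and sqrt d <= d give 13312 d^3, and
      13312 <= 2^14 <= d^14.\<close>
    have "8 * real s * M0 / L = 3328 * \<delta> * (real d * (real d + 3) * sqrt (real d))"
      using N \<delta> by (simp add: M0_def L_def s_def)
    also have "\<dots> \<le> 3328 * \<delta> * (real d * (4 * real d) * real d)"
    proof (intro mult_left_mono mult_mono)
      show "sqrt (real d) \<le> real d" using d2 by (intro real_le_lsqrt) (auto simp: power2_eq_square)
    qed (use d2 \<delta> in auto)
    also have "\<dots> = 13312 * (\<delta> * real d ^ 3)" by (simp add: power3_eq_cube)
    also have "\<dots> \<le> real d ^ 14 * (\<delta> * real d ^ 3)"
    proof (intro mult_right_mono)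
      have "(13312::real) \<le> 2 ^ 14" by simp
      also have "\<dots> \<le> real d ^ 14" using d2 by (intro power_mono) auto
      finally show "13312 \<le> real d ^ 14" .
    qed (use \<delta> in auto)
    also have "\<dots> = \<delta> * real d ^ 17" by (simp flip: power_add)
    finally have le: "8 * real s * M0 / L \<le> \<delta> * real d ^ 17" .
    have "8 * real s * M0 / L > 0" using L M0 s(2) by simp
    then have "ln (8 * real s * M0 / L) \<le> ln (\<delta> * real d ^ 17)" using le by (intro ln_mono) auto
    also have "\<dots> = ln \<delta> + 17 * ln (real d)" using \<delta> d2 by (simp add: ln_mult ln_realpow)
    finally have l1: "ln (8 * real s * M0 / L) \<le> ln \<delta> + 17 * ln (real d)" .
    \<comment> \<open>Since d >= 2, the additive 2 is absorbed by 3 ln d; the coefficient 3 * (17 +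
      3) = 60 of ln d is the final constant.\<close>
    have "2 / 3 \<le> ln (2::real)" by (rule ln2_ge_two_thirds)
    also have "\<dots> \<le> ln (real d)" using d2 by (intro ln_mono) auto
    finally have "2 \<le> 3 * ln (real d)" by simp
    moreover have "ln \<delta> \<ge> 0" using \<delta> by simp
    ultimately show "3 * (ln (8 * real s * M0 / L) + 2) \<le> 60 * (ln \<delta> + ln (real d))" using l1 by argo
  qed simp
  finally have "(\<integral>\<^sup>+v\<in>V. num_limit_cycles d v \<partial>M) \<le> ennreal (60 * (ln \<delta> + ln (real d))) * emeasure ?P C" .
  then show "(\<integral>\<^sup>+v\<in>V. num_limit_cycles d v \<partial>M) / emeasure M V \<le> ennreal (60 * (ln \<delta> + ln (real d)))"
    unfolding eV using emeasure_C_pos by (intro divide_le_posI_ennreal) (auto simp: mult.commute)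
qed

end

text \<open>Measurability belongs to the conclusion so that the nonnegative integral has its usual
  meaning. The conversion to \<open>ennreal\<close> hides no negative bound, because the volume
  hypothesis forces \<delta> >= 1.\<close>

theorem corollary1p4:
  shows "\<exists>c::real. c > 0 \<and>
    (\<forall>(d::nat) (N::real) (\<delta>::real) (V::coeffs set).
       2 \<le> d \<longrightarrow> 0 < N \<longrightarrow> N \<le> 1 / (40 * pi * sqrt (real d)) \<longrightarrow> 0 < \<delta> \<longrightarrow>
       V \<subseteq> coeff_ball d N \<longrightarrow> convex V \<longrightarrow>
       emeasure lebesgue (ball (0 :: real ^ 4) N) / emeasure lebesgue (linear_part ` V) \<le> ennreal \<delta> \<longrightarrow>
       (\<lambda>v. num_limit_cycles d v * indicator V v) \<in> borel_measurable (affine_lebesgue d (affine hull V)) \<and>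
       (\<integral>\<^sup>+v\<in>V. num_limit_cycles d v \<partial>affine_lebesgue d (affine hull V))
           / emeasure (affine_lebesgue d (affine hull V)) V
         \<le> ennreal (c * (ln \<delta> + ln (real d))))"
proof (intro exI[of _ 60] conjI allI impI)
  fix d :: nat and N \<delta> :: real and V :: "coeffs set"
  assume d: "2 \<le> d" and N: "0 < N" "N \<le> 1 / (40 * pi * sqrt (real d))" and \<delta>: "0 < \<delta>"
    and V: "V \<subseteq> coeff_ball d N" "convex V"
    and vol: "emeasure lebesgue (ball (0 :: real ^ 4) N) / emeasure lebesgue (linear_part ` V) \<le> ennreal \<delta>"
  have d1: "1 \<le> d" using d by simp
  have \<delta>1: "1 \<le> \<delta>" by (rule small_trace_points(1)[OF d1 N(1) \<delta> V(1) vol])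
  obtain v where v: "v \<in> V" "N / (32 * \<delta>) \<le> \<bar>Poly_Mapping.lookup (fst v) (1,0) + Poly_Mapping.lookup (snd v) (0,1)\<bar>"
    using small_trace_points(2)[OF d1 N(1) \<delta> V(1) vol] by blast
  have hull: "affine hull V \<subseteq> coeff_space d"
    by (rule hull_minimal) (use V(1) in \<open>auto simp: coeff_ball_def intro: subspace_imp_affine subspace_coeff_space\<close>)
  have "affine hull V \<noteq> {}" using v(1) by auto
  then have ex: "\<exists>p. case p of (m, \<phi>) \<Rightarrow> isometric_chart d (affine hull V) m \<phi>"
    using isometric_chart_exists[OF affine_affine_hull _ hull] by auto
  \<comment> \<open>The estimate holds for every isometric chart, so it applies to whichever one the
    definition selects.\<close>
  obtain m \<phi> where some: "(SOME (m, \<phi>). isometric_chart d (affine hull V) m \<phi>) = (m, \<phi>)"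
    by (cases "SOME (m, \<phi>). isometric_chart d (affine hull V) m \<phi>")
  have chart: "isometric_chart d (affine hull V) m \<phi>" using someI_ex[OF ex] unfolding some by simp
  have M: "affine_lebesgue d (affine hull V) = embed_measure (completion (lborel_n m)) \<phi>"
    unfolding affine_lebesgue_def some by simp
  obtain o' w where *: "o' \<in> affine hull V" "orthonormal d m w"
    "\<And>x. x \<in> {..<m} \<rightarrow>\<^sub>E UNIV \<Longrightarrow> \<phi> x = o' + (\<Sum>j<m. x j *\<^sub>R w j)" "\<And>j. j < m \<Longrightarrow> o' + w j \<in> affine hull V"
    by (rule isometric_chart_affine[OF chart hull]) (rule that, assumption+)
  interpret chart_body d N V m \<phi> o' w
    by unfold_locales (use d N V v(1) chart * in auto)
  show "(\<lambda>v. num_limit_cycles d v * indicator V v) \<in> borel_measurable (affine_lebesgue d (affine hull V))"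
    unfolding M by (rule mean_num_limit_cycles_le(1)[OF \<delta>1 v])
  show "(\<integral>\<^sup>+v\<in>V. num_limit_cycles d v \<partial>affine_lebesgue d (affine hull V)) / emeasure (affine_lebesgue d (affine hull V)) V
    \<le> ennreal (60 * (ln \<delta> + ln (real d)))"
    unfolding M by (rule mean_num_limit_cycles_le(2)[OF \<delta>1 v])
qed simp

end
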